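(* Let $\Upsilon=\{\Theta_d\}_{d\in\mathbb{N}}$ be a uniformly discrete triangular family with separation constant $\delta(\Upsilon)$, where $\Theta_d=\{\theta_j(d)\}_{j=0}^{d-1}\subset[0,1]$ has $d$ elements. For $d\in\mathbb{N}$ and $j=0,\dots,d-1$ denote $\mu_j^{(d)}=\theta_j(d)-\frac jd$, and for $N\in\mathbb{N}$ let $$\rho(N):=\sup\Big|\frac dN\sum_{j=mN}^{(m+1)N-1}\mu_j^{(d)}\Big|,$$ where the supremum is taken over $d\in\mathbb{N}$ and $m=0,\dots,d-1$, and the variable $j$ in the sum is understood modulo $d$. Assume that there exists $L>0$ so that for every $d\in\mathbb{N}$ and $j=0,\dots,d-1$ we have $|\mu_j^{(d)}|<L/d$. If there exists $N\in\mathbb{N}$ so that $\rho(N)<1/4$, then $\Upsilon$ is a minimal MZ family and its lower MZ bound satisfies $$A(\Upsilon)\geq\frac{1}{7\delta(\Upsilon)}\,e^{-\frac{960\pi L^2N}{\delta(\Upsilon)(1-4\rho)^2}}\,\sin^2\!\Big(\frac\pi4(1-4\rho)\Big),$$ where $\rho:=\rho(N)$.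
   Context: $\mathbb{N}=\{1,2,\dots\}$. A triangular family is a family $\Upsilon=\{\Theta_d\}_{d\in\mathbb{N}}$ of finite sets $\Theta_d\subset[0,1]$; it is minimal if $|\Theta_d|=d$ for every $d$. It is uniformly discrete if there is $\delta>0$ with $|\theta_1-\theta_2|\geq\delta/d$ (mod 1) for every $d$ and all distinct $\theta_1,\theta_2\in\Theta_d$; the largest such $\delta$ is the separation constant $\delta(\Upsilon)$. $\mathcal{P}_{d-1}$ is the space of polynomials $p(z)=a_0+a_1z+\dots+a_{d-1}z^{d-1}$ with complex coefficients, with $\|p\|_{L^2(\mathbb{T})}^2=\int_0^1|p(e^{2\pi it})|^2dt=\sum|a_j|^2$. A minimal triangular family is a minimal Marcinkiewicz–Zygmund (MZ) family if there are $A,B>0$ such that for every $d\in\mathbb{N}$ $$A\|p\|_{L^2(\mathbb{T})}^2\leq\frac1d\sum_{\theta\in\Theta_d}|p(e^{2\pi i\theta})|^2\leq B\|p\|_{L^2(\mathbb{T})}^2\qquad\forall p\in\mathcal{P}_{d-1}.$$ The largest such $A$ is the lower MZ bound $A(\Upsilon)$. *)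

theory Defs
  imports "HOL-Analysis.Analysis" "HOL-Computational_Algebra.Polynomial"
begin

text \<open>
  A family indexed by the positive integers is a function on \<^typ>\<open>nat\<close> whose value at \<open>0\<close>
  is irrelevant.
\<close>

definition triangular_family :: "(nat \<Rightarrow> real set) \<Rightarrow> bool" where
  "triangular_family \<Theta> \<longleftrightarrow> (\<forall>d\<ge>1. finite (\<Theta> d) \<and> \<Theta> d \<subseteq> {0..1})"

definition minimal_family :: "(nat \<Rightarrow> real set) \<Rightarrow> bool" where
  "minimal_family \<Theta> \<longleftrightarrow> triangular_family \<Theta> \<and> (\<forall>d\<ge>1. card (\<Theta> d) = d)"

text \<open>The distance modulo 1 of two reals is the distance of their difference to \<open>\<int>\<close>.\<close>

definition separated_by :: "(nat \<Rightarrow> real set) \<Rightarrow> real \<Rightarrow> bool" where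
  "separated_by \<Theta> \<delta> \<longleftrightarrow>
    (\<forall>d\<ge>1. \<forall>x\<in>\<Theta> d. \<forall>y\<in>\<Theta> d. x \<noteq> y \<longrightarrow> infdist (x - y) \<int> \<ge> \<delta> / real d)"

definition uniformly_discrete :: "(nat \<Rightarrow> real set) \<Rightarrow> bool" where
  "uniformly_discrete \<Theta> \<longleftrightarrow> triangular_family \<Theta> \<and> (\<exists>\<delta>>0. separated_by \<Theta> \<delta>)"

text \<open>
  The condition is closed in \<open>\<delta>\<close>, and for a minimal family the case \<open>d = 2\<close> bounds \<open>\<delta>\<close> by 1;
  so for a minimal uniformly discrete family this supremum is the largest admissible \<open>\<delta>\<close>.
\<close>

definition separation_constant :: "(nat \<Rightarrow> real set) \<Rightarrow> real" where
  "separation_constant \<Theta> = Sup {\<delta>. \<delta> > 0 \<and> separated_by \<Theta> \<delta>}"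

definition L2_norm_circle :: "complex poly \<Rightarrow> real" where
  "L2_norm_circle p = sqrt (integral {0..1} (\<lambda>t. (cmod (poly p (cis (2 * pi * t))))\<^sup>2))"

text \<open>For \<open>d \<ge> 1\<close>, \<open>degree p < d\<close> describes the space \<open>P\<^sub>d\<^sub>-\<^sub>1\<close>, including \<open>p = 0\<close>.\<close>

definition MZ_bounds :: "(nat \<Rightarrow> real set) \<Rightarrow> real \<Rightarrow> real \<Rightarrow> bool" where
  "MZ_bounds \<Theta> A B \<longleftrightarrow>
    (\<forall>d\<ge>1. \<forall>p::complex poly. degree p < d \<longrightarrow>
       A * (L2_norm_circle p)\<^sup>2 \<le> 1 / real d * (\<Sum>t\<in>\<Theta> d. (cmod (poly p (cis (2 * pi * t))))\<^sup>2) \<and>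
       1 / real d * (\<Sum>t\<in>\<Theta> d. (cmod (poly p (cis (2 * pi * t))))\<^sup>2) \<le> B * (L2_norm_circle p)\<^sup>2)"

definition minimal_MZ_family :: "(nat \<Rightarrow> real set) \<Rightarrow> bool" where
  "minimal_MZ_family \<Theta> \<longleftrightarrow> minimal_family \<Theta> \<and> (\<exists>A>0. \<exists>B>0. MZ_bounds \<Theta> A B)"

text \<open>
  For a minimal MZ family this is the largest lower bound: the condition is closed in \<open>A\<close>, and
  \<open>d = 1\<close>, \<open>p = 1\<close> forces \<open>A \<le> 1\<close>.
\<close>

definition lower_MZ_bound :: "(nat \<Rightarrow> real set) \<Rightarrow> real" where
  "lower_MZ_bound \<Theta> = Sup {A. A > 0 \<and> (\<exists>B>0. MZ_bounds \<Theta> A B)}"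

text \<open>Below, \<open>\<theta> d j\<close> is the point with index \<open>j\<close> of level \<open>d\<close>.\<close>

definition deviation :: "(nat \<Rightarrow> nat \<Rightarrow> real) \<Rightarrow> nat \<Rightarrow> nat \<Rightarrow> real" where
  "deviation \<theta> d j = \<theta> d j - real j / real d"

definition max_mean_deviation :: "(nat \<Rightarrow> nat \<Rightarrow> real) \<Rightarrow> nat \<Rightarrow> real" where
  "max_mean_deviation \<theta> N =
    Sup {\<bar>real d / real N * (\<Sum>j = m * N..<(m + 1) * N. deviation \<theta> d (j mod d))\<bar> | d m.
           1 \<le> d \<and> m < d}"

end

theory Submission
  imports Defs "HOL-Complex_Analysis.Cauchy_Integral_Formula"
begin

text \<open>
  Fix a level \<open>d\<close> and put \<open>a\<^sub>j = r cis (2 \<pi> \<theta>\<^sub>j)\<close> with \<open>r = exp (- 2 \<pi> h / d)\<close>: the nodes are pulled inside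
  the disc to a depth of \<open>h\<close> node spacings. If \<open>p\<close> is a polynomial of degree below \<open>d\<close>, then so is
  \<open>p'(z) = p(z/r)\<close>; it has \<open>p'(a\<^sub>j) = p(cis (2 \<pi> \<theta>\<^sub>j))\<close>, and its norm is at least that of \<open>p\<close>. Hence
  it suffices to bound the norm of \<open>p'\<close> by its values at the points \<open>a\<^sub>j\<close>.

  Let \<open>B\<close> be the Blaschke product with zeros \<open>a\<^sub>j\<close>. On the circle \<open>p cnj(B) = E + g\<close>, where \<open>g\<close> is a
  polynomial and \<open>E\<close> is a combination of the functions \<open>1 / (z - a\<^sub>j)\<close> whose coefficients are the values
  \<open>p(a\<^sub>j)\<close> up to explicit factors; the two parts are orthogonal. Since \<open>deg p < d\<close>, \<open>p\<close> is orthogonal to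
  \<open>z\<^sup>d g\<close>, and therefore \<open>\<langle>g, g\<rangle> = \<langle>p, B g\<rangle> = \<langle>p, (B - \<gamma> z\<^sup>d) g\<rangle>\<close> for every constant \<open>\<gamma>\<close>. So if \<open>B z\<^sup>-\<^sup>d\<close> stays
  within distance \<open>\<eta> < 1\<close> of a constant, then \<open>g\<close> carries at most the fraction \<open>\<eta>\<^sup>2\<close> of the energy of
  \<open>p\<close>, and \<open>E\<close> at least \<open>1 - \<eta>\<^sup>2\<close> (\<open>blaschke_lower_bound\<close>). The norm of \<open>E\<close> is controlled by its
  coefficients through a bound for the sum of the Poisson kernels of the \<open>a\<^sub>j\<close> (\<open>mean_square_kernel_sum_le\<close>);
  the coefficients involve the products of the pseudohyperbolic distances between the \<open>a\<^sub>j\<close>, which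
  separation bounds below by \<open>exp (- 2 \<pi> h / \<delta>)\<close> (\<open>separated_nodes_product\<close>).

  The hypothesis on the mean deviations enters through the phase of \<open>B z\<^sup>-\<^sup>d\<close>. Moving one zero by the
  angle \<open>2 \<pi> \<mu>\<^sub>j\<close> changes that phase by \<open>2 \<pi> \<mu>\<^sub>j (1 - P)\<close>, with \<open>P\<close> a value of a Poisson kernel of width
  \<open>h / d\<close>. Such a kernel is almost constant on blocks of \<open>N\<close> neighbouring nodes once \<open>h\<close> is large
  against \<open>N + L\<close>, so that only the block averages of the \<open>\<mu>\<^sub>j\<close> count, and the phase differs from a
  constant by at most about \<open>2 \<pi> \<rho> < \<pi> / 2\<close> (\<open>blaschke_product_phase\<close>). With
  \<open>h = 160 L\<^sup>2 N / (1 - 4 \<rho>)\<^sup>2\<close> the errors use up less than half of the gap to \<open>\<pi> / 2\<close>, which yields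
  the factor \<open>sin\<^sup>2 (\<pi> (1 - 4 \<rho>) / 4)\<close>, and the remaining factors multiply to the exponential.

  This choice of \<open>h\<close> requires \<open>L\<close> to be bounded away from zero. For \<open>L < 1/7\<close> a Taylor expansion around
  the roots of unity gives the bound directly (\<open>small_deviation_lower_bound\<close>). The upper bound is
  again the estimate for the sum of the Poisson kernels.
\<close>

section \<open>Means over the unit circle and the Poisson kernel\<close>

definition circle_mean :: "(complex \<Rightarrow> 'b::real_normed_vector) \<Rightarrow> 'b" where
  "circle_mean f = integral {0..1} (\<lambda>t. f (cis (2 * pi * t)))"

lemma circle_integrable:
  fixes f :: "complex \<Rightarrow> 'b::banach"
  assumes "continuous_on (sphere 0 1) f"
  shows "(\<lambda>t. f (cis (2 * pi * t))) integrable_on {0..1}"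
  by (intro integrable_continuous_interval continuous_on_compose2[OF assms] continuous_intros) auto

lemma circle_mean_cong:
  "(\<And>z. cmod z = 1 \<Longrightarrow> f z = g z) \<Longrightarrow> circle_mean f = circle_mean g"
  by (simp add: circle_mean_def)

lemma circle_mean_add:
  fixes f g :: "complex \<Rightarrow> 'b::banach"
  assumes "continuous_on (sphere 0 1) f" "continuous_on (sphere 0 1) g"
  shows "circle_mean (\<lambda>z. f z + g z) = circle_mean f + circle_mean g"
  unfolding circle_mean_def
  by (rule Henstock_Kurzweil_Integration.integral_add[OF circle_integrable[OF assms(1)] circle_integrable[OF assms(2)]])

lemma circle_mean_cmult:
  fixes f :: "complex \<Rightarrow> 'b::{real_normed_field,banach}"
  shows "circle_mean (\<lambda>z. c * f z) = c * circle_mean f"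
  unfolding circle_mean_def by (rule integral_mult_right)

lemma circle_mean_sum:
  fixes f :: "'i \<Rightarrow> complex \<Rightarrow> 'b::banach"
  assumes "finite I" "\<And>i. i \<in> I \<Longrightarrow> continuous_on (sphere 0 1) (f i)"
  shows "circle_mean (\<lambda>z. \<Sum>i\<in>I. f i z) = (\<Sum>i\<in>I. circle_mean (f i))"
  unfolding circle_mean_def by (intro integral_sum assms circle_integrable) auto

lemma circle_mean_mono:
  fixes f g :: "complex \<Rightarrow> real"
  assumes "continuous_on (sphere 0 1) f" "continuous_on (sphere 0 1) g"
    and "\<And>z. cmod z = 1 \<Longrightarrow> f z \<le> g z"
  shows "circle_mean f \<le> circle_mean g"
  unfolding circle_mean_def by (intro integral_le circle_integrable assms) auto

lemma norm_circle_mean_le: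
  fixes f :: "complex \<Rightarrow> complex"
  assumes "continuous_on (sphere 0 1) f" "continuous_on (sphere 0 1) g"
    and "\<And>z. cmod z = 1 \<Longrightarrow> cmod (f z) \<le> g z"
  shows "cmod (circle_mean f) \<le> circle_mean g"
  unfolding circle_mean_def by (intro integral_norm_bound_integral circle_integrable assms) auto

lemma circle_mean_cnj: "circle_mean (\<lambda>z. cnj (f z)) = cnj (circle_mean f)"
  unfolding circle_mean_def by (simp add: integral_cnj)

lemma circle_mean_of_real:
  assumes "continuous_on (sphere 0 1) f"
  shows "circle_mean (\<lambda>z. complex_of_real (f z)) = of_real (circle_mean f)"
  unfolding circle_mean_def
  using integral_linear[OF circle_integrable[OF assms] bounded_linear_of_real]
  by (simp add: o_def)

lemma circle_mean_cauchy:
  assumes "f holomorphic_on cball 0 1" "cmod a < 1"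
  shows "circle_mean (\<lambda>z. f z * (z / (z - a))) = f a"
proof -
  have "((\<lambda>u. f u / (u - a)) has_contour_integral (2 * of_real pi * \<i> * f a)) (circlepath 0 1)"
    using assms by (intro Cauchy_integral_circlepath_simple) auto
  moreover have "circlepath 0 1 t = cis (2*pi*t)"
    and "t \<in> {0..1} \<Longrightarrow> vector_derivative (circlepath 0 1) (at t within {0..1})
            = 2 * of_real pi * \<i> * cis (2*pi*t)" for t
    by (auto simp: vector_derivative_circlepath01) (auto simp: circlepath cis_conv_exp mult_ac)
  ultimately have "((\<lambda>t. f (cis (2*pi*t)) / (cis (2*pi*t) - a) * (2 * of_real pi * \<i> * cis (2*pi*t)))
            has_integral (2 * of_real pi * \<i> * f a)) {0..1}"
    unfolding has_contour_integral_def by (subst has_integral_cong) auto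
  hence "((\<lambda>t. (2 * of_real pi * \<i>) * (f (cis (2*pi*t)) * (cis (2*pi*t) / (cis (2*pi*t) - a))))
            has_integral (2 * of_real pi * \<i>) * f a) {0..1}"
    by (simp add: mult_ac)
  hence "((\<lambda>t. f (cis (2*pi*t)) * (cis (2*pi*t) / (cis (2*pi*t) - a))) has_integral f a) {0..1}"
    by (subst (asm) has_integral_mult_right_iff) auto
  thus ?thesis unfolding circle_mean_def by (rule integral_unique)
qed

lemma circle_mean_holomorphic:
  assumes "f holomorphic_on cball 0 1"
  shows "circle_mean f = f 0"
proof -
  have "circle_mean f = circle_mean (\<lambda>z. f z * (z / (z - 0)))"
    by (rule circle_mean_cong) auto
  thus ?thesis using circle_mean_cauchy[OF assms, of 0] by simp
qed

definition poisson :: "complex \<Rightarrow> complex \<Rightarrow> real" where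
  "poisson a z = (1 - (cmod a)\<^sup>2) / (cmod (1 - cnj a * z))\<^sup>2"

lemma one_minus_cnj_mult_nonzero: "cmod a < 1 \<Longrightarrow> cmod z \<le> 1 \<Longrightarrow> 1 - cnj a * z \<noteq> 0"
proof
  assume "cmod a < 1" "cmod z \<le> 1" "1 - cnj a * z = 0"
  hence "1 = cmod (cnj a * z)" by simp
  also have "\<dots> \<le> cmod a * 1"
    unfolding norm_mult complex_mod_cnj using \<open>cmod z \<le> 1\<close> by (intro mult_left_mono) auto
  finally show False using \<open>cmod a < 1\<close> by simp
qed

lemma poisson_nonneg: "cmod a < 1 \<Longrightarrow> poisson a z \<ge> 0"
  unfolding poisson_def by (simp add: abs_square_le_1)

lemma continuous_on_poisson:
  assumes "cmod a < 1"
  shows "continuous_on (sphere 0 1) (poisson a)"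
  unfolding poisson_def using one_minus_cnj_mult_nonzero[OF assms]
  by (intro continuous_intros) auto

lemma holomorphic_kernel:
  assumes "cmod a < 1"
  shows "(\<lambda>z. 1 / (1 - cnj a * z)) holomorphic_on cball 0 1"
  using one_minus_cnj_mult_nonzero[OF assms] by (intro holomorphic_intros) auto

lemma cnj_unit: "cmod z = 1 \<Longrightarrow> cnj z = 1 / z"
  by (metis divide_conv_cnj mult_1)

text \<open>
  On the circle the Poisson kernel is \<open>(1 - |a|\<^sup>2) / (1 - cnj a z)\<close> times \<open>z / (z - a)\<close>, so the formula is
  Cauchy's for the function \<open>f / (1 - cnj a z)\<close>.
\<close>

lemma circle_poisson:
  assumes "f holomorphic_on cball 0 1" "cmod a < 1"
  shows "circle_mean (\<lambda>z. f z * of_real (poisson a z)) = f a"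
proof -
  have h: "(\<lambda>z. f z * ((1 - (cmod a)\<^sup>2) * (1 / (1 - cnj a * z)))) holomorphic_on cball 0 1"
    by (intro holomorphic_on_mult assms holomorphic_kernel holomorphic_on_const)
  have eq: "f z * of_real (poisson a z) = f z * ((1 - (cmod a)\<^sup>2) * (1 / (1 - cnj a * z))) * (z / (z - a))"
    if "cmod z = 1" for z
  proof -
    have z: "z \<noteq> 0" using that by auto
    have "cnj (1 - cnj a * z) = (z - a) / z"
      using z by (simp add: cnj_unit[OF that] diff_divide_distrib)
    hence "of_real ((cmod (1 - cnj a * z))\<^sup>2) = (1 - cnj a * z) * ((z - a) / z)"
      by (metis complex_norm_square)
    thus ?thesis by (simp add: poisson_def)
  qed
  have "circle_mean (\<lambda>z. f z * of_real (poisson a z)) =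
        circle_mean (\<lambda>z. f z * ((1 - (cmod a)\<^sup>2) * (1 / (1 - cnj a * z))) * (z / (z - a)))"
    using eq by (rule circle_mean_cong)
  also have "\<dots> = f a * ((1 - (cmod a)\<^sup>2) * (1 / (1 - cnj a * a)))"
    by (rule circle_mean_cauchy[OF h assms(2)])
  also have "(1 - (cmod a)\<^sup>2) * (1 / (1 - cnj a * a)) = 1"
    using one_minus_cnj_mult_nonzero[OF assms(2), of a] assms(2)
    by (simp add: complex_norm_square[of a] mult.commute del: of_real_power)
  finally show ?thesis by simp
qed

lemma continuous_on_sphere_holomorphic:
  "f holomorphic_on cball 0 1 \<Longrightarrow> continuous_on (sphere 0 1) f"
  by (meson holomorphic_on_imp_continuous_on continuous_on_subset sphere_cball)

text \<open>
  The Poisson formula for \<open>f\<^sup>2\<close> bounds each \<open>|f(a\<^sub>j)|\<^sup>2\<close> by a Poisson mean of \<open>|f|\<^sup>2\<close>. This turns a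
  pointwise bound for the sum of the kernels into a Carleson embedding with the same constant.
\<close>

lemma sum_square_values_le:
  assumes f: "f holomorphic_on cball 0 1" and J: "finite J"
    and a: "\<And>j. j \<in> J \<Longrightarrow> cmod (a j) < 1"
    and M: "\<And>z. cmod z = 1 \<Longrightarrow> (\<Sum>j\<in>J. poisson (a j) z) \<le> M"
  shows "(\<Sum>j\<in>J. (cmod (f (a j)))\<^sup>2) \<le> M * circle_mean (\<lambda>z. (cmod (f z))\<^sup>2)"
proof -
  have c: "continuous_on (sphere 0 1) f" using f by (rule continuous_on_sphere_holomorphic)
  have "(cmod (f (a j)))\<^sup>2 \<le> circle_mean (\<lambda>z. (cmod (f z))\<^sup>2 * poisson (a j) z)" if j: "j \<in> J" for j
  proof -
    have "(\<lambda>z. f z ^ 2) holomorphic_on cball 0 1" using f by (intro holomorphic_intros)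
    from circle_poisson[OF this a[OF j]]
    have "(cmod (f (a j)))\<^sup>2 = cmod (circle_mean (\<lambda>z. f z ^ 2 * of_real (poisson (a j) z)))"
      by (simp add: norm_power)
    also have "\<dots> \<le> circle_mean (\<lambda>z. (cmod (f z))\<^sup>2 * poisson (a j) z)"
      using a[OF j] c
      by (intro norm_circle_mean_le continuous_intros continuous_on_poisson)
         (auto simp: norm_mult norm_power poisson_nonneg)
    finally show ?thesis .
  qed
  hence "(\<Sum>j\<in>J. (cmod (f (a j)))\<^sup>2) \<le> (\<Sum>j\<in>J. circle_mean (\<lambda>z. (cmod (f z))\<^sup>2 * poisson (a j) z))"
    by (rule sum_mono)
  also have "\<dots> = circle_mean (\<lambda>z. \<Sum>j\<in>J. (cmod (f z))\<^sup>2 * poisson (a j) z)"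
    using a c J by (intro circle_mean_sum[symmetric] continuous_intros continuous_on_poisson) auto
  also have "\<dots> \<le> circle_mean (\<lambda>z. M * (cmod (f z))\<^sup>2)"
  proof (rule circle_mean_mono)
    fix z :: complex assume "cmod z = 1"
    from mult_left_mono[OF M[OF this], of "(cmod (f z))\<^sup>2"]
    show "(\<Sum>j\<in>J. (cmod (f z))\<^sup>2 * poisson (a j) z) \<le> M * (cmod (f z))\<^sup>2"
      by (simp add: sum_distrib_left[symmetric] mult.commute[of M])
  qed (use a c in \<open>auto intro!: continuous_intros continuous_on_poisson\<close>)
  finally show ?thesis by (simp only: circle_mean_cmult)
qed

section \<open>Lower bounds from the phase of a Blaschke product\<close>

text \<open>
  Dual form of the preceding embedding. On the circle \<open>cnj E = z H\<close> with \<open>H\<close> holomorphic in the disc, so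
  Cauchy's formula gives \<open>\<langle>E, E\<rangle> = \<Sum>\<^sub>j e\<^sub>j H(a\<^sub>j)\<close>, and the values of \<open>H\<close> are controlled by its norm,
  which is that of \<open>E\<close>.
\<close>

lemma mean_square_kernel_sum_le:
  fixes a e :: "'i \<Rightarrow> complex"
  assumes J: "finite J" and a: "\<And>j. j \<in> J \<Longrightarrow> cmod (a j) < 1"
    and M: "\<And>z. cmod z = 1 \<Longrightarrow> (\<Sum>j\<in>J. poisson (a j) z) \<le> M" and "M > 0"
  shows "circle_mean (\<lambda>z. (cmod (\<Sum>j\<in>J. e j / (z - a j)))\<^sup>2) \<le> M * (\<Sum>j\<in>J. (cmod (e j))\<^sup>2)"
proof -
  define E where "E = (\<lambda>z. \<Sum>j\<in>J. e j / (z - a j))"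
  define H where "H = (\<lambda>z. \<Sum>j\<in>J. cnj (e j) * (1 / (1 - cnj (a j) * z)))"
  have holH: "H holomorphic_on cball 0 1"
    unfolding H_def by (intro holomorphic_on_sum holomorphic_on_mult holomorphic_kernel a) auto
  have cH: "continuous_on (sphere 0 1) H" using holH by (rule continuous_on_sphere_holomorphic)
  have ne: "z - a j \<noteq> 0" if "cmod z = 1" "j \<in> J" for z j using a[OF that(2)] that(1) by auto
  have cE: "continuous_on (sphere 0 1) E" unfolding E_def using ne by (intro continuous_intros) auto
  have cnjE: "cnj (E z) = z * H z" if z: "cmod z = 1" for z
  proof -
    have "cnj (e j / (z - a j)) = z * (cnj (e j) * (1 / (1 - cnj (a j) * z)))" if "j \<in> J" for j
    proof -
      have "z \<noteq> 0" using z by auto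
      hence "cnj (z - a j) = (1 - cnj (a j) * z) / z" by (simp add: cnj_unit[OF z] diff_divide_distrib)
      thus ?thesis by simp
    qed
    thus ?thesis unfolding E_def H_def by (simp add: sum_distrib_left)
  qed
  have norm_eq: "cmod (E z) = cmod (H z)" if "cmod z = 1" for z
    using arg_cong[OF cnjE[OF that], of cmod] that by (simp add: norm_mult)
  let ?n = "circle_mean (\<lambda>z. (cmod (E z))\<^sup>2)"
  have "complex_of_real ?n = circle_mean (\<lambda>z. of_real ((cmod (E z))\<^sup>2))"
    by (rule circle_mean_of_real[symmetric]) (intro continuous_intros cE)
  also have "\<dots> = circle_mean (\<lambda>z. \<Sum>j\<in>J. e j * (H z * (z / (z - a j))))"
  proof (rule circle_mean_cong)
    fix z :: complex assume z: "cmod z = 1"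
    have "complex_of_real ((cmod (E z))\<^sup>2) = E z * (z * H z)"
      by (simp only: complex_norm_square cnjE[OF z])
    thus "complex_of_real ((cmod (E z))\<^sup>2) = (\<Sum>j\<in>J. e j * (H z * (z / (z - a j))))"
      by (simp add: E_def sum_distrib_left sum_distrib_right mult_ac)
  qed
  also have "\<dots> = (\<Sum>j\<in>J. e j * H (a j))"
  proof (subst circle_mean_sum)
    show "(\<Sum>j\<in>J. circle_mean (\<lambda>z. e j * (H z * (z / (z - a j))))) = (\<Sum>j\<in>J. e j * H (a j))"
      by (intro sum.cong refl) (simp only: circle_mean_cmult circle_mean_cauchy[OF holH a])
  qed (use ne J in \<open>auto intro!: continuous_intros cH\<close>)
  finally have "complex_of_real ?n = (\<Sum>j\<in>J. e j * H (a j))" .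
  hence "?n \<le> cmod (\<Sum>j\<in>J. e j * H (a j))"
    by (metis abs_ge_self norm_of_real)
  also have "\<dots> \<le> (\<Sum>j\<in>J. cmod (e j) * cmod (H (a j)))"
    by (rule order_trans[OF norm_sum]) (simp add: norm_mult)
  also have "\<dots> \<le> (\<Sum>j\<in>J. (M * (cmod (e j))\<^sup>2 + (cmod (H (a j)))\<^sup>2 / M) / 2)"
  proof (rule sum_mono)
    fix j
    have "0 \<le> (M * cmod (e j) - cmod (H (a j)))\<^sup>2 / M" using \<open>M > 0\<close> by simp
    also have "\<dots> = M * (cmod (e j))\<^sup>2 + (cmod (H (a j)))\<^sup>2 / M - 2 * (cmod (e j) * cmod (H (a j)))"
      using \<open>M > 0\<close> by (simp add: power2_eq_square field_simps)
    finally show "cmod (e j) * cmod (H (a j)) \<le> (M * (cmod (e j))\<^sup>2 + (cmod (H (a j)))\<^sup>2 / M) / 2" by simp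
  qed
  also have "\<dots> = (M * (\<Sum>j\<in>J. (cmod (e j))\<^sup>2) + (\<Sum>j\<in>J. (cmod (H (a j)))\<^sup>2) / M) / 2"
    by (simp add: sum_divide_distrib[symmetric] sum.distrib sum_distrib_left)
  also have "(\<Sum>j\<in>J. (cmod (H (a j)))\<^sup>2) \<le> M * circle_mean (\<lambda>z. (cmod (H z))\<^sup>2)"
    by (rule sum_square_values_le[OF holH J a M])
  also have "circle_mean (\<lambda>z. (cmod (H z))\<^sup>2) = ?n"
    by (rule circle_mean_cong) (simp add: norm_eq)
  finally show ?thesis using \<open>M > 0\<close> by (simp add: E_def divide_right_mono field_simps)
qed

lemma prod_linear_dvd:
  fixes a :: "'i \<Rightarrow> complex"
  assumes "finite J" "inj_on a J" "\<And>j. j \<in> J \<Longrightarrow> poly D (a j) = 0"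
  shows "(\<Prod>j\<in>J. [:- a j, 1:]) dvd D"
  using assms
proof (induction J)
  case (insert x F)
  then obtain q where q: "D = (\<Prod>j\<in>F. [:- a j, 1:]) * q" by (auto simp: dvd_def)
  have "poly D (a x) = 0" by (rule insert.prems(2)) simp
  moreover have "(\<Prod>j\<in>F. a x - a j) \<noteq> 0"
    using insert by (auto simp: inj_on_def)
  ultimately have "poly q (a x) = 0" by (simp add: q poly_prod)
  hence "[:- a x, 1:] * (\<Prod>j\<in>F. [:- a j, 1:]) dvd q * (\<Prod>j\<in>F. [:- a j, 1:])"
    by (intro mult_dvd_mono) (simp_all add: poly_eq_0_iff_dvd)
  thus ?case unfolding q prod.insert[OF insert.hyps] by (simp only: mult.commute)
qed auto

text \<open>
  Lagrange interpolation written as division with remainder: the sum on the right is the remainder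
  of \<open>R\<close> modulo the node polynomial, divided by that polynomial, in partial fractions.
\<close>

lemma division_by_nodes:
  fixes a :: "'i \<Rightarrow> complex" and R :: "complex poly"
  assumes "finite J" "inj_on a J"
  obtains g where "\<And>z. (\<And>j. j \<in> J \<Longrightarrow> z \<noteq> a j) \<Longrightarrow>
     poly R z / (\<Prod>j\<in>J. z - a j) =
       poly g z + (\<Sum>j\<in>J. poly R (a j) / (\<Prod>k\<in>J-{j}. a j - a k) / (z - a j))"
proof -
  define c where "c = (\<lambda>j. poly R (a j) / (\<Prod>k\<in>J-{j}. a j - a k))"
  define Q where "Q = (\<Sum>j\<in>J. smult (c j) (\<Prod>k\<in>J-{j}. [:- a k, 1:]))"
  have "poly (R - Q) (a i) = 0" if i: "i \<in> J" for i
  proof -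
    have "poly Q (a i) = (\<Sum>j\<in>J. if j = i then c i * (\<Prod>k\<in>J-{i}. a i - a k) else 0)"
      unfolding Q_def poly_sum using i assms by (intro sum.cong) (auto simp: poly_prod)
    also have "\<dots> = c i * (\<Prod>k\<in>J-{i}. a i - a k)" using i assms by simp
    also have "\<dots> = poly R (a i)" unfolding c_def using i assms by (auto simp: inj_on_def)
    finally show ?thesis by simp
  qed
  with prod_linear_dvd[OF assms, of "R - Q"] obtain g where g: "R - Q = (\<Prod>j\<in>J. [:- a j, 1:]) * g"
    by (auto simp: dvd_def)
  show ?thesis
  proof (rule that)
    fix z assume z: "\<And>j. j \<in> J \<Longrightarrow> z \<noteq> a j"
    have nz: "(\<Prod>j\<in>J. z - a j) \<noteq> 0" using z assms by auto
    have "poly R z = poly (R - Q) z + poly Q z" by simp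
    also have "\<dots> = (\<Prod>j\<in>J. z - a j) * poly g z + (\<Sum>j\<in>J. c j * (\<Prod>k\<in>J-{j}. z - a k))"
      unfolding g by (simp add: Q_def poly_prod poly_sum)
    finally have "poly R z / (\<Prod>j\<in>J. z - a j) =
        poly g z + (\<Sum>j\<in>J. c j * (\<Prod>k\<in>J-{j}. z - a k) / (\<Prod>j\<in>J. z - a j))"
      using nz by (simp add: add_divide_distrib sum_divide_distrib)
    also have "(\<Sum>j\<in>J. c j * (\<Prod>k\<in>J-{j}. z - a k) / (\<Prod>j\<in>J. z - a j)) = (\<Sum>j\<in>J. c j / (z - a j))"
    proof (rule sum.cong)
      fix j assume "j \<in> J"
      hence "(\<Prod>j\<in>J. z - a j) = (z - a j) * (\<Prod>k\<in>J-{j}. z - a k)"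
        using assms by (simp add: prod.remove)
      thus "c j * (\<Prod>k\<in>J-{j}. z - a k) / (\<Prod>j\<in>J. z - a j) = c j / (z - a j)"
        using nz by auto
    qed simp
    finally show "poly R z / (\<Prod>j\<in>J. z - a j) =
       poly g z + (\<Sum>j\<in>J. poly R (a j) / (\<Prod>k\<in>J-{j}. a j - a k) / (z - a j))"
      by (simp add: c_def)
  qed
qed

text \<open>
  On the circle \<open>cnj(p) z\<^sup>n\<close> agrees with a polynomial that vanishes at the origin.
\<close>

lemma circle_mean_poly_orthogonal:
  fixes p :: "complex poly"
  assumes "degree p < n" "f holomorphic_on cball 0 1"
  shows "circle_mean (\<lambda>z. poly p z * cnj (z ^ n * f z)) = 0"
proof -
  define q where "q = (\<lambda>z. (\<Sum>k\<le>degree p. cnj (coeff p k) * z ^ (n - k)) * f z)"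
  have "poly p z * cnj (z ^ n * f z) = cnj (q z)" if z: "cmod z = 1" for z
  proof -
    have z0: "z \<noteq> 0" using z by auto
    have "cnj (poly p z) * z ^ n = (\<Sum>k\<le>degree p. cnj (coeff p k) * z ^ (n - k))"
      unfolding poly_altdef cnj_sum sum_distrib_right
    proof (rule sum.cong)
      fix k assume "k \<in> {..degree p}"
      hence "z ^ n = z ^ k * z ^ (n - k)" using assms by (simp add: power_add[symmetric])
      thus "cnj (coeff p k * z ^ k) * z ^ n = cnj (coeff p k) * z ^ (n - k)"
        using z0 by (simp add: cnj_unit[OF z] power_divide)
    qed simp
    hence "cnj (poly p z * cnj (z ^ n * f z)) = q z" by (simp add: q_def mult_ac)
    thus ?thesis by (metis complex_cnj_cnj)
  qed
  hence "circle_mean (\<lambda>z. poly p z * cnj (z ^ n * f z)) = circle_mean (\<lambda>z. cnj (q z))"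
    by (rule circle_mean_cong)
  also have "\<dots> = cnj (q 0)"
    unfolding circle_mean_cnj using assms(2)
    by (subst circle_mean_holomorphic) (auto simp: q_def intro!: holomorphic_intros)
  also have "q 0 = 0" unfolding q_def using assms(1) by (auto simp: zero_power intro!: sum.neutral)
  finally show ?thesis by simp
qed

text \<open>
  The function \<open>p cnj(B)\<close> splits on the circle into a polynomial \<open>g\<close> and an orthogonal part \<open>E\<close> with
  poles at the nodes. The polynomial part satisfies \<open>\<langle>g, g\<rangle> = \<langle>p, (B - \<gamma> z\<^sup>d) g\<rangle>\<close> and so has norm at most
  \<open>\<eta>\<close> times that of \<open>p\<close>; the rest of the energy of \<open>p\<close> sits in \<open>E\<close>, which depends on \<open>p\<close> only through its
  values at the nodes. The number \<open>\<beta>\<close> is a lower bound for the products of the pseudohyperbolic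
  distances.
\<close>

theorem blaschke_lower_bound:
  fixes p :: "complex poly" and a :: "'i \<Rightarrow> complex"
  assumes J: "finite J" and inj: "inj_on a J" and a: "\<And>j. j \<in> J \<Longrightarrow> cmod (a j) < 1"
    and deg: "degree p < card J"
    and M: "\<And>z. cmod z = 1 \<Longrightarrow> (\<Sum>j\<in>J. poisson (a j) z) \<le> M" and M0: "M > 0"
    and sep: "\<And>j. j \<in> J \<Longrightarrow> \<beta> \<le> (\<Prod>k\<in>J-{j}. cmod (a j - a k) / cmod (1 - cnj (a k) * a j))"
    and \<beta>: "\<beta> > 0"
    and \<eta>: "\<And>z. cmod z = 1 \<Longrightarrow>
        cmod ((\<Prod>j\<in>J. (z - a j) / (1 - cnj (a j) * z)) - \<gamma> * z ^ card J) \<le> \<eta>"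
  shows "(1 - \<eta>\<^sup>2) * circle_mean (\<lambda>z. (cmod (poly p z))\<^sup>2) \<le>
          M / \<beta>\<^sup>2 * (\<Sum>j\<in>J. (1 - (cmod (a j))\<^sup>2)\<^sup>2 * (cmod (poly p (a j)))\<^sup>2)"
proof -
  define R where "R = p * (\<Prod>j\<in>J. [:1, - cnj (a j):])"
  define e where "e = (\<lambda>j. poly R (a j) / (\<Prod>k\<in>J-{j}. a j - a k))"
  define E where "E = (\<lambda>z. \<Sum>j\<in>J. e j / (z - a j))"
  define B where "B = (\<lambda>z. \<Prod>j\<in>J. (z - a j) / (1 - cnj (a j) * z))"
  define H where "H = (\<lambda>z. \<Sum>j\<in>J. cnj (e j) * (1 / (1 - cnj (a j) * z)))"
  obtain g where g: "\<And>z. (\<And>j. j \<in> J \<Longrightarrow> z \<noteq> a j) \<Longrightarrow> poly R z / (\<Prod>j\<in>J. z - a j) = poly g z + E z"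
    using division_by_nodes[OF J inj, of R] unfolding E_def e_def by blast
  have ne: "z \<noteq> a j" if "cmod z = 1" "j \<in> J" for z j using a[OF that(2)] that(1) by auto
  have ne': "1 - cnj (a j) * z \<noteq> 0" if "cmod z \<le> 1" "j \<in> J" for z j
    using one_minus_cnj_mult_nonzero[OF a] that by blast
  have cB: "continuous_on (sphere 0 1) B" unfolding B_def using ne' by (intro continuous_intros) auto
  have cE: "continuous_on (sphere 0 1) E" unfolding E_def using ne by (intro continuous_intros) auto
  have cnjfac: "cnj (z - a j) = (1 - cnj (a j) * z) / z" if z: "cmod z = 1" for z j
  proof -
    have "z \<noteq> 0" using z by auto
    thus ?thesis by (simp add: cnj_unit[OF z] diff_divide_distrib)
  qed
  have cnjfac': "cnj (1 - cnj (a j) * z) = (z - a j) / z" if z: "cmod z = 1" for z j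
  proof -
    have "z \<noteq> 0" using z by auto
    thus ?thesis by (simp add: cnj_unit[OF z] diff_divide_distrib)
  qed
  have cnjE: "cnj (E z) = z * H z" if z: "cmod z = 1" for z
    unfolding E_def H_def using z by (auto simp: cnjfac[OF z] sum_distrib_left intro!: sum.cong simp del: complex_cnj_diff)
  have cnjB: "cnj (B z) = (\<Prod>j\<in>J. (1 - cnj (a j) * z) / (z - a j))" if z: "cmod z = 1" for z
  proof -
    have "z \<noteq> 0" using z by auto
    thus ?thesis unfolding B_def 
      by (auto simp: cnjfac[OF z] cnjfac'[OF z] intro!: prod.cong simp del: complex_cnj_diff)
  qed
  have BB: "B z * cnj (B z) = 1" if z: "cmod z = 1" for z
    unfolding cnjB[OF z] unfolding B_def prod.distrib[symmetric]
    using ne[OF z] ne'[OF eq_refl[OF z]] by (intro prod.neutral) auto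
  have normB: "cmod (B z) = 1" if z: "cmod z = 1" for z
  proof -
    have "complex_of_real ((cmod (B z))\<^sup>2) = 1" by (simp only: complex_norm_square BB[OF z])
    hence "(cmod (B z))\<^sup>2 = 1" using of_real_eq_1_iff by blast
    thus ?thesis by (simp add: abs_square_eq_1)
  qed
  have decomp: "poly p z * cnj (B z) = poly g z + E z" if z: "cmod z = 1" for z
    using g[of z] ne[OF z] by (simp add: cnjB[OF z] R_def poly_prod prod_dividef mult.commute)
  have cp: "continuous_on (sphere 0 1) (poly p)" "continuous_on (sphere 0 1) (poly g)"
    by (intro continuous_intros)+
  note cont = continuous_intros cB cE cp
  \<comment> \<open>The conjugate of \<open>E\<close> is \<open>z H\<close>, which is holomorphic in the disc and vanishes at the origin.\<close>
  have orth: "circle_mean (\<lambda>z. E z * cnj (poly g z)) = 0"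
  proof -
    have hol: "(\<lambda>z. z * H z * poly g z) holomorphic_on cball 0 1"
      unfolding H_def using a by (intro holomorphic_intros holomorphic_kernel) auto
    have "circle_mean (\<lambda>z. E z * cnj (poly g z)) = circle_mean (\<lambda>z. cnj (z * H z * poly g z))"
      by (rule circle_mean_cong) (metis cnjE complex_cnj_cnj complex_cnj_mult)
    thus ?thesis by (simp only: circle_mean_cnj circle_mean_holomorphic[OF hol]) simp
  qed
  have norm_p: "circle_mean (\<lambda>z. (cmod (poly p z))\<^sup>2) =
      circle_mean (\<lambda>z. (cmod (poly g z))\<^sup>2) + circle_mean (\<lambda>z. (cmod (E z))\<^sup>2)"
  proof -
    have pt: "complex_of_real ((cmod (poly p z))\<^sup>2) = complex_of_real ((cmod (poly g z))\<^sup>2 + (cmod (E z))\<^sup>2)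
        + (E z * cnj (poly g z) + cnj (E z * cnj (poly g z)))" if z: "cmod z = 1" for z
    proof -
      have "cmod (poly p z) = cmod (poly g z + E z)"
        using arg_cong[OF decomp[OF z], of cmod] by (simp add: norm_mult normB[OF z])
      hence "complex_of_real ((cmod (poly p z))\<^sup>2) = (poly g z + E z) * cnj (poly g z + E z)"
        by (simp only: complex_norm_square)
      also have "\<dots> = complex_of_real ((cmod (poly g z))\<^sup>2 + (cmod (E z))\<^sup>2)
          + (E z * cnj (poly g z) + cnj (E z * cnj (poly g z)))"
        unfolding of_real_add complex_norm_square by (simp add: algebra_simps)
      finally show ?thesis .
    qed
    have "complex_of_real (circle_mean (\<lambda>z. (cmod (poly p z))\<^sup>2)) =
        circle_mean (\<lambda>z. complex_of_real ((cmod (poly p z))\<^sup>2))"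
      by (intro circle_mean_of_real[symmetric] cont)
    also have "\<dots> = circle_mean (\<lambda>z. complex_of_real ((cmod (poly g z))\<^sup>2 + (cmod (E z))\<^sup>2)
        + (E z * cnj (poly g z) + cnj (E z * cnj (poly g z))))"
      using pt by (rule circle_mean_cong)
    also have "\<dots> = circle_mean (\<lambda>z. complex_of_real ((cmod (poly g z))\<^sup>2 + (cmod (E z))\<^sup>2))
        + (circle_mean (\<lambda>z. E z * cnj (poly g z)) + circle_mean (\<lambda>z. cnj (E z * cnj (poly g z))))"
      by (subst circle_mean_add, (intro cont)+)
         (subst circle_mean_add, (intro cont)+, simp)
    also have "\<dots> = complex_of_real (circle_mean (\<lambda>z. (cmod (poly g z))\<^sup>2 + (cmod (E z))\<^sup>2))"
      unfolding circle_mean_cnj orth by (subst circle_mean_of_real) (intro cont, simp)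
    also have "circle_mean (\<lambda>z. (cmod (poly g z))\<^sup>2 + (cmod (E z))\<^sup>2) =
       circle_mean (\<lambda>z. (cmod (poly g z))\<^sup>2) + circle_mean (\<lambda>z. (cmod (E z))\<^sup>2)"
      by (intro circle_mean_add cont)
    finally show ?thesis by (simp only: of_real_eq_iff)
  qed
  have norm_g: "circle_mean (\<lambda>z. (cmod (poly g z))\<^sup>2) \<le> \<eta>\<^sup>2 * circle_mean (\<lambda>z. (cmod (poly p z))\<^sup>2)"
  proof -
    let ?F = "\<lambda>z. poly p z * cnj ((B z - \<gamma> * z ^ card J) * poly g z)"
    let ?G = "\<lambda>z. poly p z * cnj (z ^ card J * (\<gamma> * poly g z))"
    have pt: "complex_of_real ((cmod (poly g z))\<^sup>2) + E z * cnj (poly g z) = ?F z + ?G z"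
      if z: "cmod z = 1" for z
    proof -
      have "complex_of_real ((cmod (poly g z))\<^sup>2) + E z * cnj (poly g z) = (poly g z + E z) * cnj (poly g z)"
        by (simp only: complex_norm_square) (simp add: algebra_simps)
      also have "\<dots> = ?F z + ?G z"
        unfolding decomp[OF z, symmetric] by (simp add: algebra_simps)
      finally show ?thesis .
    qed
    have "complex_of_real (circle_mean (\<lambda>z. (cmod (poly g z))\<^sup>2)) + 0 =
        circle_mean (\<lambda>z. complex_of_real ((cmod (poly g z))\<^sup>2)) + circle_mean (\<lambda>z. E z * cnj (poly g z))"
      unfolding orth by (subst circle_mean_of_real) (intro cont, simp)
    also have "\<dots> = circle_mean (\<lambda>z. ?F z + ?G z)"
      by (subst circle_mean_add[symmetric], (intro cont)+) (rule circle_mean_cong, rule pt)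
    also have "\<dots> = circle_mean ?F + circle_mean ?G"
      by (intro circle_mean_add cont)
    also have "circle_mean ?G = 0"
      by (intro circle_mean_poly_orthogonal deg holomorphic_intros)
    finally have "complex_of_real (circle_mean (\<lambda>z. (cmod (poly g z))\<^sup>2)) = circle_mean ?F" by simp
    hence "circle_mean (\<lambda>z. (cmod (poly g z))\<^sup>2) \<le> cmod (circle_mean ?F)"
      by (metis abs_ge_self norm_of_real)
    also have "\<dots> \<le> circle_mean (\<lambda>z. (1/2) * (\<eta>\<^sup>2 * (cmod (poly p z))\<^sup>2 + (cmod (poly g z))\<^sup>2))"
    proof (rule norm_circle_mean_le)
      fix z :: complex assume z: "cmod z = 1"
      have "cmod (?F z) = cmod (B z - \<gamma> * z ^ card J) * (cmod (poly p z) * cmod (poly g z))"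
        by (simp only: norm_mult complex_mod_cnj mult_ac)
      also have "\<dots> \<le> \<eta> * (cmod (poly p z) * cmod (poly g z))"
        using \<eta>[OF z] by (intro mult_right_mono) (auto simp: B_def)
      also have "\<dots> \<le> (1/2) * (\<eta>\<^sup>2 * (cmod (poly p z))\<^sup>2 + (cmod (poly g z))\<^sup>2)"
        using sum_squares_ge_zero[of "\<eta> * cmod (poly p z) - cmod (poly g z)" 0]
        by (simp add: power2_eq_square algebra_simps)
      finally show "cmod (?F z) \<le> \<dots>" .
    qed (intro cont)+
    also have "\<dots> = (1/2) * (\<eta>\<^sup>2 * circle_mean (\<lambda>z. (cmod (poly p z))\<^sup>2) + circle_mean (\<lambda>z. (cmod (poly g z))\<^sup>2))"
      unfolding circle_mean_cmult by (subst circle_mean_add) (intro cont, intro cont, simp add: circle_mean_cmult)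
    finally show ?thesis by simp
  qed
  have "circle_mean (\<lambda>z. (cmod (E z))\<^sup>2) \<le> M * (\<Sum>j\<in>J. (cmod (e j))\<^sup>2)"
    unfolding E_def by (rule mean_square_kernel_sum_le[OF J a M M0])
  also have "\<dots> \<le> M * (\<Sum>j\<in>J. (1 - (cmod (a j))\<^sup>2)\<^sup>2 * (cmod (poly p (a j)))\<^sup>2 / \<beta>\<^sup>2)"
  proof (intro mult_left_mono sum_mono)
    fix j assume j: "j \<in> J"
    define P where "P = (\<Prod>k\<in>J-{j}. cmod (a j - a k) / cmod (1 - cnj (a k) * a j))"
    have P: "P \<ge> \<beta>" "P > 0" using sep[OF j] \<beta> by (auto simp: P_def)
    have e: "cmod (e j) = (1 - (cmod (a j))\<^sup>2) * cmod (poly p (a j)) / P"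
    proof -
      have "cmod (1 - cnj (a j) * a j) = 1 - (cmod (a j))\<^sup>2"
      proof -
        have "1 - cnj (a j) * a j = complex_of_real (1 - (cmod (a j))\<^sup>2)"
          by (simp only: of_real_diff complex_norm_square) simp
        thus ?thesis using a[OF j] by (simp only: norm_of_real) (simp add: abs_square_le_1)
      qed
      moreover have "(\<Prod>k\<in>J. cmod (1 - cnj (a k) * a j)) =
          cmod (1 - cnj (a j) * a j) * (\<Prod>k\<in>J-{j}. cmod (1 - cnj (a k) * a j))"
        using J j by (rule prod.remove)
      ultimately show ?thesis
        by (simp add: e_def R_def P_def poly_prod norm_mult norm_divide prod_norm[symmetric] prod_dividef mult_ac)
    qed
    have "(cmod (e j))\<^sup>2 = (1 - (cmod (a j))\<^sup>2)\<^sup>2 * (cmod (poly p (a j)))\<^sup>2 / P\<^sup>2"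
      by (simp add: e power_mult_distrib power_divide)
    also have "\<dots> \<le> (1 - (cmod (a j))\<^sup>2)\<^sup>2 * (cmod (poly p (a j)))\<^sup>2 / \<beta>\<^sup>2"
      using P \<beta> by (intro divide_left_mono power_mono) auto
    finally show "(cmod (e j))\<^sup>2 \<le> \<dots>" .
  qed (use M0 in auto)
  finally show ?thesis using norm_p norm_g
    by (simp add: algebra_simps sum_divide_distrib[symmetric])
qed

section \<open>The Poisson kernel and the Blaschke factor in polar coordinates\<close>

definition circle_poisson_kernel :: "real \<Rightarrow> real \<Rightarrow> real" where
  "circle_poisson_kernel r x = (1 - r\<^sup>2) / (1 - 2 * r * cos x + r\<^sup>2)"

lemma norm_one_minus_cis: "(cmod (1 - of_real r * cis x))\<^sup>2 = 1 - 2 * r * cos x + r\<^sup>2"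
proof -
  have "(cmod (1 - of_real r * cis x))\<^sup>2 = (1 - r * cos x)\<^sup>2 + (r * sin x)\<^sup>2"
    by (simp add: cmod_power2)
  also have "\<dots> = 1 - 2 * r * cos x + r\<^sup>2"
    using sin_cos_squared_add[of x] by algebra
  finally show ?thesis .
qed

lemma poisson_polar:
  "poisson (of_real r * cis \<phi>) (cis y) = circle_poisson_kernel r (y - \<phi>)"
proof -
  have "cnj (of_real r * cis \<phi>) * cis y = of_real r * cis (y - \<phi>)"
    by (simp add: cis_cnj cis_mult)
  thus ?thesis unfolding poisson_def circle_poisson_kernel_def
    by (simp only: norm_one_minus_cis) (simp add: norm_mult)
qed

lemma poisson_denominator_pos:
  fixes r :: real
  assumes "0 \<le> r" "r < 1"
  shows "0 < 1 - 2 * r * cos x + r\<^sup>2"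
proof -
  have "0 < (1 - r)\<^sup>2" using assms by (intro zero_less_power) simp
  also have "\<dots> \<le> (1 - r)\<^sup>2 + 2 * r * (1 - cos x)" using assms by simp
  finally show ?thesis by (simp add: power2_eq_square algebra_simps)
qed

text \<open>
  On the circle the Poisson kernel is \<open>(1 - |a|\<^sup>2) / (1 - cnj a z)\<close> times \<open>z / (z - a)\<close>, so the formula is
  Cauchy's for the function \<open>f / (1 - cnj a z)\<close>.
\<close>

lemma circle_poisson_kernel_pos: "0 \<le> r \<Longrightarrow> r < 1 \<Longrightarrow> 0 < circle_poisson_kernel r x"
  unfolding circle_poisson_kernel_def
  by (intro divide_pos_pos poisson_denominator_pos) (auto simp: abs_square_less_1)

text \<open>
  The logarithmic derivative of the kernel is at most \<open>2 r / (1 - r\<^sup>2)\<close> in absolute value.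
\<close>

lemma poisson_kernel_harnack:
  assumes r: "0 \<le> r" "r < 1"
  shows "circle_poisson_kernel r x \<le> exp (2 * r / (1 - r\<^sup>2) * \<bar>x - y\<bar>) * circle_poisson_kernel r y"
proof -
  define D where "D = (\<lambda>x. 1 - 2 * r * cos x + r\<^sup>2)"
  have D: "D x > 0" for x unfolding D_def using poisson_denominator_pos[OF r] .
  have r2: "1 - r\<^sup>2 > 0" using r by (simp add: abs_square_less_1)
  have bound: "\<bar>2 * r * sin x / D x\<bar> \<le> 2 * r / (1 - r\<^sup>2)" for x
  proof -
    have s: "(sin x)\<^sup>2 = 1 - (cos x)\<^sup>2" using sin_cos_squared_add[of x] by linarith
    have "(D x)\<^sup>2 - ((1 - r\<^sup>2) * sin x)\<^sup>2 = (2 * r - cos x * (1 + r\<^sup>2))\<^sup>2"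
      unfolding D_def power_mult_distrib s by algebra
    hence "((1 - r\<^sup>2) * sin x)\<^sup>2 \<le> (D x)\<^sup>2" by (metis diff_ge_0_iff_ge zero_le_power2)
    hence "\<bar>(1 - r\<^sup>2) * sin x\<bar> \<le> D x" using D[of x] by (simp add: abs_le_square_iff[symmetric])
    hence "(1 - r\<^sup>2) * \<bar>sin x\<bar> \<le> D x" using r2 by (simp add: abs_mult)
    hence "2 * r * ((1 - r\<^sup>2) * \<bar>sin x\<bar>) \<le> 2 * r * D x" using r by (intro mult_left_mono) auto
    thus ?thesis using D[of x] r2 r by (simp add: abs_mult field_simps)
  qed
  have "norm (ln (D y) - ln (D x)) \<le> 2 * r / (1 - r\<^sup>2) * norm (y - x)"
  proof (rule field_differentiable_bound[of UNIV])
    show "((\<lambda>x. ln (D x)) has_field_derivative 2 * r * sin z / D z) (at z within UNIV)" for z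
      using D[of z] unfolding D_def by (auto intro!: derivative_eq_intros)
  qed (use bound in auto)
  hence "ln (D y) \<le> 2 * r / (1 - r\<^sup>2) * \<bar>x - y\<bar> + ln (D x)" by (simp add: abs_minus_commute)
  hence "D y \<le> exp (2 * r / (1 - r\<^sup>2) * \<bar>x - y\<bar>) * D x"
  proof -
    have "exp (ln (D y)) \<le> exp (2 * r / (1 - r\<^sup>2) * \<bar>x - y\<bar> + ln (D x))"
      using \<open>ln (D y) \<le> _\<close> by (rule exp_le_cancel_iff[THEN iffD2])
    thus ?thesis using D[of x] D[of y] by (simp only: exp_add exp_ln)
  qed
  hence "(1 - r\<^sup>2) * D y \<le> (1 - r\<^sup>2) * (exp (2 * r / (1 - r\<^sup>2) * \<bar>x - y\<bar>) * D x)"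
    using r2 by (intro mult_left_mono) auto
  hence "(1 - r\<^sup>2) / D x \<le> exp (2 * r / (1 - r\<^sup>2) * \<bar>x - y\<bar>) * ((1 - r\<^sup>2) / D y)"
    using D[of x] D[of y] by (simp add: divide_simps mult_ac)
  moreover have "circle_poisson_kernel r u = (1 - r\<^sup>2) / D u" for u
    by (simp add: circle_poisson_kernel_def D_def)
  ultimately show ?thesis by (simp only:)
qed

text \<open>
  The argument of \<open>b(z) / z\<close> at \<open>z = cis y\<close>, as a function of \<open>x = y - \<phi>\<close>, where \<open>b\<close> is the Blaschke factor
  with zero \<open>r cis \<phi>\<close>. The arctangent makes it a smooth function on the whole line.
\<close>

definition factor_angle :: "real \<Rightarrow> real \<Rightarrow> real" where
  "factor_angle r x = 2 * arctan (r * sin x / (1 - r * cos x))"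

lemma one_minus_r_cos_pos:
  fixes r :: real
  shows "0 \<le> r \<Longrightarrow> r < 1 \<Longrightarrow> 0 < 1 - r * cos x"
  using mult_left_le[of "cos x" r] cos_le_one[of x] by linarith

lemma cis_factor_angle:
  assumes "0 \<le> r" "r < 1"
  shows "cis (factor_angle r x) = cnj (1 - of_real r * cis x) / (1 - of_real r * cis x)"
proof -
  define c where "c = 1 - r * cos x"
  define t where "t = r * sin x / c"
  have c: "c > 0" unfolding c_def using one_minus_r_cos_pos[OF assms] .
  have u: "1 - of_real r * cis x = of_real c * Complex 1 (- t)"
    using c by (simp add: complex_eq_iff c_def t_def)
  have sq: "(sqrt (1 + t\<^sup>2))\<^sup>2 = 1 + t\<^sup>2" by simp
  have s0: "1 + t\<^sup>2 > 0" by (simp add: add_pos_nonneg)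
  have "cis (arctan t) = Complex 1 t / of_real (sqrt (1 + t\<^sup>2))"
    by (simp add: complex_eq_iff cos_arctan sin_arctan)
  hence "cis (arctan t) ^ 2 = (Complex 1 t)\<^sup>2 / of_real (1 + t\<^sup>2)"
    by (simp add: power_divide sq flip: of_real_power)
  also have "of_real (1 + t\<^sup>2) = Complex 1 t * Complex 1 (- t)"
    by (simp add: complex_eq_iff power2_eq_square)
  also have "(Complex 1 t)\<^sup>2 / (Complex 1 t * Complex 1 (- t)) = Complex 1 t / Complex 1 (- t)"
    by (simp add: power2_eq_square complex_eq_iff)
  also have "\<dots> = cnj (of_real c * Complex 1 (- t)) / (of_real c * Complex 1 (- t))"
    using c by (simp add: complex_cnj)
  finally have "cis (2 * arctan t) = cnj (1 - of_real r * cis x) / (1 - of_real r * cis x)"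
    unfolding u[symmetric] by (simp only: Complex.DeMoivre of_nat_numeral)
  thus ?thesis by (simp add: factor_angle_def t_def c_def)
qed

lemma factor_angle_deriv:
  assumes "0 \<le> r" "r < 1"
  shows "(factor_angle r has_real_derivative circle_poisson_kernel r x - 1) (at x)"
proof -
  have c: "1 - r * cos x > 0" using one_minus_r_cos_pos[OF assms] .
  have D: "1 - 2 * r * cos x + r\<^sup>2 > 0" using poisson_denominator_pos[OF assms] .
  have s: "sin x * sin x = 1 - cos x * cos x"
    using sin_cos_squared_add[of x] by (simp add: power2_eq_square)
  define t where "t = r * sin x / (1 - r * cos x)"
  have t: "1 + t\<^sup>2 = (1 - 2 * r * cos x + r\<^sup>2) / (1 - r * cos x)\<^sup>2"
  proof -
    have "1 + t\<^sup>2 = ((1 - r * cos x)\<^sup>2 + (r * sin x)\<^sup>2) / (1 - r * cos x)\<^sup>2"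
      using c by (simp add: t_def power_divide add_divide_distrib)
    also have "(1 - r * cos x)\<^sup>2 + (r * sin x)\<^sup>2 = 1 - 2 * r * cos x + r\<^sup>2"
      using s by algebra
    finally show ?thesis .
  qed
  have "(factor_angle r has_real_derivative
     2 * (inverse (1 + t\<^sup>2) * ((r * cos x * (1 - r * cos x) - r * sin x * (r * sin x)) / (1 - r * cos x)\<^sup>2))) (at x)"
    unfolding factor_angle_def[abs_def] t_def using c
    by (auto intro!: derivative_eq_intros simp: power2_eq_square)
  also have "2 * (inverse (1 + t\<^sup>2) * ((r * cos x * (1 - r * cos x) - r * sin x * (r * sin x)) / (1 - r * cos x)\<^sup>2))
     = 2 * (r * cos x * (1 - r * cos x) - r * sin x * (r * sin x)) / (1 - 2 * r * cos x + r\<^sup>2)"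
    unfolding t using c D by simp
  also have "2 * (r * cos x * (1 - r * cos x) - r * sin x * (r * sin x)) =
      (1 - r\<^sup>2) - (1 - 2 * r * cos x + r\<^sup>2)"
    using s by algebra
  also have "\<dots> / (1 - 2 * r * cos x + r\<^sup>2) = circle_poisson_kernel r x - 1"
    using D by (simp add: circle_poisson_kernel_def divide_simps)
  finally show ?thesis .
qed

text \<open>
  The mean value theorem for the phase, whose derivative is the Poisson kernel minus its mean value 1.
\<close>

lemma factor_angle_diff:
  assumes "0 \<le> r" "r < 1"
  obtains \<xi> where "\<bar>\<xi> - x\<bar> \<le> \<bar>y - x\<bar>"
    "factor_angle r y - factor_angle r x = (y - x) * (circle_poisson_kernel r \<xi> - 1)"
proof (cases x y rule: linorder_cases)
  case less
  from MVT2[OF less factor_angle_deriv[OF assms]] obtain \<xi> where "x < \<xi>" "\<xi> < y"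
    "factor_angle r y - factor_angle r x = (y - x) * (circle_poisson_kernel r \<xi> - 1)" by blast
  thus ?thesis by (intro that[of \<xi>]) auto
next
  case greater
  from MVT2[OF greater factor_angle_deriv[OF assms]] obtain \<xi> where "y < \<xi>" "\<xi> < x"
    "factor_angle r x - factor_angle r y = (x - y) * (circle_poisson_kernel r \<xi> - 1)" by blast
  thus ?thesis by (intro that[of \<xi>]) (auto simp: algebra_simps)
qed (use that[of x] in auto)

lemma blaschke_factor_polar:
  assumes "0 \<le> r" "r < 1"
  shows "(cis y - of_real r * cis \<phi>) / (1 - cnj (of_real r * cis \<phi>) * cis y) =
           cis y * cis (factor_angle r (y - \<phi>))"
proof -
  have "cis y * cnj (1 - of_real r * cis (y - \<phi>)) = cis y - of_real r * cis \<phi>"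
    by (simp add: cis_cnj algebra_simps cis_mult)
  moreover have "1 - cnj (of_real r * cis \<phi>) * cis y = 1 - of_real r * cis (y - \<phi>)"
    by (simp add: cis_cnj cis_mult)
  ultimately show ?thesis unfolding cis_factor_angle[OF assms] by simp
qed

text \<open>
  On the circle the Poisson kernel is \<open>(1 - |a|\<^sup>2) / (1 - cnj a z)\<close> times \<open>z / (z - a)\<close>, so the formula is
  Cauchy's for the function \<open>f / (1 - cnj a z)\<close>.
\<close>

lemma circle_poisson_kernel_add_2pi:
  "circle_poisson_kernel r (x + 2 * pi * real_of_int k) = circle_poisson_kernel r x"
proof -
  have "cos (x + 2 * pi * real_of_int k) = cos x"
    using cos_int_2pin[of k] sin_int_2pin[of k] by (simp add: cos_add)
  thus ?thesis by (simp add: circle_poisson_kernel_def)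
qed

section \<open>Roots of unity and separated points\<close>

lemma root_of_unity_power: "d \<ge> 1 \<Longrightarrow> cis (2 * pi * real j / real d) ^ d = 1"
  using cis_multiple_2pi[of "real j"] by (simp add: Complex.DeMoivre)

lemma prod_roots_of_unity_poly:
  assumes "d \<ge> 1"
  shows "(\<Prod>j<d. [:- cis (2 * pi * real j / real d), 1:]) = monom 1 d - 1"
proof -
  let ?P = "\<Prod>j<d. [:- cis (2 * pi * real j / real d), 1:]"
  have bij: "bij_betw (\<lambda>k. cis (2 * pi * real k / real d)) {..<d} {z. z ^ d = 1}"
    using assms by (intro Complex.bij_betw_roots_unity) auto
  have "?P dvd monom 1 d - 1"
  proof (rule prod_linear_dvd)
    show "inj_on (\<lambda>k. cis (2 * pi * real k / real d)) {..<d}"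
      using bij by (rule bij_betw_imp_inj_on)
    show "poly (monom 1 d - 1) (cis (2 * pi * real j / real d)) = 0" if "j \<in> {..<d}" for j
      using bij_betw_apply[OF bij that] by (simp add: poly_monom)
  qed auto
  then obtain q where q: "monom 1 d - 1 = ?P * q" by (auto simp: dvd_def)
  have deg: "degree (monom 1 d - 1 :: complex poly) = d"
    using degree_add_eq_left[of "-1" "monom 1 d :: complex poly"] assms by (simp add: degree_monom_eq)
  have degP: "degree ?P = d" by (subst degree_prod_sum_eq) auto
  have lcP: "lead_coeff ?P = 1" by (simp add: lead_coeff_prod)
  have "q \<noteq> 0" using q deg assms by auto
  moreover have "?P \<noteq> 0" using lcP by auto
  ultimately have "degree q = 0" using arg_cong[OF q, of degree] deg degP by (simp add: degree_mult_eq)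
  then obtain c where c: "q = [:c:]" by (metis degree_eq_zeroE)
  have "lead_coeff (monom 1 d - 1 :: complex poly) = 1"
    unfolding deg using assms by simp
  moreover have "lead_coeff (monom 1 d - 1 :: complex poly) = lead_coeff ?P * lead_coeff q"
    unfolding arg_cong[OF q, of lead_coeff] by (rule lead_coeff_mult)
  ultimately have "c = 1" unfolding lcP by (simp add: c)
  thus ?thesis using q by (simp add: c)
qed

lemma prod_minus_roots_of_unity:
  fixes x y :: complex
  assumes "d \<ge> 1"
  shows "(\<Prod>j<d. x - y * cis (2 * pi * real j / real d)) = x ^ d - y ^ d"
proof (cases "y = 0")
  case True
  thus ?thesis using assms by simp
next
  case False
  have "(\<Prod>j<d. x - y * cis (2 * pi * real j / real d)) =
        (\<Prod>j<d. y * (x / y - cis (2 * pi * real j / real d)))"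
    using False by (simp add: right_diff_distrib)
  also have "\<dots> = y ^ d * (\<Prod>j<d. x / y - cis (2 * pi * real j / real d))"
    by (simp add: prod.distrib)
  also have "(\<Prod>j<d. x / y - cis (2 * pi * real j / real d)) = (x / y) ^ d - 1"
    using arg_cong[OF prod_roots_of_unity_poly[OF assms], of "\<lambda>p. poly p (x / y)"]
    by (simp add: poly_prod poly_monom)
  finally show ?thesis using False by (simp add: right_diff_distrib power_divide)
qed

text \<open>
  Cancelling the factor \<open>x - 1\<close> from the factorization of \<open>x\<^sup>K - 1\<close>. The identity is needed at \<open>x = 1\<close>
  too, hence the detour through polynomials.
\<close>

lemma prod_nontrivial_roots_of_unity:
  fixes x :: complex
  assumes "K \<ge> 1"
  shows "(\<Prod>n\<in>{1..<K}. x - cis (2 * pi * real n / real K)) = (\<Sum>i<K. x ^ i)"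
proof -
  let ?P = "\<Prod>n\<in>{1..<K}. [:- cis (2 * pi * real n / real K), 1:]"
  let ?S = "\<Sum>i<K. [:0, 1:] ^ i :: complex poly"
  have "[:-1, 1:] * ?P = (\<Prod>n<K. [:- cis (2 * pi * real n / real K), 1:])"
    using assms by (simp add: lessThan_atLeast0 prod.atLeast_Suc_lessThan del: mult_pCons_left)
  also have "\<dots> = [:0, 1:] ^ K - 1"
    unfolding prod_roots_of_unity_poly[OF assms] by (simp add: monom_altdef)
  also have "\<dots> = ([:0, 1:] - 1) * ?S" by (rule power_diff_1_eq)
  also have "[:0, 1:] - 1 = ([:-1, 1:] :: complex poly)" by (simp add: one_pCons)
  finally have "[:-1, 1:] * ?P = [:-1, 1:] * ?S" .
  hence "?P = ?S" by (subst (asm) mult_cancel_left) simp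
  from arg_cong[OF this, of "\<lambda>p. poly p x"] show ?thesis
    by (simp add: poly_prod poly_sum)
qed

lemma sum_powers_root_of_unity:
  assumes "k < d"
  shows "(\<Sum>j<d. cis (2 * pi * real j / real d) ^ k) = (if k = 0 then of_nat d else 0)"
proof (cases "k = 0")
  case False
  define w where "w = cis (2 * pi * real k / real d)"
  have wd: "w ^ d = 1" using assms by (simp add: w_def root_of_unity_power)
  have "inj_on (\<lambda>k. cis (2 * pi * real k / real d)) {..<d}"
    using Complex.bij_betw_roots_unity[of d] assms by (auto dest: bij_betw_imp_inj_on)
  from inj_onD[OF this, of k 0] have "w \<noteq> 1" using assms False by (auto simp: w_def)
  moreover have "(w - 1) * (\<Sum>j<d. w ^ j) = 0" using power_diff_1_eq[of w d] wd by simp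
  moreover have "cis (2 * pi * real j / real d) ^ k = w ^ j" for j
    by (simp add: w_def Complex.DeMoivre mult_ac)
  ultimately show ?thesis using False by simp
qed simp

lemma poisson_kernel_Re:
  assumes "0 \<le> r" "r < 1"
  shows "circle_poisson_kernel r x = 2 * Re (1 / (1 - of_real r * cis x)) - 1"
proof -
  have n: "(cmod (1 - of_real r * cis x))\<^sup>2 = 1 - 2 * r * cos x + r\<^sup>2" by (rule norm_one_minus_cis)
  have "Re (1 / (1 - of_real r * cis x)) = (1 - r * cos x) / (1 - 2 * r * cos x + r\<^sup>2)"
    unfolding n[symmetric] by (simp add: Re_divide cmod_power2)
  thus ?thesis using poisson_denominator_pos[OF assms, of x]
    by (simp add: circle_poisson_kernel_def divide_simps) (simp add: algebra_simps)
qed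

text \<open>
  Averaging over the \<open>d\<close>-th roots of unity keeps only the frequencies divisible by \<open>d\<close>, and these form
  the Poisson kernel of radius \<open>r\<^sup>d\<close> at \<open>d y\<close>.
\<close>

lemma sum_poisson_kernel_equidistant:
  assumes "0 \<le> r" "r < 1" "d \<ge> 1"
  shows "(\<Sum>j<d. circle_poisson_kernel r (y - 2 * pi * real j / real d)) =
           real d * circle_poisson_kernel (r ^ d) (real d * y)"
proof -
  define x where "x = of_real r * cis y"
  define w where "w = (\<lambda>j. cis (2 * pi * real j / real d))"
  have xj: "of_real r * cis (y - 2 * pi * real j / real d) = x * cnj (w j)" for j
    by (simp add: x_def w_def cis_cnj cis_mult)
  have nx: "cmod (x * cnj (w j)) < 1" for j using assms by (simp add: x_def w_def norm_mult)
  have wd: "w j ^ d = 1" for j using assms(3) by (simp add: w_def root_of_unity_power)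
  have xd: "x ^ d = of_real (r ^ d) * cis (real d * y)"
    by (simp add: x_def power_mult_distrib Complex.DeMoivre)
  have rd: "0 \<le> r ^ d" "r ^ d < 1" using assms by (auto simp: power_less_one_iff)
  have nz: "1 - x ^ d \<noteq> 0"
  proof -
    have "cmod (x ^ d) < 1" unfolding xd norm_mult norm_of_real norm_cis using rd by simp
    thus ?thesis by auto
  qed
  have geom: "1 / (1 - x * cnj (w j)) = (\<Sum>k<d. x ^ k * cnj (w j ^ k)) / (1 - x ^ d)" for j
  proof -
    have "1 - x * cnj (w j) \<noteq> 0" using nx[of j] by (metis norm_one less_irrefl right_minus_eq)
    moreover have "(x * cnj (w j)) ^ d = x ^ d"
      using arg_cong[OF wd[of j], of cnj] by (simp add: power_mult_distrib)
    hence "1 - x ^ d = (1 - x * cnj (w j)) * (\<Sum>k<d. (x * cnj (w j)) ^ k)"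
      using one_diff_power_eq[of "x * cnj (w j)" d] by simp
    ultimately show ?thesis using nz by (simp add: divide_simps power_mult_distrib)
  qed
  have "(\<Sum>j<d. 1 / (1 - x * cnj (w j))) = (\<Sum>k<d. x ^ k * cnj (\<Sum>j<d. w j ^ k)) / (1 - x ^ d)"
    unfolding geom sum_divide_distrib[symmetric] by (subst sum.swap) (simp add: sum_distrib_left)
  also have "(\<Sum>k<d. x ^ k * cnj (\<Sum>j<d. w j ^ k)) = (\<Sum>k<d. if k = 0 then of_nat d else 0)"
    unfolding w_def by (intro sum.cong) (auto simp: sum_powers_root_of_unity simp del: cnj_sum)
  also have "\<dots> = of_nat d" using assms(3) by simp
  finally have "(\<Sum>j<d. 1 / (1 - x * cnj (w j))) = of_nat d * (1 / (1 - x ^ d))" by simp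
  from arg_cong[OF this, of Re]
  have "(\<Sum>j<d. Re (1 / (1 - x * cnj (w j)))) = Re (of_nat d * (1 / (1 - x ^ d)))" by (simp only: Re_sum)
  also have "Re (of_nat d * z) = real d * Re z" for z by simp
  finally have "(\<Sum>j<d. Re (1 / (1 - x * cnj (w j)))) = real d * Re (1 / (1 - x ^ d))" .
  thus ?thesis
    unfolding poisson_kernel_Re[OF assms(1,2)] poisson_kernel_Re[OF rd] xj xd
    by (simp add: sum_subtractf sum_distrib_left[symmetric] algebra_simps)
qed

text \<open>
  On the circle the Poisson kernel is \<open>(1 - |a|\<^sup>2) / (1 - cnj a z)\<close> times \<open>z / (z - a)\<close>, so the formula is
  Cauchy's for the function \<open>f / (1 - cnj a z)\<close>.
\<close>

lemma circle_poisson_kernel_le: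
  assumes "0 \<le> r" "r < 1"
  shows "circle_poisson_kernel r x \<le> (1 + r) / (1 - r)"
proof -
  have "(1 - r)\<^sup>2 \<le> (1 - r)\<^sup>2 + 2 * r * (1 - cos x)" using assms by simp
  also have "\<dots> = 1 - 2 * r * cos x + r\<^sup>2" by (simp add: power2_eq_square algebra_simps)
  finally have "circle_poisson_kernel r x \<le> (1 - r\<^sup>2) / (1 - r)\<^sup>2"
    unfolding circle_poisson_kernel_def using assms by (intro divide_left_mono) (auto simp: abs_square_le_1 intro!: mult_pos_pos poisson_denominator_pos)
  also have "\<dots> = ((1 + r) * (1 - r)) / ((1 - r) * (1 - r))" by (simp add: power2_eq_square algebra_simps)
  also have "\<dots> = (1 + r) / (1 - r)" using assms by simp
  finally show ?thesis .
qed

text \<open>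
  For \<open>s = r\<^sup>2\<close> this is the inverse square of the pseudohyperbolic distance between two points of modulus
  \<open>r\<close> at an angle \<open>x\<close>.
\<close>

definition sep_factor :: "real \<Rightarrow> real \<Rightarrow> real" where
  "sep_factor s x = (1 - 2 * s * cos x + s\<^sup>2) / (s * (2 - 2 * cos x))"

lemma sep_factor_alt:
  assumes "s > 0" "cos x < 1"
  shows "sep_factor s x = 1 + (1 - s)\<^sup>2 / (2 * s * (1 - cos x))"
proof -
  have "s * (2 - 2 * cos x) \<noteq> 0" "2 * s * (1 - cos x) \<noteq> 0" using assms by auto
  moreover have "s * (2 - 2 * cos x) = 2 * s * (1 - cos x)" by (simp add: algebra_simps)
  moreover have "1 - 2 * s * cos x + s\<^sup>2 = 2 * s * (1 - cos x) + (1 - s)\<^sup>2"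
    by (simp add: power2_eq_square algebra_simps)
  ultimately show ?thesis unfolding sep_factor_def by (simp add: add_divide_distrib)
qed

lemma sep_factor_mono:
  assumes "s > 0" "cos x \<le> cos y" "cos y < 1"
  shows "sep_factor s x \<le> sep_factor s y"
proof -
  have "(1 - s)\<^sup>2 / (2 * s * (1 - cos x)) \<le> (1 - s)\<^sup>2 / (2 * s * (1 - cos y))"
    using assms by (intro divide_left_mono mult_left_mono mult_pos_pos) auto
  thus ?thesis using assms by (simp add: sep_factor_alt)
qed

lemma sep_factor_ge_1: "s > 0 \<Longrightarrow> cos x < 1 \<Longrightarrow> 1 \<le> sep_factor s x"
  by (simp add: sep_factor_alt)

lemma norm_cis_minus_cis: "(cmod (1 - cis x))\<^sup>2 = 2 - 2 * cos x"
  using norm_one_minus_cis[of 1 x] by simp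

lemma cos_2pi_less_1:
  assumes "0 < u" "u < 1"
  shows "cos (2 * pi * u) < 1"
proof -
  have "cos (2 * pi * u) \<noteq> 1"
  proof
    assume "cos (2 * pi * u) = 1"
    then obtain n :: int where n: "2 * pi * u = of_int n * 2 * pi" by (auto simp: cos_one_2pi_int)
    hence "u = of_int n" by simp
    with assms have "0 < n" "n < 1" by auto
    thus False by simp
  qed
  thus ?thesis using cos_le_one[of "2 * pi * u"] by linarith
qed

text \<open>
  The distances in the numerators and in the denominators multiply to geometric sums, of which the
  first is at most \<open>K\<close> and the second equal to \<open>K\<close>; what remains is the power of \<open>s\<close>.
\<close>

lemma prod_sep_factor_equidistant:
  assumes s: "0 < s" "s \<le> 1" and K: "K \<ge> 1"
  shows "(\<Prod>n\<in>{1..<K}. sep_factor s (2 * pi * real n / real K)) \<le> (1 / s) ^ (K - 1)"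
proof -
  let ?w = "\<lambda>n. cis (2 * pi * real n / real K)"
  let ?I = "{1..<K}"
  have "(\<Prod>n\<in>?I. 1 - of_real s * ?w n) = (\<Prod>n\<in>?I. of_real s * (of_real (1 / s) - ?w n))"
    using s by (intro prod.cong) (auto simp: right_diff_distrib simp flip: of_real_mult)
  also have "\<dots> = of_real s ^ (K - 1) * (\<Sum>i<K. of_real (1 / s) ^ i)"
    by (simp only: prod.distrib prod_nontrivial_roots_of_unity[OF K]) simp
  also have "\<dots> = of_real (\<Sum>i<K. s ^ (K - 1 - i))"
    unfolding sum_distrib_left of_real_sum
  proof (rule sum.cong)
    fix i assume "i \<in> {..<K}"
    hence "s ^ (K - 1) = s ^ (K - 1 - i) * s ^ i" by (simp add: power_add[symmetric])
    hence "s ^ (K - 1) * (1 / s) ^ i = s ^ (K - 1 - i)" using s by (simp add: power_divide)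
    thus "complex_of_real s ^ (K - 1) * of_real (1 / s) ^ i = of_real (s ^ (K - 1 - i))"
      by (metis of_real_mult of_real_power)
  qed simp
  finally have e1: "(\<Prod>n\<in>?I. cmod (1 - of_real s * ?w n)) = \<bar>\<Sum>i<K. s ^ (K - 1 - i)\<bar>"
    unfolding prod_norm by (simp only: norm_of_real)
  have S: "(\<Sum>i<K. s ^ (K - 1 - i)) \<le> real K" "0 \<le> (\<Sum>i<K. s ^ (K - 1 - i))"
    using s sum_bounded_above[of "{..<K}" "\<lambda>i. s ^ (K - 1 - i)" 1]
    by (auto simp: power_le_one intro!: sum_nonneg)
  have e2: "(\<Prod>n\<in>?I. cmod (1 - ?w n)) = real K"
    unfolding prod_norm prod_nontrivial_roots_of_unity[OF K, of 1] by simp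
  have "(\<Prod>n\<in>?I. sep_factor s (2 * pi * real n / real K)) =
        (\<Prod>n\<in>?I. (cmod (1 - of_real s * ?w n))\<^sup>2 / (s * (cmod (1 - ?w n))\<^sup>2))"
    unfolding sep_factor_def norm_one_minus_cis norm_cis_minus_cis ..
  also have "\<dots> = (\<Sum>i<K. s ^ (K - 1 - i))\<^sup>2 / (s ^ (K - 1) * (real K)\<^sup>2)"
    unfolding prod_dividef prod.distrib prod_power_distrib[symmetric] e1 e2 by simp
  also have "\<dots> \<le> (real K)\<^sup>2 / (s ^ (K - 1) * (real K)\<^sup>2)"
    using S s by (intro divide_right_mono power_mono) auto
  also have "\<dots> = (1 / s) ^ (K - 1)" using K s by (simp add: power_divide)
  finally show ?thesis .
qed

text \<open>
  Rounding every point to a multiple of \<open>1 / K\<close>, away from \<open>1/2\<close>, increases its factor. Points at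
  distance at least \<open>1 / K\<close> round to different multiples, so the equidistant case is the extreme one.
\<close>

lemma prod_sep_factor_le:
  fixes u :: "'i \<Rightarrow> real"
  assumes s: "0 < s" "s \<le> 1" and K: "K \<ge> 1" and I: "finite I"
    and u: "\<And>i. i \<in> I \<Longrightarrow> 1 / real K \<le> u i" "\<And>i. i \<in> I \<Longrightarrow> u i \<le> 1 - 1 / real K"
    and gap: "\<And>i j. i \<in> I \<Longrightarrow> j \<in> I \<Longrightarrow> i \<noteq> j \<Longrightarrow> 1 / real K \<le> \<bar>u i - u j\<bar>"
  shows "(\<Prod>i\<in>I. sep_factor s (2 * pi * u i)) \<le> (1 / s) ^ (K - 1)"
proof -
  define n :: "'i \<Rightarrow> int" where "n = (\<lambda>i. if u i \<le> 1 / 2 then \<lfloor>real K * u i\<rfloor> else \<lceil>real K * u i\<rceil>)"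
  have K0: "real K > 0" using K by simp
  have r: "1 \<le> real K * u i" "real K * u i \<le> real K - 1" if "i \<in> I" for i
    using u[OF that] K0 by (simp_all add: field_simps)
  have n1: "1 \<le> n i" "n i \<le> int K - 1" if "i \<in> I" for i
  proof -
    have "1 \<le> \<lfloor>real K * u i\<rfloor>" using r(1)[OF that] by (simp add: le_floor_iff)
    also have "\<lfloor>real K * u i\<rfloor> \<le> n i" unfolding n_def by (simp add: floor_le_ceiling)
    finally show "1 \<le> n i" .
    have "n i \<le> \<lceil>real K * u i\<rceil>" unfolding n_def by (simp add: floor_le_ceiling)
    also have "\<lceil>real K * u i\<rceil> \<le> int K - 1" using r(2)[OF that] by (intro ceiling_le) simp
    finally show "n i \<le> int K - 1" .
  qed
  have n_floor: "real_of_int (n i) \<le> real K * u i" "real K * u i < real_of_int (n i) + 1" if "u i \<le> 1 / 2" for i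
    using that unfolding n_def by simp_all
  have n_ceiling: "real K * u i \<le> real_of_int (n i)" "real_of_int (n i) < real K * u i + 1" if "\<not> u i \<le> 1 / 2" for i
    using that of_int_ceiling_le_add_one[of "real K * u i"] ceiling_correct[of "real K * u i"] unfolding n_def by simp_all
  have inj: "inj_on n I"
  proof (rule inj_onI, rule ccontr)
    fix i j assume ij: "i \<in> I" "j \<in> I" "n i = n j" "i \<noteq> j"
    have g: "1 \<le> \<bar>real K * u i - real K * u j\<bar>"
    proof -
      have "real K * u i - real K * u j = real K * (u i - u j)" by (simp add: right_diff_distrib)
      hence "\<bar>real K * u i - real K * u j\<bar> = real K * \<bar>u i - u j\<bar>" by (simp add: abs_mult)
      thus ?thesis using gap[OF ij(1,2,4)] K0 by (simp add: pos_divide_le_eq mult.commute)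
    qed
    have half: "u i \<le> 1 / 2 \<longleftrightarrow> real K * u i \<le> real K / 2" for i using K0 by (simp add: field_simps)
    have e: "real_of_int (n i) = real_of_int (n j)" using ij(3) by simp
    show False
    proof (cases "u i \<le> 1 / 2")
      case i: True
      show False
      proof (cases "u j \<le> 1 / 2")
        case True
        thus False using g e n_floor[OF i] n_floor[OF True] by linarith
      next
        case False
        thus False using e n_floor(1)[OF i] n_ceiling(1)[OF False] half[of i] half[of j] i by linarith
      qed
    next
      case i: False
      show False
      proof (cases "u j \<le> 1 / 2")
        case True
        thus False using e n_ceiling(1)[OF i] n_floor(1)[OF True] half[of i] half[of j] i by linarith
      next
        case False
        thus False using g e n_ceiling[OF i] n_ceiling[OF False] by linarith
      qed
    qed
  qed
  have cos_le: "cos (2 * pi * u i) \<le> cos (2 * pi * real (nat (n i)) / real K) \<and>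
      cos (2 * pi * real (nat (n i)) / real K) < 1" if i: "i \<in> I" for i
  proof -
    define v where "v = real_of_int (n i) / real K"
    have nat: "real (nat (n i)) / real K = v" using n1[OF i] by (simp add: v_def)
    have v: "0 < v" "v < 1" using n1[OF i] K0 by (auto simp: v_def divide_simps)
    have "cos (2 * pi * u i) \<le> cos (2 * pi * v)"
    proof (cases "u i \<le> 1 / 2")
      case True
      hence "real_of_int (n i) \<le> real K * u i" unfolding n_def by simp
      hence "v \<le> u i" using K0 by (simp add: v_def divide_simps mult.commute)
      thus ?thesis using v True by (intro cos_monotone_0_pi_le) (auto simp: field_simps)
    next
      case False
      hence "real_of_int (n i) \<ge> real K * u i" unfolding n_def by simp
      hence vu: "u i \<le> v" using K0 by (simp add: v_def divide_simps mult.commute)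
      have refl: "cos (2 * pi * t) = cos (2 * pi * (1 - t))" for t :: real
        by (simp add: right_diff_distrib cos_diff)
      show ?thesis unfolding refl[of "u i"] refl[of v]
        using v False vu by (intro cos_monotone_0_pi_le) (auto simp: field_simps)
    qed
    moreover have "cos (2 * pi * v) < 1" using v by (rule cos_2pi_less_1)
    moreover have "2 * pi * real (nat (n i)) / real K = 2 * pi * v" by (simp flip: nat)
    ultimately show ?thesis by simp
  qed
  have "(\<Prod>i\<in>I. sep_factor s (2 * pi * u i)) \<le> (\<Prod>i\<in>I. sep_factor s (2 * pi * real (nat (n i)) / real K))"
  proof (rule prod_mono, safe)
    fix i assume i: "i \<in> I"
    have "cos (2 * pi * u i) < 1" using cos_le[OF i] by linarith
    from sep_factor_ge_1[OF s(1) this] show "0 \<le> sep_factor s (2 * pi * u i)" by simp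
    show "sep_factor s (2 * pi * u i) \<le> sep_factor s (2 * pi * real (nat (n i)) / real K)"
      using cos_le[OF i] s by (intro sep_factor_mono) auto
  qed
  also have "\<dots> = (\<Prod>m\<in>(\<lambda>i. nat (n i)) ` I. sep_factor s (2 * pi * real m / real K))"
  proof -
    have "inj_on (\<lambda>i. nat (n i)) I"
    proof (rule inj_onI)
      fix i j assume ij: "i \<in> I" "j \<in> I" "nat (n i) = nat (n j)"
      hence "n i = n j" using n1(1)[OF ij(1)] n1(1)[OF ij(2)] by simp
      thus "i = j" using inj ij by (auto dest: inj_onD)
    qed
    thus ?thesis by (simp add: prod.reindex)
  qed
  also have "\<dots> \<le> (\<Prod>m\<in>{1..<K}. sep_factor s (2 * pi * real m / real K))"
  proof (rule prod_mono2)
    show sub: "(\<lambda>i. nat (n i)) ` I \<subseteq> {1..<K}"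
    proof safe
      fix i assume "i \<in> I"
      from n1[OF this] show "nat (n i) \<in> {1..<K}" by (simp add: nat_less_iff le_nat_iff)
    qed
    have *: "cos (2 * pi * real m / real K) < 1" if "m \<in> {1..<K}" for m
      using cos_2pi_less_1[of "real m / real K"] that by simp
    show "1 \<le> sep_factor s (2 * pi * real b / real K)" if "b \<in> {1..<K} - (\<lambda>i. nat (n i)) ` I" for b
      using that by (intro sep_factor_ge_1 * s) auto
    show "0 \<le> sep_factor s (2 * pi * real a / real K)" if "a \<in> (\<lambda>i. nat (n i)) ` I" for a
      using that sub by (intro order_trans[OF zero_le_one sep_factor_ge_1] * s) blast
  qed auto
  also have "\<dots> \<le> (1 / s) ^ (K - 1)" by (rule prod_sep_factor_equidistant[OF s K])
  finally show ?thesis .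
qed

section \<open>The phase of the Blaschke product of the nodes\<close>

lemma two_exp_div_le:
  assumes "u > 0"
  shows "2 * exp (- u) / (1 - (exp (- u))\<^sup>2) \<le> 1 / (u::real)"
proof -
  have "(\<lambda>x. exp x - exp (- x) - 2 * x) 0 \<le> (\<lambda>x. exp x - exp (- x) - 2 * x) u"
  proof (rule DERIV_nonneg_imp_nondecreasing[where f = "\<lambda>x. exp x - exp (- x) - 2 * x"])
    fix x :: real
    have "0 \<le> (exp (x / 2) - exp (- x / 2))\<^sup>2" by simp
    also have "\<dots> = exp x + exp (- x) - 2"
      by (simp add: power2_eq_square algebra_simps flip: exp_add)
    finally have "0 \<le> exp x + exp (- x) - 2" .
    moreover have "((\<lambda>x. exp x - exp (- x) - 2 * x) has_real_derivative (exp x + exp (- x) - 2)) (at x)"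
      by (auto intro!: derivative_eq_intros)
    ultimately show "\<exists>y. ((\<lambda>x. exp x - exp (- x) - 2 * x) has_real_derivative y) (at x) \<and> 0 \<le> y" by blast
  qed (use assms in auto)
  hence "2 * u \<le> exp u - exp (- u)" by simp
  hence "2 * u * exp (- u) \<le> (exp u - exp (- u)) * exp (- u)" by (rule mult_right_mono) simp
  also have "\<dots> = 1 - (exp (- u))\<^sup>2" by (simp add: power2_eq_square algebra_simps flip: exp_add)
  finally have le: "2 * u * exp (- u) \<le> 1 - (exp (- u))\<^sup>2" .
  moreover have "0 < 2 * u * exp (- u)" using assms by simp
  ultimately have pos: "0 < 1 - (exp (- u))\<^sup>2" by linarith
  have "2 * exp (- u) / (1 - (exp (- u))\<^sup>2) \<le> 1 / u \<longleftrightarrow> 2 * exp (- u) * u \<le> 1 * (1 - (exp (- u))\<^sup>2)"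
    by (simp only: pos_divide_le_eq[OF pos] times_divide_eq_left pos_le_divide_eq[OF assms])
  thus ?thesis using le by (simp add: mult.commute mult.left_commute)
qed

text \<open>
  The logarithmic derivative of the kernel is at most \<open>2 r / (1 - r\<^sup>2)\<close> in absolute value.
\<close>

lemma poisson_kernel_harnack_scaled:
  assumes "h > 0" "d \<ge> 1" "r = exp (- (2 * pi * h / real d))"
  shows "circle_poisson_kernel r (y - 2 * pi * s) \<le>
           exp (real d / h * \<bar>s - t\<bar>) * circle_poisson_kernel r (y - 2 * pi * t)"
proof -
  let ?u = "2 * pi * h / real d"
  have u: "?u > 0" using assms by simp
  have r: "0 \<le> r" "r < 1" using u by (simp_all add: assms(3))
  have "(y - 2 * pi * s) - (y - 2 * pi * t) = - (2 * pi) * (s - t)" by (simp add: algebra_simps)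
  hence diff: "\<bar>(y - 2 * pi * s) - (y - 2 * pi * t)\<bar> = 2 * pi * \<bar>s - t\<bar>"
    by (simp only: abs_mult) simp
  have "2 * r / (1 - r\<^sup>2) * (2 * pi * \<bar>s - t\<bar>) \<le> 1 / ?u * (2 * pi * \<bar>s - t\<bar>)"
    unfolding assms(3) using two_exp_div_le[OF u] by (rule mult_right_mono) simp
  also have "\<dots> = real d / h * \<bar>s - t\<bar>" using assms by simp
  finally have "exp (2 * r / (1 - r\<^sup>2) * (2 * pi * \<bar>s - t\<bar>)) \<le> exp (real d / h * \<bar>s - t\<bar>)"
    by (rule exp_le_cancel_iff[THEN iffD2])
  from mult_right_mono[OF this less_imp_le[OF circle_poisson_kernel_pos[OF r, of "y - 2 * pi * t"]]]
  show ?thesis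
    using poisson_kernel_harnack[OF r, of "y - 2 * pi * s" "y - 2 * pi * t"] unfolding diff by linarith
qed

lemma sum_blocks_mod:
  fixes F :: "nat \<Rightarrow> 'a::comm_semiring_1"
  assumes "d \<ge> 1"
  shows "(\<Sum>m<d. \<Sum>j = m * N..<(m + 1) * N. F (j mod d)) = of_nat N * (\<Sum>j<d. F j)"
proof -
  have "(\<Sum>m<d. \<Sum>j = m * N..<(m + 1) * N. F (j mod d)) = (\<Sum>j<d * N. F (j mod d))"
    using sum.nat_group[of "\<lambda>j. F (j mod d)" N d] by (simp add: add.commute)
  also have "\<dots> = (\<Sum>j<N * d. F (j mod d))" by (simp add: mult.commute)
  also have "\<dots> = (\<Sum>m<N. \<Sum>j = m * d..<m * d + d. F (j mod d))"
    by (rule sum.nat_group[symmetric])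
  also have "\<dots> = (\<Sum>m<N. \<Sum>j<d. F j)"
  proof (rule sum.cong)
    fix m
    have "(\<Sum>j = m * d..<m * d + d. F (j mod d)) = (\<Sum>j = 0..<d. F ((j + m * d) mod d))"
      using sum.shift_bounds_nat_ivl[of "\<lambda>j. F (j mod d)" 0 "m * d" d] by (simp add: add.commute)
    thus "(\<Sum>j = m * d..<m * d + d. F (j mod d)) = (\<Sum>j<d. F j)"
      by (simp add: lessThan_atLeast0)
  qed simp
  finally show ?thesis by simp
qed

text \<open>
  Within a block every weight \<open>Q\<close> is close to every \<open>R\<close>, so a block contributes the sum of its \<open>\<mu>\<close> times
  the mean of \<open>R\<close> over the block, up to the relative error \<open>c\<close>. The \<open>d\<close> blocks of length \<open>N\<close>, taken modulo
  \<open>d\<close>, cover every index exactly \<open>N\<close> times even if \<open>N\<close> does not divide \<open>d\<close>.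
\<close>

lemma block_average_bound:
  fixes \<mu> Q R :: "nat \<Rightarrow> real"
  assumes d: "d \<ge> 1" and N: "N \<ge> 1"
    and R0: "\<And>i. R i \<ge> 0"
    and near: "\<And>i j. \<bar>real i - real j\<bar> \<le> real N \<Longrightarrow> \<bar>Q (j mod d) - R (i mod d)\<bar> \<le> c * R (i mod d)"
    and \<mu>: "\<And>j. j < d \<Longrightarrow> \<bar>\<mu> j\<bar> \<le> b"
    and block: "\<And>m. m < d \<Longrightarrow> \<bar>\<Sum>j = m * N..<(m + 1) * N. \<mu> (j mod d)\<bar> \<le> \<sigma>"
  shows "\<bar>\<Sum>j<d. \<mu> j * Q j\<bar> \<le> (\<sigma> / real N + b * c) * (\<Sum>i<d. R i)"
proof -
  let ?B = "\<lambda>m. {m * N..<(m + 1) * N}"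
  let ?S = "\<lambda>m. \<Sum>j\<in>?B m. \<mu> (j mod d) * Q (j mod d)"
  have cardB: "card (?B m) = N" for m by simp
  have single: "\<bar>?S m\<bar> \<le> (\<sigma> + real N * (b * c)) * R (i mod d)" if m: "m < d" and i: "i \<in> ?B m" for m i
  proof -
    let ?R = "R (i mod d)"
    have "?S m = ?R * (\<Sum>j\<in>?B m. \<mu> (j mod d)) + (\<Sum>j\<in>?B m. \<mu> (j mod d) * (Q (j mod d) - ?R))"
      by (simp add: sum_distrib_left sum.distrib[symmetric] algebra_simps)
    hence "\<bar>?S m\<bar> \<le> \<bar>?R * (\<Sum>j\<in>?B m. \<mu> (j mod d))\<bar> + \<bar>\<Sum>j\<in>?B m. \<mu> (j mod d) * (Q (j mod d) - ?R)\<bar>"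
      by (simp only: abs_triangle_ineq)
    also have "\<bar>?R * (\<Sum>j\<in>?B m. \<mu> (j mod d))\<bar> \<le> ?R * \<sigma>"
      unfolding abs_mult using R0 block[OF m] by (simp add: mult_left_mono)
    also have "\<bar>\<Sum>j\<in>?B m. \<mu> (j mod d) * (Q (j mod d) - ?R)\<bar> \<le> (\<Sum>j\<in>?B m. b * (c * ?R))"
    proof (rule order_trans[OF sum_abs sum_mono])
      fix j assume "j \<in> ?B m"
      hence "\<bar>real i - real j\<bar> \<le> real N" using i by auto
      from near[OF this] \<mu>[of "j mod d"] d
      show "\<bar>\<mu> (j mod d) * (Q (j mod d) - ?R)\<bar> \<le> b * (c * ?R)"
        unfolding abs_mult by (intro mult_mono) auto
    qed
    also have "(\<Sum>j\<in>?B m. b * (c * ?R)) = real N * (b * (c * ?R))" by simp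
    finally show ?thesis by (simp add: algebra_simps)
  qed
  have one: "real N * \<bar>?S m\<bar> \<le> (\<sigma> + real N * (b * c)) * (\<Sum>i\<in>?B m. R (i mod d))" if m: "m < d" for m
  proof -
    have "real N * \<bar>?S m\<bar> = (\<Sum>i\<in>?B m. \<bar>?S m\<bar>)" using cardB[of m] by (simp del: card_atLeastLessThan)
    also have "\<dots> \<le> (\<Sum>i\<in>?B m. (\<sigma> + real N * (b * c)) * R (i mod d))"
      by (intro sum_mono single m)
    finally show ?thesis by (simp add: sum_distrib_left)
  qed
  have "real N * (real N * \<bar>\<Sum>j<d. \<mu> j * Q j\<bar>) = real N * \<bar>\<Sum>m<d. ?S m\<bar>"
    using sum_blocks_mod[OF d, of "\<lambda>j. \<mu> j * Q j" N] by (simp add: abs_mult)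
  also have "\<dots> \<le> real N * (\<Sum>m<d. \<bar>?S m\<bar>)" by (intro mult_left_mono sum_abs) auto
  also have "\<dots> = (\<Sum>m<d. real N * \<bar>?S m\<bar>)" by (rule sum_distrib_left)
  also have "\<dots> \<le> (\<Sum>m<d. (\<sigma> + real N * (b * c)) * (\<Sum>i\<in>?B m. R (i mod d)))"
    by (intro sum_mono one) auto
  also have "\<dots> = (\<sigma> + real N * (b * c)) * (real N * (\<Sum>i<d. R i))"
    using sum_blocks_mod[OF d, of R N] by (simp add: sum_distrib_left[symmetric])
  also have "\<dots> = real N * ((\<sigma> + real N * (b * c)) * (\<Sum>i<d. R i))" by (rule mult.left_commute)
  finally have "real N * \<bar>\<Sum>j<d. \<mu> j * Q j\<bar> \<le> (\<sigma> + real N * (b * c)) * (\<Sum>i<d. R i)"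
    using N by (subst (asm) mult_le_cancel_left_pos) auto
  thus ?thesis using N by (simp add: field_simps)
qed

lemma cis_sum: "cis (\<Sum>j\<in>A. f j) = (\<Prod>j\<in>A. cis (f j))"
  by (induction A rule: infinite_finite_induct) (auto simp: cis_mult[symmetric])

text \<open>
  For the equidistant zeros \<open>r cis (2 \<pi> j / d)\<close> the product is explicit. The factor with the sum of the
  deviations is constant in \<open>z\<close>, and \<open>\<alpha>\<close> collects the contributions \<open>- 2 \<pi> \<mu>\<^sub>j P\<close> of the individual
  shifts; they cancel up to the block averages because \<open>P\<close> is nearly constant on blocks.
\<close>

lemma blaschke_product_phase:
  fixes \<theta> :: "nat \<Rightarrow> real"
  assumes d: "d \<ge> 1" and N: "N \<ge> 1" and h: "h > 0" and L: "L > 0"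
    and r: "r = exp (- (2 * pi * h / real d))"
    and \<theta>: "\<And>j. j < d \<Longrightarrow> \<bar>\<theta> j - real j / real d\<bar> \<le> L / real d"
    and block: "\<And>m. m < d \<Longrightarrow>
      \<bar>\<Sum>j = m * N..<(m + 1) * N. \<theta> (j mod d) - real (j mod d) / real d\<bar> \<le> \<rho> * real N / real d"
    and \<rho>: "\<rho> \<ge> 0"
    and z: "cmod z = 1"
  obtains \<alpha> where
    "\<bar>\<alpha>\<bar> \<le> 2 * pi * (\<rho> + L * (exp ((real N + L) / h) - 1)) * ((1 + r ^ d) / (1 - r ^ d))"
    "(\<Prod>j<d. (z - of_real r * cis (2 * pi * \<theta> j)) / (1 - cnj (of_real r * cis (2 * pi * \<theta> j)) * z)) =
       (z ^ d - of_real (r ^ d)) / (1 - of_real (r ^ d) * z ^ d) *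
       cis (2 * pi * (\<Sum>j<d. \<theta> j - real j / real d)) * cis \<alpha>"
proof -
  obtain y where y: "z = cis y"
    using complex_norm_eq_1_exp[of z] z by (metis cis_conv_exp)
  have r01: "0 \<le> r" "r < 1" using h d by (simp_all add: r)
  have rd: "0 \<le> r ^ d" "r ^ d < 1" using r01 d by (auto simp: power_less_one_iff)
  define \<mu> where "\<mu> = (\<lambda>j. \<theta> j - real j / real d)"
  define R where "R = (\<lambda>i. circle_poisson_kernel r (y - 2 * pi * real i / real d))"
  have "\<exists>s. \<bar>s - real j / real d\<bar> \<le> \<bar>\<mu> j\<bar> \<and>
      factor_angle r (y - 2 * pi * \<theta> j) = factor_angle r (y - 2 * pi * real j / real d)
        + 2 * pi * \<mu> j - 2 * pi * (\<mu> j * circle_poisson_kernel r (y - 2 * pi * s))" for j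
  proof -
    obtain \<xi> where x: "\<bar>\<xi> - (y - 2 * pi * real j / real d)\<bar> \<le> \<bar>(y - 2 * pi * \<theta> j) - (y - 2 * pi * real j / real d)\<bar>"
      "factor_angle r (y - 2 * pi * \<theta> j) - factor_angle r (y - 2 * pi * real j / real d) =
        ((y - 2 * pi * \<theta> j) - (y - 2 * pi * real j / real d)) * (circle_poisson_kernel r \<xi> - 1)"
      using factor_angle_diff[OF r01] by blast
    have m: "(y - 2 * pi * \<theta> j) - (y - 2 * pi * real j / real d) = - (2 * pi) * \<mu> j"
      by (simp add: \<mu>_def algebra_simps)
    define s where "s = (y - \<xi>) / (2 * pi)"
    have \<xi>: "\<xi> = y - 2 * pi * s" by (simp add: s_def)
    have "\<xi> - (y - 2 * pi * real j / real d) = - (2 * pi) * (s - real j / real d)"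
      unfolding \<xi> by (simp add: algebra_simps)
    hence "2 * pi * \<bar>s - real j / real d\<bar> = \<bar>\<xi> - (y - 2 * pi * real j / real d)\<bar>"
      by (simp only: abs_mult) simp
    also have "\<dots> \<le> 2 * pi * \<bar>\<mu> j\<bar>" using x(1) unfolding m by (simp add: abs_mult)
    finally have "\<bar>s - real j / real d\<bar> \<le> \<bar>\<mu> j\<bar>" by simp
    moreover have "factor_angle r (y - 2 * pi * \<theta> j) = factor_angle r (y - 2 * pi * real j / real d)
        + 2 * pi * \<mu> j - 2 * pi * (\<mu> j * circle_poisson_kernel r (y - 2 * pi * s))"
      using x(2) unfolding m \<xi> by (simp add: algebra_simps)
    ultimately show ?thesis by blast
  qed
  then obtain s where s: "\<And>j. \<bar>s j - real j / real d\<bar> \<le> \<bar>\<mu> j\<bar>"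
    "\<And>j. factor_angle r (y - 2 * pi * \<theta> j) = factor_angle r (y - 2 * pi * real j / real d)
        + 2 * pi * \<mu> j - 2 * pi * (\<mu> j * circle_poisson_kernel r (y - 2 * pi * s j))"
    by metis
  define Q where "Q = (\<lambda>j. circle_poisson_kernel r (y - 2 * pi * s j))"
  define \<alpha> where "\<alpha> = - (2 * pi * (\<Sum>j<d. \<mu> j * Q j))"
  define c where "c = exp ((real N + L) / h) - 1"
  have c0: "c \<ge> 0" using L h by (simp add: c_def)
  have R0: "R i > 0" for i unfolding R_def using circle_poisson_kernel_pos[OF r01] .
  have split: "real i / real d = real (i div d) + real (i mod d) / real d" for i
  proof -
    have "real i = real (i div d) * real d + real (i mod d)"
      by (metis of_nat_add of_nat_mult div_mult_mod_eq)
    hence "real i / real d = (real (i div d) * real d + real (i mod d)) / real d" by (rule arg_cong)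
    thus ?thesis using d by (simp add: add_divide_distrib)
  qed
  have Rmod: "R i = R (i mod d)" for i
  proof -
    have "y - 2 * pi * real (i mod d) / real d = (y - 2 * pi * real i / real d) + 2 * pi * real_of_int (int (i div d))"
      using arg_cong[OF split[of i], of "\<lambda>x. 2 * pi * x"] by (simp add: distrib_left)
    thus ?thesis unfolding R_def by (simp only: circle_poisson_kernel_add_2pi)
  qed
  have near: "\<bar>Q (j mod d) - R (i mod d)\<bar> \<le> c * R (i mod d)" if ij: "\<bar>real i - real j\<bar> \<le> real N" for i j
  proof -
    \<comment> \<open>The representative of the point modulo 1 that lies near \<open>j / d\<close>, also across the end of the period.\<close>
    define t where "t = s (j mod d) + real (j div d)"
    have "y - 2 * pi * s (j mod d) = (y - 2 * pi * t) + 2 * pi * real_of_int (int (j div d))"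
      by (simp add: t_def algebra_simps)
    hence Qt: "Q (j mod d) = circle_poisson_kernel r (y - 2 * pi * t)"
      unfolding Q_def by (simp only: circle_poisson_kernel_add_2pi)
    have Ri: "R (i mod d) = circle_poisson_kernel r (y - 2 * pi * (real i / real d))"
      using Rmod[of i] by (simp add: R_def)
    have "t - real i / real d = (s (j mod d) - real (j mod d) / real d) + (real j - real i) / real d"
      using split[of j] by (simp add: t_def diff_divide_distrib)
    hence "\<bar>t - real i / real d\<bar> \<le> \<bar>s (j mod d) - real (j mod d) / real d\<bar> + \<bar>(real j - real i) / real d\<bar>"
      by (simp only: abs_triangle_ineq)
    also have "\<dots> \<le> L / real d + real N / real d"
      using s(1)[of "j mod d"] \<theta>[of "j mod d"] d ij
      by (intro add_mono) (auto simp: \<mu>_def abs_minus_commute divide_right_mono)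
    finally have dist: "real d / h * \<bar>t - real i / real d\<bar> \<le> (real N + L) / h"
      using h d by (simp add: field_simps)
    have "Q (j mod d) \<le> exp (real d / h * \<bar>t - real i / real d\<bar>) * R (i mod d)"
      unfolding Qt Ri by (rule poisson_kernel_harnack_scaled[OF h d r])
    also have "\<dots> \<le> exp ((real N + L) / h) * R (i mod d)"
      using dist R0[of "i mod d"] by (intro mult_right_mono) auto
    finally have up: "Q (j mod d) - R (i mod d) \<le> c * R (i mod d)" by (simp add: c_def algebra_simps)
    have "R (i mod d) \<le> exp (real d / h * \<bar>real i / real d - t\<bar>) * Q (j mod d)"
      unfolding Qt Ri by (rule poisson_kernel_harnack_scaled[OF h d r])
    also have "\<dots> \<le> exp ((real N + L) / h) * Q (j mod d)"
      using dist circle_poisson_kernel_pos[OF r01, of "y - 2 * pi * s (j mod d)"]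
      by (intro mult_right_mono) (auto simp: Q_def abs_minus_commute)
    finally have low: "R (i mod d) \<le> (1 + c) * Q (j mod d)" by (simp add: c_def)
    have "R (i mod d) - Q (j mod d) \<le> c * R (i mod d)"
    proof (cases "Q (j mod d) \<le> R (i mod d)")
      case True
      hence "c * Q (j mod d) \<le> c * R (i mod d)" using c0 by (rule mult_left_mono)
      thus ?thesis using low by (simp add: algebra_simps)
    next
      case False
      have "0 \<le> c * R (i mod d)" using c0 R0[of "i mod d"] by simp
      thus ?thesis using False by linarith
    qed
    thus ?thesis using up by linarith
  qed
  have "\<bar>\<Sum>j<d. \<mu> j * Q j\<bar> \<le> (\<rho> * real N / real d / real N + L / real d * c) * (\<Sum>i<d. R i)"
  proof (rule block_average_bound[OF d N])
    show "0 \<le> R i" for i using R0[of i] by simp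
    show "\<bar>Q (j mod d) - R (i mod d)\<bar> \<le> c * R (i mod d)" if "\<bar>real i - real j\<bar> \<le> real N" for i j
      using near[OF that] .
    show "\<bar>\<mu> j\<bar> \<le> L / real d" if "j < d" for j using \<theta>[OF that] by (simp add: \<mu>_def)
    show "\<bar>\<Sum>j = m * N..<(m + 1) * N. \<mu> (j mod d)\<bar> \<le> \<rho> * real N / real d" if "m < d" for m
      using block[OF that] by (simp only: \<mu>_def)
  qed
  also have "(\<Sum>i<d. R i) = real d * circle_poisson_kernel (r ^ d) (real d * y)"
    unfolding R_def by (rule sum_poisson_kernel_equidistant[OF r01 d])
  also have "(\<rho> * real N / real d / real N + L / real d * c) * (real d * circle_poisson_kernel (r ^ d) (real d * y))
     = (\<rho> + L * c) * circle_poisson_kernel (r ^ d) (real d * y)"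
    using d N by (simp add: field_simps)
  also have "\<dots> \<le> (\<rho> + L * c) * ((1 + r ^ d) / (1 - r ^ d))"
    using circle_poisson_kernel_le[OF rd] \<rho> L c0 by (intro mult_left_mono) auto
  finally have le: "\<bar>\<Sum>j<d. \<mu> j * Q j\<bar> \<le> (\<rho> + L * c) * ((1 + r ^ d) / (1 - r ^ d))" .
  have bound: "\<bar>\<alpha>\<bar> \<le> 2 * pi * (\<rho> + L * c) * ((1 + r ^ d) / (1 - r ^ d))"
  proof -
    have "\<bar>\<alpha>\<bar> = 2 * pi * \<bar>\<Sum>j<d. \<mu> j * Q j\<bar>" by (simp add: \<alpha>_def abs_mult)
    also have "\<dots> \<le> 2 * pi * ((\<rho> + L * c) * ((1 + r ^ d) / (1 - r ^ d)))"
      by (intro mult_left_mono le) simp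
    finally show ?thesis by (simp only: mult.assoc)
  qed
  have B0: "(\<Prod>j<d. (z - of_real r * cis (2 * pi * real j / real d)) / (1 - cnj (of_real r * cis (2 * pi * real j / real d)) * z))
     = (z ^ d - of_real (r ^ d)) / (1 - of_real (r ^ d) * z ^ d)"
  proof -
    have "(\<Prod>j<d. 1 - cnj (of_real r * cis (2 * pi * real j / real d)) * z) =
      cnj (\<Prod>j<d. 1 - (of_real r * cnj z) * cis (2 * pi * real j / real d))"
      by (simp add: mult_ac)
    also have "\<dots> = 1 - of_real (r ^ d) * z ^ d"
      unfolding prod_minus_roots_of_unity[OF d] by (simp add: power_mult_distrib)
    finally show ?thesis unfolding prod_dividef prod_minus_roots_of_unity[OF d] by simp
  qed
  have "(\<Prod>j<d. (z - of_real r * cis (2 * pi * \<theta> j)) / (1 - cnj (of_real r * cis (2 * pi * \<theta> j)) * z)) =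
    (\<Prod>j<d. (z - of_real r * cis (2 * pi * real j / real d)) / (1 - cnj (of_real r * cis (2 * pi * real j / real d)) * z)
       * (cis (2 * pi * \<mu> j) * cis (- (2 * pi * (\<mu> j * Q j)))))"
    unfolding y blaschke_factor_polar[OF r01] s(2)
    by (simp add: Q_def cis_mult algebra_simps)
  also have "\<dots> = (z ^ d - of_real (r ^ d)) / (1 - of_real (r ^ d) * z ^ d) *
       (cis (\<Sum>j<d. 2 * pi * \<mu> j) * cis (\<Sum>j<d. - (2 * pi * (\<mu> j * Q j))))"
    unfolding prod.distrib B0 by (simp only: cis_sum)
  also have "(\<Sum>j<d. - (2 * pi * (\<mu> j * Q j))) = \<alpha>"
    by (simp add: \<alpha>_def sum_negf sum_distrib_left)
  also have "(\<Sum>j<d. 2 * pi * \<mu> j) = 2 * pi * (\<Sum>j<d. \<theta> j - real j / real d)"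
    by (simp only: sum_distrib_left \<mu>_def)
  finally show ?thesis
    by (intro that[OF bound[unfolded c_def]]) (simp only: mult.assoc)
qed

section \<open>Bounds at a single level\<close>

lemma poly_as_sum_lessThan:
  fixes p :: "complex poly"
  assumes "degree p < d"
  shows "poly p z = (\<Sum>k<d. coeff p k * z ^ k)"
  unfolding poly_altdef
  by (rule sum.mono_neutral_left) (use assms in \<open>auto simp: coeff_eq_0\<close>)

lemma circle_mean_powers:
  "circle_mean (\<lambda>z. z ^ k * cnj (z ^ l)) = (if k = l then 1 else 0)"
proof (cases k l rule: linorder_cases)
  case less
  have "degree (monom (1::complex) k) < l" using less by (simp add: degree_monom_eq)
  from circle_mean_poly_orthogonal[OF this, of "\<lambda>_. 1"] show ?thesis using less by (simp add: poly_monom)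
next
  case greater
  have "degree (monom (1::complex) l) < k" using greater by (simp add: degree_monom_eq)
  from circle_mean_poly_orthogonal[OF this, of "\<lambda>_. 1"]
  have "circle_mean (\<lambda>z. cnj (z ^ k * cnj (z ^ l))) = 0" by (simp add: poly_monom mult.commute)
  thus ?thesis using greater unfolding circle_mean_cnj by simp
next
  case equal
  have "circle_mean (\<lambda>z. z ^ k * cnj (z ^ l)) = circle_mean (\<lambda>_. 1 :: complex)"
    by (rule circle_mean_cong) (simp add: equal complex_norm_square[symmetric] norm_power del: complex_cnj_power of_real_power)
  thus ?thesis using equal by (simp add: circle_mean_def)
qed

lemma parseval_poly:
  fixes p :: "complex poly"
  assumes "degree p < d"
  shows "circle_mean (\<lambda>z. (cmod (poly p z))\<^sup>2) = (\<Sum>k<d. (cmod (coeff p k))\<^sup>2)"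
proof -
  have "complex_of_real (circle_mean (\<lambda>z. (cmod (poly p z))\<^sup>2)) =
      circle_mean (\<lambda>z. complex_of_real ((cmod (poly p z))\<^sup>2))"
    by (intro circle_mean_of_real[symmetric] continuous_intros)
  also have "\<dots> = circle_mean (\<lambda>z. \<Sum>k<d. \<Sum>l<d. coeff p k * cnj (coeff p l) * (z ^ k * cnj (z ^ l)))"
    unfolding complex_norm_square poly_as_sum_lessThan[OF assms]
    by (simp add: sum_product mult_ac)
  also have "\<dots> = (\<Sum>k<d. \<Sum>l<d. coeff p k * cnj (coeff p l) * circle_mean (\<lambda>z. z ^ k * cnj (z ^ l)))"
    by (subst circle_mean_sum, simp, (intro continuous_intros)[1])
       (subst circle_mean_sum, simp, (intro continuous_intros)[1], simp only: circle_mean_cmult)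
  also have "\<dots> = (\<Sum>k<d. coeff p k * cnj (coeff p k))"
    unfolding circle_mean_powers by (intro sum.cong refl) (simp add: if_distrib[of "\<lambda>x. _ * x"] cong: if_cong)
  also have "\<dots> = complex_of_real (\<Sum>k<d. (cmod (coeff p k))\<^sup>2)"
    by (simp only: of_real_sum complex_norm_square)
  finally show ?thesis by (simp only: of_real_eq_iff)
qed

lemma L2_norm_circle_sq: "(L2_norm_circle p)\<^sup>2 = circle_mean (\<lambda>z. (cmod (poly p z))\<^sup>2)"
proof -
  have "0 \<le> circle_mean (\<lambda>z. (cmod (poly p z))\<^sup>2)"
    using parseval_poly[of p "Suc (degree p)"] by (simp add: sum_nonneg)
  thus ?thesis unfolding L2_norm_circle_def circle_mean_def[symmetric]
    by (simp add: circle_mean_def)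
qed

text \<open>
  The passage between the nodes on the unit circle and those on the circle of radius \<open>r\<close> loses
  nothing in the direction that the lower bound needs.
\<close>

lemma poly_dilation:
  fixes p :: "complex poly"
  assumes r: "0 < r" "r < 1" and deg: "degree p < d"
  obtains p' where "degree p' < d" "\<And>z. poly p' (of_real r * z) = poly p z"
    "circle_mean (\<lambda>z. (cmod (poly p z))\<^sup>2) \<le> circle_mean (\<lambda>z. (cmod (poly p' z))\<^sup>2)"
    "circle_mean (\<lambda>z. (cmod (poly p' z))\<^sup>2) \<le> (1 / r ^ d)\<^sup>2 * circle_mean (\<lambda>z. (cmod (poly p z))\<^sup>2)"
proof
  let ?p = "pcompose p [:0, of_real (1 / r):]"
  show deg': "degree ?p < d"
    using deg r by (simp add: degree_pcompose)
  show "poly ?p (of_real r * z) = poly p z" for z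
    using r by (simp add: poly_pcompose)
  have c: "cmod (coeff ?p k) = (1 / r) ^ k * cmod (coeff p k)" for k
    using r by (simp add: coeff_pcompose_linear norm_mult norm_power norm_divide)
  show "circle_mean (\<lambda>z. (cmod (poly p z))\<^sup>2) \<le> circle_mean (\<lambda>z. (cmod (poly ?p z))\<^sup>2)"
    unfolding parseval_poly[OF deg] parseval_poly[OF deg'] c
    using r by (intro sum_mono power_mono) (auto intro!: mult_left_le_one_le mult_right_le_one_le simp: mult_le_cancel_right1 one_le_power)
  show "circle_mean (\<lambda>z. (cmod (poly ?p z))\<^sup>2) \<le> (1 / r ^ d)\<^sup>2 * circle_mean (\<lambda>z. (cmod (poly p z))\<^sup>2)"
    unfolding parseval_poly[OF deg] parseval_poly[OF deg'] c sum_distrib_left power_mult_distrib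
  proof (intro sum_mono mult_right_mono power_mono)
    fix k assume "k \<in> {..<d}"
    hence "(1 / r) ^ k \<le> (1 / r) ^ d" using r by (intro power_increasing) auto
    thus "(1 / r) ^ k \<le> 1 / r ^ d" by (simp add: power_divide)
  qed (use r in auto)
qed

text \<open>
  By Harnack's inequality a shift by \<open>L / d\<close> costs at most a factor \<open>exp (L / h)\<close>, and for equidistant
  points the sum is explicit.
\<close>

lemma poisson_sum_le:
  assumes d: "d \<ge> 1" and h: "h > 0" and r: "r = exp (- (2 * pi * h / real d))"
    and \<theta>: "\<And>j. j < d \<Longrightarrow> \<bar>\<theta> j - real j / real d\<bar> \<le> L / real d"
    and z: "cmod z = 1"
  shows "(\<Sum>j<d. poisson (of_real r * cis (2 * pi * \<theta> j)) z) \<le>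
           exp (L / h) * (real d * ((1 + r ^ d) / (1 - r ^ d)))"
proof -
  obtain y where y: "z = cis y"
    using complex_norm_eq_1_exp[of z] z by (metis cis_conv_exp)
  have r01: "0 \<le> r" "r < 1" using h d by (simp_all add: r)
  have rd: "0 \<le> r ^ d" "r ^ d < 1" using r01 d by (auto simp: power_less_one_iff)
  have "(\<Sum>j<d. poisson (of_real r * cis (2 * pi * \<theta> j)) z) =
        (\<Sum>j<d. circle_poisson_kernel r (y - 2 * pi * \<theta> j))"
    unfolding y poisson_polar ..
  also have "\<dots> \<le> (\<Sum>j<d. exp (L / h) * circle_poisson_kernel r (y - 2 * pi * real j / real d))"
  proof (rule sum_mono)
    fix j assume "j \<in> {..<d}"
    hence "real d / h * \<bar>\<theta> j - real j / real d\<bar> \<le> real d / h * (L / real d)"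
      using \<theta>[of j] h by (intro mult_left_mono) auto
    also have "\<dots> = L / h" using d by simp
    finally have "exp (real d / h * \<bar>\<theta> j - real j / real d\<bar>) \<le> exp (L / h)" by simp
    from mult_right_mono[OF this less_imp_le[OF circle_poisson_kernel_pos[OF r01, of "y - 2 * pi * (real j / real d)"]]]
    show "circle_poisson_kernel r (y - 2 * pi * \<theta> j) \<le> exp (L / h) * circle_poisson_kernel r (y - 2 * pi * real j / real d)"
      using poisson_kernel_harnack_scaled[OF h d r, of y "\<theta> j" "real j / real d"] by simp
  qed
  also have "\<dots> = exp (L / h) * (real d * circle_poisson_kernel (r ^ d) (real d * y))"
    unfolding sum_distrib_left[symmetric] sum_poisson_kernel_equidistant[OF r01 d] ..
  also have "\<dots> \<le> exp (L / h) * (real d * ((1 + r ^ d) / (1 - r ^ d)))"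
    using circle_poisson_kernel_le[OF rd] by (intro mult_left_mono) auto
  finally show ?thesis .
qed

text \<open>
  The embedding of \<open>sum_square_values_le\<close> for the dilated polynomial, whose norm exceeds that of \<open>p\<close> by
  at most the factor \<open>exp (2 \<pi> h)\<close>.
\<close>

lemma level_upper_bound:
  fixes p :: "complex poly"
  assumes d: "d \<ge> 1" and h: "h > 0"
    and \<theta>: "\<And>j. j < d \<Longrightarrow> \<bar>\<theta> j - real j / real d\<bar> \<le> L / real d"
    and deg: "degree p < d"
  shows "(\<Sum>j<d. (cmod (poly p (cis (2 * pi * \<theta> j))))\<^sup>2) \<le>
     real d * (exp (L / h) * ((1 + exp (- (2 * pi * h))) / (1 - exp (- (2 * pi * h)))) * exp (4 * pi * h)) *
       circle_mean (\<lambda>z. (cmod (poly p z))\<^sup>2)"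
proof -
  define r where "r = exp (- (2 * pi * h / real d))"
  have r01: "0 < r" "r < 1" using h d by (simp_all add: r_def)
  have rd: "r ^ d = exp (- (2 * pi * h))" using d by (simp add: r_def flip: exp_of_nat_mult)
  obtain p' where p': "\<And>z. poly p' (of_real r * z) = poly p z"
    "circle_mean (\<lambda>z. (cmod (poly p' z))\<^sup>2) \<le> (1 / r ^ d)\<^sup>2 * circle_mean (\<lambda>z. (cmod (poly p z))\<^sup>2)"
    using poly_dilation[OF r01 deg] by metis
  let ?M = "exp (L / h) * (real d * ((1 + r ^ d) / (1 - r ^ d)))"
  have M0: "?M \<ge> 0" using r01 by (simp add: power_le_one)
  have "(\<Sum>j<d. (cmod (poly p (cis (2 * pi * \<theta> j))))\<^sup>2) =
        (\<Sum>j<d. (cmod (poly p' (of_real r * cis (2 * pi * \<theta> j))))\<^sup>2)"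
    by (simp only: p'(1))
  also have "\<dots> \<le> ?M * circle_mean (\<lambda>z. (cmod (poly p' z))\<^sup>2)"
    using poisson_sum_le[OF d h r_def \<theta>] r01
    by (intro sum_square_values_le[where a = "\<lambda>j. of_real r * cis (2 * pi * \<theta> j)"] holomorphic_intros)
       (auto simp: norm_mult)
  also have "\<dots> \<le> ?M * ((1 / r ^ d)\<^sup>2 * circle_mean (\<lambda>z. (cmod (poly p z))\<^sup>2))"
    using p'(2) M0 by (rule mult_left_mono)
  also have "(1 / r ^ d)\<^sup>2 = exp (4 * pi * h)"
  proof -
    have "1 / r ^ d = exp (2 * pi * h)" unfolding rd by (simp add: exp_minus divide_inverse)
    thus ?thesis by (simp add: power2_eq_square flip: exp_add)
  qed
  finally show ?thesis unfolding rd by (simp add: mult_ac)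
qed

text \<open>
  The constant \<open>s\<close> is the best choice for numbers on the unit circle with real part at least \<open>s\<close>; the
  number \<open>\<kappa>\<close> pays for replacing the constant by a multiple of a unimodular \<open>v\<close> near 1.
\<close>

lemma unimodular_distance:
  assumes "cmod w = 1" "cmod v = 1" "s + \<kappa> \<le> Re w" "cmod (v - 1) \<le> \<kappa>" "0 \<le> s"
  shows "(cmod (w - of_real s * v))\<^sup>2 \<le> 1 - s\<^sup>2"
proof -
  have "cnj v = 1 + cnj (v - 1)" by simp
  hence "Re (w * cnj v) = Re w + Re (w * cnj (v - 1))" by (metis distrib_left mult.right_neutral plus_complex.sel(1))
  moreover have "\<bar>Re (w * cnj (v - 1))\<bar> \<le> \<kappa>"
    using abs_Re_le_cmod[of "w * cnj (v - 1)"] assms unfolding norm_mult complex_mod_cnj by simp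
  ultimately have ge: "s \<le> Re (w * cnj v)" using assms(3) by linarith
  have "complex_of_real ((cmod (w - of_real s * v))\<^sup>2) =
      of_real ((cmod w)\<^sup>2) + of_real (s\<^sup>2) * of_real ((cmod v)\<^sup>2) - of_real s * (w * cnj v + cnj (w * cnj v))"
    unfolding complex_norm_square by (simp add: algebra_simps power2_eq_square)
  also have "\<dots> = of_real (1 + s\<^sup>2 - 2 * s * Re (w * cnj v))"
    unfolding complex_add_cnj using assms by simp
  finally have "(cmod (w - of_real s * v))\<^sup>2 = 1 + s\<^sup>2 - 2 * s * Re (w * cnj v)"
    by (simp only: of_real_eq_iff)
  moreover have "s * s \<le> s * Re (w * cnj v)" using ge assms(5) by (rule mult_left_mono)
  ultimately show ?thesis by (simp add: power2_eq_square)
qed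

lemma infdist_Ints_le: "infdist x \<int> \<le> \<bar>x - of_int n\<bar>" for x :: real
  using infdist_le[of "of_int n" \<int> x] by (simp add: dist_real_def)

text \<open>
  Measured from \<open>\<theta>\<^sub>j\<close> modulo 1, the other nodes are points of \<open>[1 / K, 1 - 1 / K]\<close> with gaps at least
  \<open>1 / K\<close>.
\<close>

lemma separated_nodes_product:
  fixes \<theta> :: "'i \<Rightarrow> real"
  assumes r: "0 < r" "r < 1" and K: "K \<ge> 1" and I: "finite I" and j: "j \<in> I"
    and sep: "\<And>i k. i \<in> I \<Longrightarrow> k \<in> I \<Longrightarrow> i \<noteq> k \<Longrightarrow> 1 / real K \<le> infdist (\<theta> i - \<theta> k) \<int>"
  shows "r ^ (K - 1) \<le> (\<Prod>k\<in>I-{j}. cmod (of_real r * cis (2 * pi * \<theta> j) - of_real r * cis (2 * pi * \<theta> k)) /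
      cmod (1 - cnj (of_real r * cis (2 * pi * \<theta> k)) * (of_real r * cis (2 * pi * \<theta> j))))"
proof -
  define u where "u = (\<lambda>k. frac (\<theta> j - \<theta> k))"
  have u_int: "u k = \<theta> j - \<theta> k - of_int \<lfloor>\<theta> j - \<theta> k\<rfloor>" for k by (simp add: u_def frac_def)
  have r2: "0 < r\<^sup>2" "r\<^sup>2 \<le> 1" using r by (auto simp: power_le_one)
  have u1: "1 / real K \<le> u k" if "k \<in> I - {j}" for k
  proof -
    have "1 / real K \<le> infdist (\<theta> j - \<theta> k) \<int>" using sep that j by auto
    also have "\<dots> \<le> \<bar>\<theta> j - \<theta> k - of_int \<lfloor>\<theta> j - \<theta> k\<rfloor>\<bar>" by (rule infdist_Ints_le)
    also have "\<dots> = u k" by (simp add: u_def frac_def[symmetric])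
    finally show ?thesis .
  qed
  have u2: "u k \<le> 1 - 1 / real K" if "k \<in> I - {j}" for k
  proof -
    have "1 / real K \<le> infdist (\<theta> j - \<theta> k) \<int>" using sep that j by auto
    also have "\<dots> \<le> \<bar>\<theta> j - \<theta> k - of_int (\<lfloor>\<theta> j - \<theta> k\<rfloor> + 1)\<bar>" by (rule infdist_Ints_le)
    also have "\<dots> = 1 - u k" using frac_lt_1[of "\<theta> j - \<theta> k"] by (simp add: u_def frac_def)
    finally show ?thesis by simp
  qed
  have gap: "1 / real K \<le> \<bar>u i - u k\<bar>" if "i \<in> I - {j}" "k \<in> I - {j}" "i \<noteq> k" for i k
  proof -
    have "1 / real K \<le> infdist (\<theta> k - \<theta> i) \<int>" using sep that by auto
    also have "\<dots> \<le> \<bar>\<theta> k - \<theta> i - of_int (\<lfloor>\<theta> j - \<theta> i\<rfloor> - \<lfloor>\<theta> j - \<theta> k\<rfloor>)\<bar>" by (rule infdist_Ints_le)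
    also have "\<dots> = \<bar>u i - u k\<bar>" by (simp add: u_int)
    finally show ?thesis .
  qed
  let ?f = "\<lambda>k. cmod (of_real r * cis (2 * pi * \<theta> j) - of_real r * cis (2 * pi * \<theta> k)) /
      cmod (1 - cnj (of_real r * cis (2 * pi * \<theta> k)) * (of_real r * cis (2 * pi * \<theta> j)))"
  have f: "(?f k)\<^sup>2 = 1 / sep_factor (r\<^sup>2) (2 * pi * u k)" for k
  proof -
    have cu: "cis (2 * pi * \<theta> j) * cis (- (2 * pi * \<theta> k)) = cis (2 * pi * u k)"
    proof -
      have "2 * pi * \<theta> j + - (2 * pi * \<theta> k) = 2 * pi * u k + 2 * pi * of_int \<lfloor>\<theta> j - \<theta> k\<rfloor>"
        by (simp add: u_int algebra_simps)
      thus ?thesis unfolding cis_mult by (simp only: cis_mult[symmetric] cis_multiple_2pi Ints_of_int mult_1_right)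
    qed
    have "of_real r * cis (2 * pi * \<theta> j) - of_real r * cis (2 * pi * \<theta> k) =
        of_real r * cis (2 * pi * \<theta> k) * (cis (2 * pi * u k) - 1)"
      unfolding cu[symmetric] by (simp add: algebra_simps cis_mult)
    hence "cmod (of_real r * cis (2 * pi * \<theta> j) - of_real r * cis (2 * pi * \<theta> k)) = r * cmod (1 - cis (2 * pi * u k))"
      using r by (simp add: norm_mult norm_minus_commute)
    moreover have "1 - cnj (of_real r * cis (2 * pi * \<theta> k)) * (of_real r * cis (2 * pi * \<theta> j)) =
        1 - of_real (r\<^sup>2) * cis (2 * pi * u k)"
      unfolding cu[symmetric] by (simp add: cis_cnj power2_eq_square mult_ac)
    ultimately show ?thesis
      unfolding power_divide power_mult_distrib sep_factor_def
      by (simp only: power_mult_distrib norm_one_minus_cis norm_cis_minus_cis) simp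
  qed
  have pos: "0 < (\<Prod>k\<in>I-{j}. sep_factor (r\<^sup>2) (2 * pi * u k))"
  proof (rule prod_pos)
    fix k assume k: "k \<in> I - {j}"
    have "cos (2 * pi * u k) < 1"
    proof (rule cos_2pi_less_1)
      have "0 < 1 / real K" using K by simp
      thus "0 < u k" using u1[OF k] by linarith
      show "u k < 1" unfolding u_def by (rule frac_lt_1)
    qed
    from sep_factor_ge_1[OF r2(1) this] show "0 < sep_factor (r\<^sup>2) (2 * pi * u k)" by simp
  qed
  have "(r ^ (K - 1))\<^sup>2 = 1 / (1 / r\<^sup>2) ^ (K - 1)" using r by (simp add: power_divide power_mult[symmetric] mult.commute)
  also have "\<dots> \<le> 1 / (\<Prod>k\<in>I-{j}. sep_factor (r\<^sup>2) (2 * pi * u k))"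
    using prod_sep_factor_le[OF r2 K, of "I - {j}" u] u1 u2 gap I pos
    by (intro divide_left_mono) (auto intro!: mult_pos_pos simp: r)
  also have "\<dots> = (\<Prod>k\<in>I-{j}. ?f k)\<^sup>2"
    unfolding prod_power_distrib f by (simp add: prod_dividef)
  finally show ?thesis by (rule power2_le_imp_le) (simp add: prod_nonneg)
qed

text \<open>
  The parameter \<open>b\<close> bounds the phase error, and \<open>s\<close> is the resulting lower bound for the real part of
  \<open>B z\<^sup>-\<^sup>d\<close> after multiplication by a unimodular constant; the term \<open>2 q / (1 - q)\<close> bounds the distance
  of the Blaschke product with zeros \<open>r cis (2 \<pi> j / d)\<close> from \<open>z\<^sup>d\<close>. In \<open>blaschke_lower_bound\<close> this gives \<open>1 - \<eta>\<^sup>2 = s\<^sup>2\<close>.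
\<close>

theorem level_lower_bound:
  fixes p :: "complex poly" and \<theta> :: "nat \<Rightarrow> real"
  defines "q \<equiv> \<lambda>h. exp (- (2 * pi * h))"
  assumes d: "d \<ge> 1" and N: "N \<ge> 1" and h: "h > 0" and L: "L > 0"
    and \<theta>: "\<And>j. j < d \<Longrightarrow> \<bar>\<theta> j - real j / real d\<bar> \<le> L / real d"
    and block: "\<And>m. m < d \<Longrightarrow>
      \<bar>\<Sum>j = m * N..<(m + 1) * N. \<theta> (j mod d) - real (j mod d) / real d\<bar> \<le> \<rho> * real N / real d"
    and \<rho>: "\<rho> \<ge> 0"
    and sep: "\<And>i j. i < d \<Longrightarrow> j < d \<Longrightarrow> i \<noteq> j \<Longrightarrow> \<delta> / real d \<le> infdist (\<theta> i - \<theta> j) \<int>" and \<delta>: "\<delta> > 0"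
    and b: "2 * pi * (\<rho> + L * (exp ((real N + L) / h) - 1)) * ((1 + q h) / (1 - q h)) \<le> b" "b \<le> pi"
    and s: "0 \<le> s" "s + 2 * q h / (1 - q h) \<le> cos b"
    and deg: "degree p < d"
  shows "s\<^sup>2 * circle_mean (\<lambda>z. (cmod (poly p z))\<^sup>2) \<le>
     exp (L / h) * ((1 + q h) / (1 - q h)) * (4 * pi * h)\<^sup>2 * exp (4 * pi * h / \<delta>) *
     (1 / real d * (\<Sum>j<d. (cmod (poly p (cis (2 * pi * \<theta> j))))\<^sup>2))"
proof -
  define r where "r = exp (- (2 * pi * h / real d))"
  have r01: "0 < r" "r < 1" using h d by (simp_all add: r_def)
  have rd: "r ^ d = q h" using d by (simp add: r_def q_def flip: exp_of_nat_mult)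
  have q: "0 < q h" "q h < 1" using h by (auto simp: q_def)
  define a where "a = (\<lambda>j. of_real r * cis (2 * pi * \<theta> j))"
  \<comment> \<open>The smallest \<open>K\<close> with gaps of at least \<open>1 / K\<close>; what counts is that \<open>K - 1 \<le> d / \<delta>\<close>.\<close>
  define K where "K = nat \<lceil>real d / \<delta>\<rceil>"
  have dd: "real d / \<delta> > 0" using d \<delta> by simp
  have K: "K \<ge> 1" "real d / \<delta> \<le> real K" "real K - 1 \<le> real d / \<delta>"
    using dd unfolding K_def by linarith+
  have "1 / real K \<le> \<delta> / real d"
    using K d \<delta> by (simp add: field_simps)
  hence sep': "1 / real K \<le> infdist (\<theta> i - \<theta> j) \<int>" if "i \<in> {..<d}" "j \<in> {..<d}" "i \<noteq> j" for i j
    using sep[of i j] that by auto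
  have a1: "cmod (a j) = r" for j using r01 by (simp add: a_def norm_mult)
  have prod: "r ^ (K - 1) \<le> (\<Prod>k\<in>{..<d}-{j}. cmod (a j - a k) / cmod (1 - cnj (a k) * a j))" if "j < d" for j
    unfolding a_def by (rule separated_nodes_product[OF r01 K(1)]) (use that sep' in auto)
  have inj: "inj_on a {..<d}"
  proof (rule inj_onI, rule ccontr)
    fix j k assume jk: "j \<in> {..<d}" "k \<in> {..<d}" "a j = a k" "j \<noteq> k"
    hence "(\<Prod>k\<in>{..<d}-{j}. cmod (a j - a k) / cmod (1 - cnj (a k) * a j)) = 0"
      by (intro prod_zero bexI[of _ k]) auto
    moreover have "0 < r ^ (K - 1)" using r01 by simp
    moreover have "j < d" using jk by simp
    ultimately show False using prod[of j] by linarith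
  qed
  define M where "M = exp (L / h) * (real d * ((1 + q h) / (1 - q h)))"
  have M0: "M > 0" using q d by (simp add: M_def)
  have M: "(\<Sum>j<d. poisson (a j) z) \<le> M" if "cmod z = 1" for z
    using poisson_sum_le[OF d h r_def \<theta> that] unfolding M_def a_def rd by simp
  define \<gamma> where "\<gamma> = of_real s * cis (2 * pi * (\<Sum>j<d. \<theta> j - real j / real d))"
  have s1: "s \<le> 1"
  proof -
    have "0 \<le> 2 * q h / (1 - q h)" using q by simp
    thus ?thesis using s(2) cos_le_one[of b] by linarith
  qed
  have s2: "s\<^sup>2 \<le> 1" by (rule power_le_one[OF s(1) s1])
  have dist: "cmod ((\<Prod>j<d. (z - a j) / (1 - cnj (a j) * z)) - \<gamma> * z ^ card {..<d}) \<le> sqrt (1 - s\<^sup>2)"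
    if z: "cmod z = 1" for z
  proof -
    define Z where "Z = z ^ d"
    have Z: "cmod Z = 1" by (simp add: Z_def norm_power z)
    obtain \<alpha> where \<alpha>: "\<bar>\<alpha>\<bar> \<le> 2 * pi * (\<rho> + L * (exp ((real N + L) / h) - 1)) * ((1 + q h) / (1 - q h))"
      "(\<Prod>j<d. (z - a j) / (1 - cnj (a j) * z)) =
       (Z - of_real (q h)) / (1 - of_real (q h) * Z) *
       cis (2 * pi * (\<Sum>j<d. \<theta> j - real j / real d)) * cis \<alpha>"
    proof (rule blaschke_product_phase[OF d N h L r_def \<theta> block \<rho> z])
      fix \<alpha>
      assume "\<bar>\<alpha>\<bar> \<le> 2 * pi * (\<rho> + L * (exp ((real N + L) / h) - 1)) * ((1 + r ^ d) / (1 - r ^ d))"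
        "(\<Prod>j<d. (z - of_real r * cis (2 * pi * \<theta> j)) / (1 - cnj (of_real r * cis (2 * pi * \<theta> j)) * z)) =
          (z ^ d - of_real (r ^ d)) / (1 - of_real (r ^ d) * z ^ d) *
          cis (2 * pi * (\<Sum>j<d. \<theta> j - real j / real d)) * cis \<alpha>"
      thus thesis unfolding rd a_def[symmetric] Z_def[symmetric]
        by (intro that[of \<alpha>]) (simp_all only: a_def)
    qed
    define B0 where "B0 = (Z - of_real (q h)) / (1 - of_real (q h) * Z)"
    have ge: "1 - q h \<le> cmod (Z - of_real (q h))"
      using norm_triangle_ineq2[of Z "of_real (q h)"] Z q by simp
    have eq: "cmod (Z - of_real (q h)) = cmod (1 - of_real (q h) * Z)"
    proof -
      have "Z - of_real (q h) = Z * cnj (1 - of_real (q h) * Z)"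
        using complex_norm_square[of Z] Z by (simp add: algebra_simps)
      thus ?thesis by (simp only: norm_mult Z complex_mod_cnj mult_1)
    qed
    have B0: "cmod B0 = 1" "B0 \<noteq> 0" using ge eq q by (auto simp: B0_def norm_divide)
    define v where "v = Z / B0"
    have v: "cmod v = 1" by (simp add: v_def norm_divide Z B0)
    have nz: "Z - of_real (q h) \<noteq> 0" "1 - of_real (q h) * Z \<noteq> 0"
      using ge eq q by (auto simp del: right_minus_eq)
    have "v - 1 = of_real (q h) * (1 - Z\<^sup>2) / (Z - of_real (q h))"
      using nz unfolding v_def B0_def by (simp add: field_simps power2_eq_square)
    hence "cmod (v - 1) = q h * cmod (1 - Z\<^sup>2) / cmod (Z - of_real (q h))"
      using q by (simp add: norm_mult norm_divide)
    also have "\<dots> \<le> q h * 2 / (1 - q h)"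
      using norm_triangle_ineq4[of 1 "Z\<^sup>2"] Z q ge
      by (intro frac_le mult_left_mono) (auto simp: norm_power)
    finally have v1: "cmod (v - 1) \<le> 2 * q h / (1 - q h)" by (simp add: mult.commute)
    have "cos b \<le> cos \<bar>\<alpha>\<bar>" using \<alpha>(1) b by (intro cos_monotone_0_pi_le) auto
    hence re: "s + 2 * q h / (1 - q h) \<le> Re (cis \<alpha>)" using s(2) by simp
    have "(\<Prod>j<d. (z - a j) / (1 - cnj (a j) * z)) - \<gamma> * z ^ card {..<d} =
       B0 * cis (2 * pi * (\<Sum>j<d. \<theta> j - real j / real d)) * (cis \<alpha> - of_real s * v)"
      using B0 unfolding \<alpha>(2) B0_def[symmetric] \<gamma>_def v_def card_lessThan Z_def[symmetric]
      by (simp add: field_simps)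
    hence "(cmod ((\<Prod>j<d. (z - a j) / (1 - cnj (a j) * z)) - \<gamma> * z ^ card {..<d}))\<^sup>2 = (cmod (cis \<alpha> - of_real s * v))\<^sup>2"
      by (simp add: norm_mult B0)
    also have "\<dots> \<le> 1 - s\<^sup>2" by (rule unimodular_distance[OF norm_cis v re v1 s(1)])
    finally show ?thesis by (rule real_le_rsqrt)
  qed
  obtain p' where p': "degree p' < d" "\<And>z. poly p' (of_real r * z) = poly p z"
    "circle_mean (\<lambda>z. (cmod (poly p z))\<^sup>2) \<le> circle_mean (\<lambda>z. (cmod (poly p' z))\<^sup>2)"
    using poly_dilation[OF r01 deg] by metis
  let ?S = "\<Sum>j<d. (cmod (poly p (cis (2 * pi * \<theta> j))))\<^sup>2"
  have S0: "?S \<ge> 0" by (intro sum_nonneg) simp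
  have "s\<^sup>2 * circle_mean (\<lambda>z. (cmod (poly p z))\<^sup>2) \<le> s\<^sup>2 * circle_mean (\<lambda>z. (cmod (poly p' z))\<^sup>2)"
    using p'(3) by (rule mult_left_mono) simp
  also have "\<dots> = (1 - (sqrt (1 - s\<^sup>2))\<^sup>2) * circle_mean (\<lambda>z. (cmod (poly p' z))\<^sup>2)"
    using s2 by simp
  also have "\<dots> \<le> M / (r ^ (K - 1))\<^sup>2 * (\<Sum>j<d. (1 - (cmod (a j))\<^sup>2)\<^sup>2 * (cmod (poly p' (a j)))\<^sup>2)"
    using r01 a1 p'(1) prod
    by (intro blaschke_lower_bound[where \<gamma> = \<gamma>] inj M M0 dist) auto
  also have "(\<Sum>j<d. (1 - (cmod (a j))\<^sup>2)\<^sup>2 * (cmod (poly p' (a j)))\<^sup>2) = (1 - r\<^sup>2)\<^sup>2 * ?S"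
  proof -
    have "poly p' (a j) = poly p (cis (2 * pi * \<theta> j))" for j unfolding a_def by (rule p'(2))
    thus ?thesis by (simp add: a1 sum_distrib_left)
  qed
  also have "M / (r ^ (K - 1))\<^sup>2 * ((1 - r\<^sup>2)\<^sup>2 * ?S) \<le> (M * exp (4 * pi * h / \<delta>)) * ((4 * pi * h / real d)\<^sup>2 * ?S)"
  proof (intro mult_mono mult_nonneg_nonneg S0)
    have "(r ^ (K - 1))\<^sup>2 = exp (- (4 * pi * h / real d * (real K - 1)))"
      using K(1) by (simp add: r_def power2_eq_square of_nat_diff mult.commute flip: exp_of_nat_mult exp_add)
    also have "\<dots> \<ge> exp (- (4 * pi * h / real d * (real d / \<delta>)))"
    proof -
      have "4 * pi * h / real d * (real K - 1) \<le> 4 * pi * h / real d * (real d / \<delta>)"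
        using h by (intro mult_left_mono K(3)) auto
      thus ?thesis by simp
    qed
    finally have "exp (- (4 * pi * h / \<delta>)) \<le> (r ^ (K - 1))\<^sup>2" using d by simp
    hence "M / (r ^ (K - 1))\<^sup>2 \<le> M / exp (- (4 * pi * h / \<delta>))"
      using M0 r01 by (intro divide_left_mono) auto
    thus "M / (r ^ (K - 1))\<^sup>2 \<le> M * exp (4 * pi * h / \<delta>)" by (simp add: exp_minus divide_inverse)
    have "r\<^sup>2 = exp (- (4 * pi * h / real d))" by (simp add: r_def power2_eq_square flip: exp_add)
    hence "1 - r\<^sup>2 \<le> 4 * pi * h / real d" using exp_ge_add_one_self[of "- (4 * pi * h / real d)"] by simp
    thus "(1 - r\<^sup>2)\<^sup>2 \<le> (4 * pi * h / real d)\<^sup>2"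
      using r01 by (intro power_mono) (auto simp: power_le_one)
  qed (use M0 in auto)
  also have "\<dots> = exp (L / h) * ((1 + q h) / (1 - q h)) * (4 * pi * h)\<^sup>2 * exp (4 * pi * h / \<delta>) * (1 / real d * ?S)"
    using d by (simp add: M_def power2_eq_square)
  finally show ?thesis .
qed

lemma discrete_parseval:
  "(\<Sum>j<d. (cmod (\<Sum>k<d. b k * cis (2 * pi * real j / real d) ^ k))\<^sup>2) = real d * (\<Sum>k<d. (cmod (b k))\<^sup>2)"
proof (cases "d = 0")
  case False
  hence d: "d \<ge> 1" by simp
  define w where "w = (\<lambda>j. cis (2 * pi * real j / real d))"
  have w1: "cmod (w j) = 1" for j by (simp add: w_def)
  have orth: "(\<Sum>j<d. w j ^ k * cnj (w j ^ l)) = (if k = l then of_nat d else 0)" if "k < d" "l < d" for k l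
  proof -
    have le: "(\<Sum>j<d. w j ^ k * cnj (w j ^ l)) = (if k = l then of_nat d else 0)" if "k < d" "l \<le> k" for k l
    proof -
      have "w j ^ k * cnj (w j ^ l) = w j ^ (k - l)" for j
      proof -
        have "w j ^ l * cnj (w j ^ l) = 1"
          unfolding complex_norm_square[symmetric] by (simp add: norm_power w1)
        moreover have "w j ^ k = w j ^ (k - l) * w j ^ l" using that by (simp flip: power_add)
        ultimately show ?thesis by (simp add: mult.assoc)
      qed
      thus ?thesis using sum_powers_root_of_unity[of "k - l" d] that by (auto simp: w_def)
    qed
    show ?thesis
    proof (cases "l \<le> k")
      case False
      have "(\<Sum>j<d. w j ^ k * cnj (w j ^ l)) = cnj (\<Sum>j<d. w j ^ l * cnj (w j ^ k))"
        by (simp add: mult.commute)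
      also have "\<dots> = 0" using False le[of l k] \<open>l < d\<close> by (simp del: cnj_sum complex_cnj_power complex_cnj_mult)
      finally show ?thesis using False by simp
    qed (use le that in auto)
  qed
  have "complex_of_real (\<Sum>j<d. (cmod (\<Sum>k<d. b k * w j ^ k))\<^sup>2) =
     (\<Sum>j<d. \<Sum>k<d. \<Sum>l<d. b k * cnj (b l) * (w j ^ k * cnj (w j ^ l)))"
    unfolding of_real_sum complex_norm_square by (simp add: sum_product mult_ac)
  also have "\<dots> = (\<Sum>k<d. \<Sum>l<d. b k * cnj (b l) * (\<Sum>j<d. w j ^ k * cnj (w j ^ l)))"
    unfolding sum_distrib_left by (subst sum.swap, rule sum.cong, simp, rule sum.swap)
  also have "\<dots> = (\<Sum>k<d. \<Sum>l<d. if k = l then b k * cnj (b k) * of_nat d else 0)"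
    by (intro sum.cong refl) (auto simp: orth simp del: complex_cnj_power)
  also have "\<dots> = complex_of_real (real d * (\<Sum>k<d. (cmod (b k))\<^sup>2))"
    unfolding of_real_mult of_real_sum complex_norm_square by (simp add: sum_distrib_left mult_ac)
  finally show ?thesis unfolding w_def by (simp only: of_real_eq_iff)
qed simp

lemma L2_set_norm_sum_le:
  fixes v :: "'n \<Rightarrow> 'i \<Rightarrow> complex"
  assumes "finite T"
  shows "L2_set (\<lambda>j. cmod (\<Sum>n\<in>T. v n j)) A \<le> (\<Sum>n\<in>T. L2_set (\<lambda>j. cmod (v n j)) A)"
  using assms
proof induction
  case (insert n F)
  have "L2_set (\<lambda>j. cmod (\<Sum>n\<in>insert n F. v n j)) A \<le> L2_set (\<lambda>j. cmod (v n j) + cmod (\<Sum>n\<in>F. v n j)) A"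
    using insert by (intro L2_set_mono) (auto simp: norm_triangle_ineq)
  also have "\<dots> \<le> L2_set (\<lambda>j. cmod (v n j)) A + L2_set (\<lambda>j. cmod (\<Sum>n\<in>F. v n j)) A"
    by (rule L2_set_triangle_ineq)
  finally show ?case using insert by simp
qed (simp add: L2_set_def)

text \<open>
  Taylor expansion around the roots of unity, in the manner of Duffin and Eachus. After multiplication
  by a unimodular function the frequencies of \<open>p\<close> lie in \<open>[- \<pi> d, \<pi> d]\<close>. The \<open>n\<close>-th term then has norm at
  most \<open>(\<pi> L)\<^sup>n / n!\<close> relative to the values at the roots of unity, and the terms with \<open>n \<ge> 1\<close> sum to
  \<open>exp (\<pi> L) - 1\<close>.
\<close>

lemma small_deviation_lower_bound:
  fixes p :: "complex poly" and \<theta> :: "nat \<Rightarrow> real"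
  assumes d: "d \<ge> 1" and L: "L \<ge> 0"
    and \<theta>: "\<And>j. j < d \<Longrightarrow> \<bar>\<theta> j - real j / real d\<bar> \<le> L / real d"
    and eL: "exp (pi * L) \<le> 2"
    and deg: "degree p < d"
  shows "(2 - exp (pi * L))\<^sup>2 * circle_mean (\<lambda>z. (cmod (poly p z))\<^sup>2) \<le>
           1 / real d * (\<Sum>j<d. (cmod (poly p (cis (2 * pi * \<theta> j))))\<^sup>2)"
proof -
  define S where "S = (\<Sum>k<d. (cmod (coeff p k))\<^sup>2)"
  have S0: "S \<ge> 0" by (simp add: S_def sum_nonneg)
  \<comment> \<open>Centring the frequencies at \<open>(d - 1) / 2\<close> halves the largest of them without changing moduli.\<close>
  define f where "f = (\<lambda>k. 2 * pi * (real k - (real d - 1) / 2))"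
  have f: "\<bar>f k\<bar> \<le> pi * real d" if "k < d" for k
  proof -
    have "real k + 1 \<le> real d" using that by simp
    hence "\<bar>real k - (real d - 1) / 2\<bar> \<le> real d / 2" by (simp add: abs_le_iff field_simps)
    thus ?thesis by (simp add: f_def abs_mult)
  qed
  define \<mu> where "\<mu> = (\<lambda>j. \<theta> j - real j / real d)"
  define F where "F = (\<lambda>t. \<Sum>k<d. coeff p k * cis (f k * t))"
  have phase: "cis (f k * t) = cis (- (pi * (real d - 1) * t)) * cis (2 * pi * t) ^ k" for k t
    unfolding f_def Complex.DeMoivre cis_mult by (rule arg_cong[where f = cis]) (simp add: field_simps)
  have F: "cmod (F t) = cmod (poly p (cis (2 * pi * t)))" for t
  proof -
    have "F t = cis (- (pi * (real d - 1) * t)) * poly p (cis (2 * pi * t))"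
      unfolding F_def poly_as_sum_lessThan[OF deg] phase by (simp add: sum_distrib_left mult_ac)
    thus ?thesis by (simp add: norm_mult)
  qed
  define v where "v = (\<lambda>n j. (\<Sum>k<d. (coeff p k * (\<i> * of_real (f k)) ^ n) * cis (f k * (real j / real d))) *
      (of_real (\<mu> j) ^ n /\<^sub>R fact n))"
  have v_sums: "(\<lambda>n. v n j) sums F (\<theta> j)" for j
  proof -
    have "(\<lambda>n. coeff p k * cis (f k * (real j / real d)) * ((\<i> * of_real (f k * \<mu> j)) ^ n /\<^sub>R fact n)) sums
       (coeff p k * cis (f k * (real j / real d)) * exp (\<i> * of_real (f k * \<mu> j)))" for k
      by (intro sums_mult exp_converges)
    hence "(\<lambda>n. \<Sum>k<d. coeff p k * cis (f k * (real j / real d)) * ((\<i> * of_real (f k * \<mu> j)) ^ n /\<^sub>R fact n)) sums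
       (\<Sum>k<d. coeff p k * cis (f k * (real j / real d)) * exp (\<i> * of_real (f k * \<mu> j)))"
      by (intro sums_sum) auto
    moreover have "(\<Sum>k<d. coeff p k * cis (f k * (real j / real d)) * ((\<i> * of_real (f k * \<mu> j)) ^ n /\<^sub>R fact n)) = v n j" for n
      unfolding v_def sum_distrib_right by (intro sum.cong refl) (simp add: power_mult_distrib scaleR_conv_of_real mult_ac)
    moreover have "cis (f k * (real j / real d)) * exp (\<i> * of_real (f k * \<mu> j)) = cis (f k * \<theta> j)" for k
      unfolding cis_conv_exp[symmetric] cis_mult by (simp add: \<mu>_def algebra_simps)
    ultimately show ?thesis by (simp add: F_def mult.assoc)
  qed
  have norm_sum: "L2_set (\<lambda>j. cmod (\<Sum>k<d. b k * cis (f k * (real j / real d)))) {..<d} =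
      sqrt (real d * (\<Sum>k<d. (cmod (b k))\<^sup>2))" for b
  proof -
    have "cmod (\<Sum>k<d. b k * cis (f k * (real j / real d))) = cmod (\<Sum>k<d. b k * cis (2 * pi * real j / real d) ^ k)" for j
    proof -
      have "cis (f k * (real j / real d)) = cis (- (pi * (real d - 1) * (real j / real d))) * cis (2 * pi * real j / real d) ^ k" for k
        using phase[of k "real j / real d"] by simp
      hence "(\<Sum>k<d. b k * cis (f k * (real j / real d))) =
          cis (- (pi * (real d - 1) * (real j / real d))) * (\<Sum>k<d. b k * cis (2 * pi * real j / real d) ^ k)"
        by (simp add: sum_distrib_left mult_ac)
      thus ?thesis by (simp only: norm_mult norm_cis mult_1)
    qed
    thus ?thesis unfolding L2_set_def by (simp only: discrete_parseval)
  qed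
  have v0: "L2_set (\<lambda>j. cmod (v 0 j)) {..<d} = sqrt (real d * S)"
    using norm_sum[of "coeff p"] by (simp add: v_def S_def)
  have vn: "L2_set (\<lambda>j. cmod (v n j)) {..<d} \<le> ((pi * L) ^ n /\<^sub>R fact n) * sqrt (real d * S)" for n
  proof -
    let ?u = "\<lambda>j. \<Sum>k<d. (coeff p k * (\<i> * of_real (f k)) ^ n) * cis (f k * (real j / real d))"
    have "L2_set (\<lambda>j. cmod (v n j)) {..<d} \<le> L2_set (\<lambda>j. ((L / real d) ^ n / fact n) * cmod (?u j)) {..<d}"
    proof (rule L2_set_mono)
      fix j assume "j \<in> {..<d}"
      hence "\<bar>\<mu> j\<bar> ^ n \<le> (L / real d) ^ n" using \<theta>[of j] by (intro power_mono) (auto simp: \<mu>_def)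
      hence "\<bar>\<mu> j\<bar> ^ n / fact n \<le> (L / real d) ^ n / fact n" by (rule divide_right_mono) simp
      from mult_left_mono[OF this norm_ge_zero[of "?u j"]]
      show "cmod (v n j) \<le> (L / real d) ^ n / fact n * cmod (?u j)"
        by (simp add: v_def norm_mult norm_power divide_inverse mult_ac)
    qed simp
    also have "\<dots> = ((L / real d) ^ n / fact n) * L2_set (\<lambda>j. cmod (?u j)) {..<d}"
      using L by (intro L2_set_right_distrib[symmetric]) simp
    finally have le: "L2_set (\<lambda>j. cmod (v n j)) {..<d} \<le> (L / real d) ^ n / fact n * L2_set (\<lambda>j. cmod (?u j)) {..<d}" .
    have "L2_set (\<lambda>j. cmod (?u j)) {..<d} = sqrt (real d * (\<Sum>k<d. (cmod (coeff p k * (\<i> * of_real (f k)) ^ n))\<^sup>2))"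
      by (rule norm_sum)
    also have "\<dots> \<le> sqrt (real d * (\<Sum>k<d. ((pi * real d) ^ n)\<^sup>2 * (cmod (coeff p k))\<^sup>2))"
    proof (intro real_sqrt_le_mono mult_left_mono sum_mono)
      fix k assume "k \<in> {..<d}"
      hence "\<bar>f k\<bar> ^ n \<le> (pi * real d) ^ n" using f[of k] by (intro power_mono) auto
      hence "(\<bar>f k\<bar> ^ n)\<^sup>2 \<le> ((pi * real d) ^ n)\<^sup>2" by (rule power_mono) simp
      from mult_right_mono[OF this, of "(cmod (coeff p k))\<^sup>2"]
      show "(cmod (coeff p k * (\<i> * of_real (f k)) ^ n))\<^sup>2 \<le> ((pi * real d) ^ n)\<^sup>2 * (cmod (coeff p k))\<^sup>2"
        by (simp add: norm_mult norm_power power_mult_distrib mult_ac)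
    qed simp
    also have "\<dots> = (pi * real d) ^ n * sqrt (real d * S)"
      by (simp add: sum_distrib_left[symmetric] S_def[symmetric] real_sqrt_mult)
    finally have u: "L2_set (\<lambda>j. cmod (?u j)) {..<d} \<le> (pi * real d) ^ n * sqrt (real d * S)" .
    note le
    also have "(L / real d) ^ n / fact n * L2_set (\<lambda>j. cmod (?u j)) {..<d} \<le>
        (L / real d) ^ n / fact n * ((pi * real d) ^ n * sqrt (real d * S))"
      using L by (intro mult_left_mono u) simp
    also have "\<dots> = ((pi * L) ^ n /\<^sub>R fact n) * sqrt (real d * S)"
    proof -
      have "(L / real d) ^ n * (pi * real d) ^ n = (pi * L) ^ n"
        unfolding power_mult_distrib[symmetric] using d by (simp add: mult.commute)
      thus ?thesis by (simp add: divide_inverse)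
    qed
    finally show ?thesis .
  qed
  have sums_exp: "(\<lambda>n. (pi * L) ^ n /\<^sub>R fact n) sums exp (pi * L)" by (rule exp_converges)
  have part: "sqrt (real d * S) - (exp (pi * L) - 1) * sqrt (real d * S) \<le> L2_set (\<lambda>j. cmod (\<Sum>n<Suc T. v n j)) {..<d}" for T
  proof -
    let ?W = "\<lambda>j. \<Sum>n\<in>{1..<Suc T}. v n j"
    have split: "(\<Sum>n<Suc T. v n j) = v 0 j + ?W j" for j
      by (simp only: lessThan_atLeast0 sum.atLeast_Suc_lessThan[of 0 "Suc T"] zero_less_Suc One_nat_def)
    have "L2_set (\<lambda>j. cmod (v 0 j)) {..<d} \<le> L2_set (\<lambda>j. cmod (\<Sum>n<Suc T. v n j) + cmod (?W j)) {..<d}"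
    proof (rule L2_set_mono)
      show "cmod (v 0 j) \<le> cmod (\<Sum>n<Suc T. v n j) + cmod (?W j)" for j
        unfolding split using norm_triangle_ineq4[of "v 0 j + ?W j" "?W j"] by simp
    qed simp
    also have "\<dots> \<le> L2_set (\<lambda>j. cmod (\<Sum>n<Suc T. v n j)) {..<d} + L2_set (\<lambda>j. cmod (?W j)) {..<d}"
      by (rule L2_set_triangle_ineq)
    also have "L2_set (\<lambda>j. cmod (?W j)) {..<d} \<le> (\<Sum>n\<in>{1..<Suc T}. L2_set (\<lambda>j. cmod (v n j)) {..<d})"
      by (rule L2_set_norm_sum_le) simp
    also have "\<dots> \<le> (\<Sum>n\<in>{1..<Suc T}. ((pi * L) ^ n /\<^sub>R fact n) * sqrt (real d * S))"
      by (intro sum_mono vn)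
    also have "\<dots> = (\<Sum>n\<in>{1..<Suc T}. (pi * L) ^ n /\<^sub>R fact n) * sqrt (real d * S)"
      by (rule sum_distrib_right[symmetric])
    also have "(\<Sum>n\<in>{1..<Suc T}. (pi * L) ^ n /\<^sub>R fact n) \<le> exp (pi * L) - 1"
    proof -
      have "(\<Sum>n<Suc T. (pi * L) ^ n /\<^sub>R fact n) \<le> exp (pi * L)"
        unfolding sums_unique[OF sums_exp] using L
        by (intro sum_le_suminf sums_summable[OF sums_exp]) auto
      moreover have "(\<Sum>n<Suc T. (pi * L) ^ n /\<^sub>R fact n) = 1 + (\<Sum>n\<in>{1..<Suc T}. (pi * L) ^ n /\<^sub>R fact n)"
        by (simp only: lessThan_atLeast0 sum.atLeast_Suc_lessThan[of 0 "Suc T"] zero_less_Suc One_nat_def) simp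
      ultimately show ?thesis by linarith
    qed
    finally show ?thesis unfolding v0 using S0 by (simp add: mult_right_mono)
  qed
  have lim: "(\<lambda>T. L2_set (\<lambda>j. cmod (\<Sum>n<Suc T. v n j)) {..<d}) \<longlonglongrightarrow> L2_set (\<lambda>j. cmod (F (\<theta> j))) {..<d}"
    unfolding L2_set_def
    by (intro tendsto_intros LIMSEQ_Suc v_sums[unfolded sums_def])
  have "sqrt (real d * S) - (exp (pi * L) - 1) * sqrt (real d * S) \<le> L2_set (\<lambda>j. cmod (F (\<theta> j))) {..<d}"
    by (rule LIMSEQ_le_const[OF lim]) (use part in blast)
  hence "(2 - exp (pi * L)) * sqrt (real d * S) \<le> L2_set (\<lambda>j. cmod (F (\<theta> j))) {..<d}"
    by (simp add: algebra_simps)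
  hence "((2 - exp (pi * L)) * sqrt (real d * S))\<^sup>2 \<le> (L2_set (\<lambda>j. cmod (F (\<theta> j))) {..<d})\<^sup>2"
    by (rule power_mono) (use eL S0 in \<open>simp add: mult_nonneg_nonneg\<close>)
  also have "\<dots> = (\<Sum>j<d. (cmod (poly p (cis (2 * pi * \<theta> j))))\<^sup>2)"
    by (simp add: L2_set_def F sum_nonneg)
  finally have "(2 - exp (pi * L))\<^sup>2 * (real d * S) \<le> (\<Sum>j<d. (cmod (poly p (cis (2 * pi * \<theta> j))))\<^sup>2)"
    using S0 by (simp add: power_mult_distrib)
  thus ?thesis unfolding parseval_poly[OF deg] S_def[symmetric] using d by (simp add: field_simps)
qed

section \<open>The choice of the depth\<close>

lemma exp_ge_fourth_power:
  assumes "(y::real) \<ge> 0"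
  shows "(y / 4) ^ 4 \<le> exp y"
proof -
  have "(y / 4) ^ 4 \<le> exp (y / 4) ^ 4"
  proof (rule power_mono)
    show "y / 4 \<le> exp (y / 4)" using exp_ge_add_one_self[of "y / 4"] by linarith
  qed (use assms in simp)
  also have "\<dots> = exp y" by (simp flip: exp_of_nat_mult)
  finally show ?thesis .
qed

lemma exp_minus_one_le:
  assumes "0 \<le> (x::real)" "x \<le> 7/20"
  shows "exp x - 1 \<le> 27/20 * x"
proof -
  have "exp x \<le> 1 + x + x\<^sup>2" using assms by (intro exp_bound) auto
  moreover have "x * x \<le> x * (7/20)" using assms by (intro mult_left_mono) auto
  ultimately show ?thesis by (simp add: power2_eq_square)
qed

text \<open>
  The depth \<open>h\<close> of the nodes below the circle, in units of the spacing, is proportional to \<open>L\<^sup>2 n / g\<^sup>2\<close>,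
  where \<open>g = 1 - 4 \<rho>\<close> and \<open>n\<close> is the block length. The factor 160 makes it large enough for the phase
  errors to stay below \<open>g\<close> times a small constant, and it keeps \<open>6 \<pi> h / \<delta>\<close>, the exponent of the claim,
  above the exponent \<open>4 \<pi> h / \<delta>\<close> lost in the separation estimate.
\<close>

context
  fixes g L n h :: real
  assumes g: "0 < g" "g \<le> 1" and L: "1 / 7 \<le> L" and n: "1 \<le> n"
    and h: "h = 160 * L\<^sup>2 * n / g\<^sup>2"
begin

lemma h_lower: "16 / g\<^sup>2 \<le> 2 * pi * h"
proof -
  have "(1/7)\<^sup>2 \<le> L\<^sup>2" using L by (intro power_mono) auto
  hence "(1/7)\<^sup>2 * 1 \<le> L\<^sup>2 * n" using n by (intro mult_mono) auto
  hence "160 / 49 \<le> 160 * L\<^sup>2 * n" by (simp add: power2_eq_square)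
  hence "160 / 49 / g\<^sup>2 \<le> h" unfolding h by (intro divide_right_mono) auto
  moreover have "0 \<le> 160 / 49 / g\<^sup>2" by simp
  ultimately have "2 * 3 * (160 / 49 / g\<^sup>2) \<le> 2 * pi * h" using pi_gt3 by (intro mult_mono) auto
  moreover have "16 / g\<^sup>2 \<le> 2 * 3 * (160 / 49 / g\<^sup>2)" 
  proof -
    have "16 / g\<^sup>2 \<le> (960 / 49) / g\<^sup>2" by (intro divide_right_mono) auto
    thus ?thesis by simp
  qed
  ultimately show ?thesis by linarith
qed

lemma h_pos: "0 < h"
  unfolding h using g L n by (intro divide_pos_pos mult_pos_pos) auto

lemma q_small: "exp (- (2 * pi * h)) \<le> g / 256"
proof -
  have g2: "1 \<le> 1 / g\<^sup>2" using g by (simp add: power_le_one)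
  have "256 / g \<le> (4 / g\<^sup>2) ^ 4"
  proof -
    have "g ^ 8 \<le> g ^ 1" using g by (intro power_decreasing) auto
    hence "256 / g \<le> 256 / g ^ 8" using g by (intro divide_left_mono) auto
    thus ?thesis by (simp add: power_divide flip: power_mult)
  qed
  also have "\<dots> = (16 / g\<^sup>2 / 4) ^ 4" by simp
  also have "\<dots> \<le> exp (16 / g\<^sup>2)" by (rule exp_ge_fourth_power) simp
  also have "\<dots> \<le> exp (2 * pi * h)" using h_lower by simp
  finally have "256 / g \<le> exp (2 * pi * h)" .
  hence "inverse (exp (2 * pi * h)) \<le> inverse (256 / g)" using g by (intro le_imp_inverse_le) auto
  thus ?thesis by (simp add: exp_minus)
qed

lemma ratio_small:
  "2 * exp (- (2 * pi * h)) / (1 - exp (- (2 * pi * h))) \<le> g / 100"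
  "(1 + exp (- (2 * pi * h))) / (1 - exp (- (2 * pi * h))) \<le> 1 + g / 100"
  "1 \<le> (1 + exp (- (2 * pi * h))) / (1 - exp (- (2 * pi * h)))"
proof -
  let ?q = "exp (- (2 * pi * h))"
  have q: "?q \<le> g / 256" "0 < ?q" using q_small by auto
  have q1: "?q \<le> 1 / 256" using q g by simp
  have "2 * ?q / (1 - ?q) \<le> 2 * (g / 256) / (1 - 1 / 256)"
    using q q1 g by (intro frac_le) auto
  also have "\<dots> \<le> g / 100" using g by simp
  finally show *: "2 * ?q / (1 - ?q) \<le> g / 100" .
  have pos: "0 \<le> 2 * ?q / (1 - ?q)"
  proof (rule divide_nonneg_nonneg)
    show "0 \<le> 1 - ?q" using q1 by linarith
  qed simp
  have "(1 + ?q) / (1 - ?q) = 1 + 2 * ?q / (1 - ?q)" 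
  proof -
    have "(1 + x) / (1 - x) = 1 + 2 * x / (1 - x)" if "x < 1" for x :: real
      using that by (simp add: field_simps)
    moreover have "?q < 1" using q1 by linarith
    ultimately show ?thesis by blast
  qed
  thus "(1 + ?q) / (1 - ?q) \<le> 1 + g / 100" "1 \<le> (1 + ?q) / (1 - ?q)"
    using * pos by auto
qed

lemma block_error_small: "L * (exp ((n + L) / h) - 1) \<le> 27/400 * g"
proof -
  have L0: "L > 0" using L by linarith
  have e1: "(n + L) / h = g\<^sup>2 / 160 * (1 / L\<^sup>2 + 1 / (L * n))"
    unfolding h using L0 n g by (simp add: field_simps power2_eq_square)
  have i1: "1 / L \<le> 7" using L L0 by (simp add: field_simps)
  have i2: "1 / n \<le> 1" using n by simp
  have i3: "1 / L * (1 / L) \<le> 7 * 7" using i1 L0 by (intro mult_mono) auto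
  have i4: "1 / L * (1 / n) \<le> 7 * 1" using i1 i2 L0 n by (intro mult_mono) auto
  have gg: "g\<^sup>2 \<le> g" using g by (simp add: power2_eq_square mult_left_le)
  have "1 / L\<^sup>2 + 1 / (L * n) \<le> 56" using i3 i4 by (simp add: power2_eq_square)
  hence "g\<^sup>2 / 160 * (1 / L\<^sup>2 + 1 / (L * n)) \<le> 1 / 160 * 56"
    using g gg L0 n by (intro mult_mono) auto
  hence x: "(n + L) / h \<le> 7/20" unfolding e1 by simp
  have x0: "0 \<le> (n + L) / h" using h_pos n L0 by simp
  have "L * (exp ((n + L) / h) - 1) \<le> L * (27/20 * ((n + L) / h))"
    using exp_minus_one_le[OF x0 x] L0 by (intro mult_left_mono) auto
  also have "\<dots> = 27/20 * (g\<^sup>2 / 160 * (1 / L + 1 / n))"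
    unfolding e1 using L0 n by (simp add: field_simps power2_eq_square)
  also have "\<dots> \<le> 27/20 * (g / 160 * 8)"
  proof -
    have "1 / L + 1 / n \<le> 8" using i1 i2 by linarith
    thus ?thesis using gg g L0 n by (intro mult_left_mono mult_mono) auto
  qed
  finally show ?thesis by simp
qed

text \<open>
  The bound \<open>b\<close> leaves the angle \<open>\<pi> g / 4\<close> to \<open>\<pi> / 2\<close>, and a further \<open>g / 4\<close> that compensates for the
  distance between \<open>z\<^sup>d\<close> and the Blaschke product of the equidistant zeros.
\<close>

lemma phase_bound:
  defines "b \<equiv> pi / 2 - (pi / 4 + 1 / 4) * g"
  assumes \<rho>: "0 \<le> \<rho>" "4 * \<rho> = 1 - g"
  shows "2 * pi * (\<rho> + L * (exp ((n + L) / h) - 1)) *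
      ((1 + exp (- (2 * pi * h))) / (1 - exp (- (2 * pi * h)))) \<le> b"
    and "b \<le> pi"
    and "sin (pi / 4 * g) + 2 * exp (- (2 * pi * h)) / (1 - exp (- (2 * pi * h))) \<le> cos b"
proof -
  let ?R = "(1 + exp (- (2 * pi * h))) / (1 - exp (- (2 * pi * h)))"
  have L0: "L > 0" using L by linarith
  have a0: "0 \<le> \<rho> + L * (exp ((n + L) / h) - 1)" using \<rho> L0 n h_pos by simp
  have a: "\<rho> + L * (exp ((n + L) / h) - 1) \<le> 1/4 - 73/400 * g"
    using block_error_small \<rho> by simp
  have "(\<rho> + L * (exp ((n + L) / h) - 1)) * ?R \<le> (1/4 - 73/400 * g) * (1 + g / 100)"
    using a a0 ratio_small g by (intro mult_mono) auto
  also have "\<dots> \<le> 1/4 - 7/40 * g"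
    using g by (simp add: algebra_simps)
  finally have "2 * pi * ((\<rho> + L * (exp ((n + L) / h) - 1)) * ?R) \<le> 2 * pi * (1/4 - 7/40 * g)"
    by (intro mult_left_mono) auto
  also have "\<dots> \<le> b"
  proof -
    have "3 * g \<le> pi * g" using pi_gt3 g by (intro mult_right_mono) auto
    hence "5 * g \<le> 2 * (pi * g)" using g by linarith
    thus ?thesis by (simp add: b_def algebra_simps)
  qed
  finally show "2 * pi * (\<rho> + L * (exp ((n + L) / h) - 1)) * ?R \<le> b" by (simp only: mult.assoc)
  show "b \<le> pi"
  proof -
    have "0 \<le> (pi / 4 + 1 / 4) * g" using g pi_gt_zero by (intro mult_nonneg_nonneg) auto
    thus ?thesis unfolding b_def using pi_gt_zero by linarith
  qed
  have lt: "pi / 4 * g < (pi / 4 + 1 / 4) * g" using g by (intro mult_strict_right_mono) auto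
  obtain z where z: "pi / 4 * g < z" "z < (pi / 4 + 1 / 4) * g"
    "sin ((pi / 4 + 1 / 4) * g) - sin (pi / 4 * g) = ((pi / 4 + 1 / 4) * g - pi / 4 * g) * cos z"
    using MVT2[OF lt DERIV_sin] by blast
  have "cos (pi / 3) \<le> cos z"
  proof (rule cos_monotone_0_pi_le)
    show "0 \<le> z" using z(1) g pi_gt_zero mult_pos_pos[of "pi / 4" g] by linarith
    have "(pi / 4 + 1 / 4) * g \<le> (pi / 4 + 1 / 4) * 1" using g pi_gt_zero by (intro mult_left_mono) auto
    hence "z \<le> (pi / 4 + 1 / 4) * 1" using z(2) by (meson less_imp_le order_trans)
    thus "z \<le> pi / 3" using pi_gt3 by simp
  qed (use pi_gt_zero in auto)
  hence cz: "1 / 2 \<le> cos z" by (simp add: cos_60)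
  have "g / 4 * (1 / 2) \<le> g / 4 * cos z" using cz g by (intro mult_left_mono) auto
  moreover have "(pi / 4 + 1 / 4) * g - pi / 4 * g = g / 4" by (simp add: algebra_simps)
  hence "sin ((pi / 4 + 1 / 4) * g) - sin (pi / 4 * g) = g / 4 * cos z" using z(3) by (simp only:)
  ultimately have "sin (pi / 4 * g) + g / 8 \<le> sin ((pi / 4 + 1 / 4) * g)" by linarith
  moreover have "cos b = sin ((pi / 4 + 1 / 4) * g)" unfolding b_def by (simp add: cos_diff)
  ultimately show "sin (pi / 4 * g) + 2 * exp (- (2 * pi * h)) / (1 - exp (- (2 * pi * h))) \<le> cos b"
    using ratio_small(1) g by linarith
qed

text \<open>
  The factors other than \<open>exp (4 \<pi> h / \<delta>)\<close> grow at most quadratically in \<open>h\<close> and are absorbed by the spare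
  \<open>exp (2 \<pi> h / \<delta>)\<close>, because \<open>2 \<pi> h\<close> is at least 16.
\<close>

lemma constant_bound:
  assumes \<delta>: "0 < \<delta>" "\<delta> \<le> 1"
  shows "exp (L / h) * ((1 + exp (- (2 * pi * h))) / (1 - exp (- (2 * pi * h)))) * (4 * pi * h)\<^sup>2 * exp (4 * pi * h / \<delta>)
    \<le> 7 * \<delta> * exp (960 * pi * L\<^sup>2 * n / (\<delta> * g\<^sup>2))"
proof -
  let ?R = "(1 + exp (- (2 * pi * h))) / (1 - exp (- (2 * pi * h)))"
  have L0: "L > 0" using L by linarith
  define y where "y = 2 * pi * h / \<delta>"
  have "16 \<le> 16 / g\<^sup>2" using g by (simp add: pos_le_divide_eq power_le_one)
  hence h16: "16 \<le> 2 * pi * h" using h_lower by linarith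
  have "2 * pi * h / 1 \<le> y" unfolding y_def using h16 \<delta> by (intro divide_left_mono) auto
  hence y: "16 \<le> y" using h16 by simp
  have "L / h = g\<^sup>2 / (160 * L * n)" unfolding h using L0 n g by (simp add: field_simps power2_eq_square)
  also have "\<dots> \<le> 1 / (160 * (1 / 7) * 1)"
    using L n g by (intro frac_le mult_mono) (auto simp: power_le_one)
  finally have Lh: "L / h \<le> 7/160" by simp
  have "exp (L / h) - 1 \<le> 27/20 * (L / h)" 
  proof (rule exp_minus_one_le)
    show "0 \<le> L / h" using h_pos L0 by simp
    show "L / h \<le> 7 / 20" using Lh by linarith
  qed
  hence "exp (L / h) \<le> 11/10" using Lh by linarith
  moreover have "?R \<le> 11/10" using ratio_small(2) g by linarith
  ultimately have "exp (L / h) * ?R \<le> 11/10 * (11/10)" using ratio_small(3) by (intro mult_mono) auto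
  hence "exp (L / h) * ?R \<le> 7/4" by linarith
  hence "exp (L / h) * ?R * (4 * pi * h)\<^sup>2 \<le> 7/4 * (4 * pi * h)\<^sup>2"
    by (rule mult_right_mono) simp
  also have "7/4 * (4 * pi * h)\<^sup>2 = 7/4 * (2 * (\<delta> * y))\<^sup>2"
  proof -
    have "4 * pi * h = 2 * (\<delta> * y)" using \<delta> by (simp add: y_def)
    thus ?thesis by (simp only:)
  qed
  also have "7/4 * (2 * (\<delta> * y))\<^sup>2 = 7 * \<delta> * (\<delta> * y\<^sup>2)" by (simp add: power2_eq_square)
  also have "\<dots> \<le> 7 * \<delta> * (1 * exp y)"
  proof (intro mult_left_mono mult_mono)
    have "16\<^sup>2 \<le> y\<^sup>2" using y by (intro power_mono) auto
    hence "256 * y\<^sup>2 \<le> y\<^sup>2 * y\<^sup>2" by (intro mult_right_mono) auto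
    hence "y\<^sup>2 \<le> (y / 4) ^ 4" by (simp add: power_divide eval_nat_numeral)
    also have "\<dots> \<le> exp y" using y by (intro exp_ge_fourth_power) auto
    finally show "y\<^sup>2 \<le> exp y" .
  qed (use \<delta> in auto)
  finally have "exp (L / h) * ?R * (4 * pi * h)\<^sup>2 \<le> 7 * \<delta> * exp y" by (simp only: mult_1)
  hence "exp (L / h) * ?R * (4 * pi * h)\<^sup>2 * exp (4 * pi * h / \<delta>) \<le> 7 * \<delta> * exp y * exp (4 * pi * h / \<delta>)"
    by (rule mult_right_mono) simp
  also have "\<dots> = 7 * \<delta> * exp (y + 4 * pi * h / \<delta>)" by (simp add: exp_add)
  also have "y + 4 * pi * h / \<delta> = 960 * pi * L\<^sup>2 * n / (\<delta> * g\<^sup>2)"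
    using \<delta> g by (simp add: y_def h field_simps)
  finally show ?thesis .
qed

end

text \<open>
  Both sides compare with \<open>1/10\<close>: nodes with small deviations are well separated, and the factor
  \<open>1 / (7 \<delta>)\<close> is then at most \<open>1/5\<close>.
\<close>

lemma small_case_constant:
  assumes L: "0 \<le> L" "L < 1 / 7" and \<delta>: "1 - 2 * L \<le> \<delta>" and g: "0 \<le> g" "g \<le> 1" and c: "0 \<le> c"
  shows "1 / (7 * \<delta>) * exp (- c) * (sin (pi / 4 * g))\<^sup>2 \<le> (2 - exp (pi * L))\<^sup>2" "exp (pi * L) \<le> 2"
proof -
  have "pi * L \<le> 16/5 * (1/7)" using L pi_approx by (intro mult_mono) auto
  hence x: "pi * L \<le> 23/50" by simp
  have x0: "0 \<le> pi * L" using L by simp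
  have "exp (pi * L) \<le> 1 + pi * L + (pi * L)\<^sup>2" using x x0 by (intro exp_bound) auto
  moreover have "(pi * L)\<^sup>2 \<le> (23/50)\<^sup>2" using x x0 by (intro power_mono) auto
  ultimately have e: "exp (pi * L) \<le> 42/25" using x by (simp add: power2_eq_square)
  thus "exp (pi * L) \<le> 2" by simp
  have a: "0 \<le> pi / 4 * g" "pi / 4 * g \<le> pi / 4 * 1"
    using g by (auto intro!: mult_left_mono)
  have "sin (pi / 4 * g) \<le> sin (pi / 4)"
  proof (rule sin_monotone_2pi_le)
    show "- (pi / 2) \<le> pi / 4 * g" using a(1) pi_gt_zero by linarith
    show "pi / 4 * g \<le> pi / 4" using a(2) by simp
  qed (use pi_gt_zero in simp)
  moreover have "0 \<le> sin (pi / 4 * g)"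
  proof (rule sin_ge_zero)
    show "pi / 4 * g \<le> pi" using a(2) pi_gt_zero by linarith
  qed (use g in auto)
  ultimately have "(sin (pi / 4 * g))\<^sup>2 \<le> (sin (pi / 4))\<^sup>2" by (intro power_mono) auto
  hence s: "(sin (pi / 4 * g))\<^sup>2 \<le> 1 / 2" by (simp add: sin_45 power_divide)
  have "1 / (7 * \<delta>) \<le> 1 / 5" using L \<delta> by (intro divide_left_mono) auto
  moreover have "0 \<le> 1 / (7 * \<delta>)" using L \<delta> by simp
  ultimately have "1 / (7 * \<delta>) * exp (- c) * (sin (pi / 4 * g))\<^sup>2 \<le> 1 / 5 * 1 * (1 / 2)"
    using s c by (intro mult_mono) auto
  also have "\<dots> \<le> (8/25)\<^sup>2" by (simp add: power2_eq_square)
  also have "\<dots> \<le> (2 - exp (pi * L))\<^sup>2" using e by (intro power_mono) auto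
  finally show "1 / (7 * \<delta>) * exp (- c) * (sin (pi / 4 * g))\<^sup>2 \<le> (2 - exp (pi * L))\<^sup>2" .
qed

section \<open>Separation constant, mean deviations and the lower bound\<close>

text \<open>
  The separation condition is closed in \<open>\<delta>\<close>, and two points are never further apart than \<open>1/2\<close>
  modulo 1. Hence the supremum is attained and at most 1.
\<close>

lemma separated_by_separation_constant:
  assumes "minimal_family \<Theta>" "uniformly_discrete \<Theta>"
  shows "separated_by \<Theta> (separation_constant \<Theta>)" "0 < separation_constant \<Theta>" "separation_constant \<Theta> \<le> 1"
    and "\<And>\<delta>. \<delta> > 0 \<Longrightarrow> separated_by \<Theta> \<delta> \<Longrightarrow> \<delta> \<le> separation_constant \<Theta>"
proof -
  let ?D = "{\<delta>. \<delta> > 0 \<and> separated_by \<Theta> \<delta>}"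
  have ne: "?D \<noteq> {}" using assms(2) by (auto simp: uniformly_discrete_def)
  have le1: "\<delta> \<le> 1" if "\<delta> \<in> ?D" for \<delta>
  proof -
    have "card (\<Theta> 2) = 2" using assms(1) by (simp add: minimal_family_def)
    then obtain x y where xy: "x \<in> \<Theta> 2" "y \<in> \<Theta> 2" "x \<noteq> y" by (auto simp: card_2_iff)
    from that have "separated_by \<Theta> \<delta>" by simp
    from this[unfolded separated_by_def, rule_format, OF _ xy]
    have "\<delta> / 2 \<le> infdist (x - y) \<int>" by simp
    also have "\<dots> \<le> \<bar>x - y - of_int (round (x - y))\<bar>" by (rule infdist_Ints_le)
    also have "\<dots> \<le> 1 / 2" using of_int_round_abs_le[of "x - y"] by linarith
    finally show ?thesis by simp
  qed
  hence bdd: "bdd_above ?D" by (rule bdd_aboveI)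
  show upper: "\<And>\<delta>. \<delta> > 0 \<Longrightarrow> separated_by \<Theta> \<delta> \<Longrightarrow> \<delta> \<le> separation_constant \<Theta>"
    unfolding separation_constant_def by (rule cSup_upper[OF _ bdd]) simp
  show "0 < separation_constant \<Theta>"
  proof -
    obtain \<delta> where "\<delta> > 0" "separated_by \<Theta> \<delta>" using ne by blast
    thus ?thesis using upper[of \<delta>] by linarith
  qed
  show "separation_constant \<Theta> \<le> 1"
    unfolding separation_constant_def using ne le1 by (rule cSup_least)
  show "separated_by \<Theta> (separation_constant \<Theta>)"
    unfolding separated_by_def
  proof (intro allI ballI impI)
    fix d :: nat and x y assume h: "1 \<le> d" "x \<in> \<Theta> d" "y \<in> \<Theta> d" "x \<noteq> y"
    have "separation_constant \<Theta> \<le> infdist (x - y) \<int> * real d"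
      unfolding separation_constant_def
    proof (rule cSup_least[OF ne])
      fix \<delta> assume "\<delta> \<in> ?D"
      hence "\<delta> / real d \<le> infdist (x - y) \<int>" using h by (auto simp: separated_by_def)
      thus "\<delta> \<le> infdist (x - y) \<int> * real d" using h(1) by (simp add: pos_divide_le_eq)
    qed
    thus "separation_constant \<Theta> / real d \<le> infdist (x - y) \<int>" using h(1) by (simp add: pos_divide_le_eq)
  qed
qed

lemma max_mean_deviation_bounds:
  assumes dev: "\<And>d j. d \<ge> 1 \<Longrightarrow> j < d \<Longrightarrow> \<bar>deviation \<theta> d j\<bar> \<le> L / real d" and N: "N \<ge> 1"
  shows "0 \<le> max_mean_deviation \<theta> N"
    and "d \<ge> 1 \<Longrightarrow> m < d \<Longrightarrow>
      \<bar>\<Sum>j = m * N..<(m + 1) * N. deviation \<theta> d (j mod d)\<bar> \<le> max_mean_deviation \<theta> N * real N / real d"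
proof -
  let ?f = "\<lambda>d m. \<bar>real d / real N * (\<Sum>j = m * N..<(m + 1) * N. deviation \<theta> d (j mod d))\<bar>"
  let ?S = "{?f d m | d m. 1 \<le> d \<and> m < d}"
  have "?f d m \<le> L" if dm: "1 \<le> d" "m < d" for d m
  proof -
    have "\<bar>\<Sum>j = m * N..<(m + 1) * N. deviation \<theta> d (j mod d)\<bar> \<le> (\<Sum>j = m * N..<(m + 1) * N. L / real d)"
      using dm by (intro order_trans[OF sum_abs sum_mono] dev) auto
    hence "real d / real N * \<bar>\<Sum>j = m * N..<(m + 1) * N. deviation \<theta> d (j mod d)\<bar> \<le> real d / real N * (real N * (L / real d))"
      by (intro mult_left_mono) auto
    thus ?thesis using dm N by (simp add: abs_mult)
  qed
  hence bdd: "bdd_above ?S" by (auto intro!: bdd_aboveI)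
  have up: "?f d m \<le> max_mean_deviation \<theta> N" if "1 \<le> d" "m < d" for d m
    unfolding max_mean_deviation_def using that by (intro cSup_upper[OF _ bdd]) blast
  show "0 \<le> max_mean_deviation \<theta> N" using up[of 1 0] by (rule order_trans[rotated]) auto
  show "\<bar>\<Sum>j = m * N..<(m + 1) * N. deviation \<theta> d (j mod d)\<bar> \<le> max_mean_deviation \<theta> N * real N / real d"
    if "d \<ge> 1" "m < d"
    using up[OF that] that N by (simp add: abs_mult field_simps)
qed

lemma separated_by_small_deviation:
  assumes \<Theta>: "\<And>d. d \<ge> 1 \<Longrightarrow> \<Theta> d = \<theta> d ` {..<d}"
    and dev: "\<And>d j. d \<ge> 1 \<Longrightarrow> j < d \<Longrightarrow> \<bar>deviation \<theta> d j\<bar> \<le> L / real d"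
  shows "separated_by \<Theta> (1 - 2 * L)"
  unfolding separated_by_def
proof (intro allI ballI impI)
  fix d :: nat and x y assume h: "1 \<le> d" "x \<in> \<Theta> d" "y \<in> \<Theta> d" "x \<noteq> y"
  then obtain i j where ij: "i < d" "j < d" "x = \<theta> d i" "y = \<theta> d j" "i \<noteq> j" using \<Theta>[OF h(1)] by auto
  have "(1 - 2 * L) / real d \<le> \<bar>x - y - of_int n\<bar>" for n
  proof -
    define k where "k = int i - int j - n * int d"
    have "k \<noteq> 0"
    proof
      assume "k = 0"
      hence "int i - int j = n * int d" by (simp add: k_def)
      moreover have "\<bar>int i - int j\<bar> < int d" using ij by auto
      ultimately have "\<bar>n\<bar> * int d < 1 * int d" by (simp add: abs_mult)
      hence "n = 0" by (simp only: mult_less_cancel_right) auto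
      thus False using \<open>int i - int j = n * int d\<close> ij(5) by simp
    qed
    hence k: "1 \<le> \<bar>real_of_int k\<bar>" by linarith
    have "x - y - of_int n = real_of_int k / real d + (deviation \<theta> d i - deviation \<theta> d j)"
      using h(1) unfolding ij deviation_def k_def by (simp add: field_simps)
    hence "\<bar>x - y - of_int n\<bar> \<ge> \<bar>real_of_int k / real d\<bar> - \<bar>deviation \<theta> d i\<bar> - \<bar>deviation \<theta> d j\<bar>" by linarith
    moreover have "1 / real d \<le> \<bar>real_of_int k / real d\<bar>" using k by (simp add: divide_right_mono)
    ultimately have "1 / real d - L / real d - L / real d \<le> \<bar>x - y - of_int n\<bar>"
      using dev[OF h(1) ij(1)] dev[OF h(1) ij(2)] by linarith
    thus ?thesis by (simp add: diff_divide_distrib)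
  qed
  moreover have "\<int> \<noteq> ({} :: real set)" by auto
  ultimately show "(1 - 2 * L) / real d \<le> infdist (x - y) \<int>"
    unfolding infdist_notempty[OF \<open>\<int> \<noteq> {}\<close>]
    by (intro cINF_greatest) (auto simp: dist_real_def elim!: Ints_cases)
qed

text \<open>
  The constant polynomial at level 1 bounds all admissible constants by 1, so the supremum that
  defines the lower bound dominates each of them.
\<close>

lemma le_lower_MZ_bound:
  assumes "minimal_family \<Theta>" "A > 0" "B > 0" "MZ_bounds \<Theta> A B"
  shows "A \<le> lower_MZ_bound \<Theta>"
  unfolding lower_MZ_bound_def
proof (rule cSup_upper)
  have "A' \<le> 1" if "MZ_bounds \<Theta> A' B'" for A' B'
  proof -
    have c: "card (\<Theta> 1) = 1" using assms(1) by (simp add: minimal_family_def)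
    have "(L2_norm_circle 1)\<^sup>2 = 1"
      unfolding L2_norm_circle_sq using parseval_poly[of 1 1] by simp
    thus ?thesis using that[unfolded MZ_bounds_def, rule_format, of 1 1] c by simp
  qed
  thus "bdd_above {A. 0 < A \<and> (\<exists>B>0. MZ_bounds \<Theta> A B)}" by (auto intro!: bdd_aboveI)
qed (use assms in auto)

theorem theorem4p20:
  fixes \<Theta> :: "nat \<Rightarrow> real set" and \<theta> :: "nat \<Rightarrow> nat \<Rightarrow> real"
    and L \<rho> :: real and N :: nat
  assumes "uniformly_discrete \<Theta>"
    and "\<And>d. d \<ge> 1 \<Longrightarrow> \<Theta> d = \<theta> d ` {..<d}"
    and "\<And>d. d \<ge> 1 \<Longrightarrow> card (\<Theta> d) = d"
    and "L > 0"
    and "\<And>d j. d \<ge> 1 \<Longrightarrow> j < d \<Longrightarrow> \<bar>deviation \<theta> d j\<bar> < L / real d"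
    and "N \<ge> 1"
    and "\<rho> = max_mean_deviation \<theta> N"
    and "\<rho> < 1 / 4"
  shows "minimal_MZ_family \<Theta> \<and>
    lower_MZ_bound \<Theta> \<ge>
      1 / (7 * separation_constant \<Theta>) *
      exp (- (960 * pi * L\<^sup>2 * real N / (separation_constant \<Theta> * (1 - 4 * \<rho>)\<^sup>2))) *
      (sin (pi / 4 * (1 - 4 * \<rho>)))\<^sup>2"
proof -
  define \<delta> where "\<delta> = separation_constant \<Theta>"
  define g where "g = 1 - 4 * \<rho>"
  define s where "s = sin (pi / 4 * g)"
  define T where "T = 1 / (7 * \<delta>) * exp (- (960 * pi * L\<^sup>2 * real N / (\<delta> * g\<^sup>2))) * s\<^sup>2"
  have dev: "\<bar>deviation \<theta> d j\<bar> \<le> L / real d" if "d \<ge> 1" "j < d" for d j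
    using assms(5)[OF that] by simp
  have minimal: "minimal_family \<Theta>"
    using assms(1,3) by (simp add: minimal_family_def uniformly_discrete_def)
  note sepc = separated_by_separation_constant[OF minimal assms(1), folded \<delta>_def]
  have \<rho>: "0 \<le> \<rho>" unfolding assms(7) by (rule max_mean_deviation_bounds(1)[OF dev assms(6)])
  have block: "\<bar>\<Sum>j = m * N..<(m + 1) * N. \<theta> d (j mod d) - real (j mod d) / real d\<bar> \<le> \<rho> * real N / real d"
    if "d \<ge> 1" "m < d" for d m
    using max_mean_deviation_bounds(2)[OF dev assms(6) that] unfolding assms(7) deviation_def .
  have g: "0 < g" "g \<le> 1" using \<rho> assms(8) by (auto simp: g_def)
  have s0: "0 < s"
  proof -
    have "pi / 4 * g \<le> pi / 4 * 1" using g by (intro mult_left_mono) auto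
    hence "pi / 4 * g < pi" using pi_gt_zero by linarith
    thus ?thesis unfolding s_def using g by (intro sin_gt_zero) auto
  qed
  have T0: "T > 0" unfolding T_def using s0 sepc(2) by simp
  have inj: "inj_on (\<theta> d) {..<d}" if "d \<ge> 1" for d
    using assms(2,3)[OF that] by (intro eq_card_imp_inj_on) auto
  have sum_nodes: "(\<Sum>t\<in>\<Theta> d. F t) = (\<Sum>j<d. F (\<theta> d j))" if "d \<ge> 1" for d and F :: "real \<Rightarrow> real"
    unfolding assms(2)[OF that] using inj[OF that] by (simp add: sum.reindex)
  have dev': "\<bar>\<theta> d j - real j / real d\<bar> \<le> L / real d" if "d \<ge> 1" "j < d" for d j
    using dev[OF that] by (simp add: deviation_def)
  have lower: "T * circle_mean (\<lambda>z. (cmod (poly p z))\<^sup>2) \<le>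
      1 / real d * (\<Sum>j<d. (cmod (poly p (cis (2 * pi * \<theta> d j))))\<^sup>2)"
    if d: "d \<ge> 1" and deg: "degree p < d" for d p
  \<comment> \<open>Below \<open>1/7\<close> the depth used in the other case would be too small for the phase errors.\<close>
  proof (cases "L < 1 / 7")
    case True
    have "1 - 2 * L \<le> \<delta>"
      using True by (intro sepc(4) separated_by_small_deviation[OF assms(2) dev]) auto
    note small = small_case_constant[OF less_imp_le[OF assms(4)] True this less_imp_le[OF g(1)] g(2)]
    have "T \<le> (2 - exp (pi * L))\<^sup>2"
      unfolding T_def s_def using assms(4) sepc(2) by (intro small(1)) simp
    hence "T * circle_mean (\<lambda>z. (cmod (poly p z))\<^sup>2) \<le> (2 - exp (pi * L))\<^sup>2 * circle_mean (\<lambda>z. (cmod (poly p z))\<^sup>2)"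
      unfolding parseval_poly[OF deg] by (intro mult_right_mono sum_nonneg) auto
    also have "\<dots> \<le> 1 / real d * (\<Sum>j<d. (cmod (poly p (cis (2 * pi * \<theta> d j))))\<^sup>2)"
      using assms(4) by (intro small_deviation_lower_bound d deg dev' small(2)[of 0]) auto
    finally show ?thesis .
  next
    case False
    define h where "h = 160 * L\<^sup>2 * real N / g\<^sup>2"
    define X where "X = exp (L / h) * ((1 + exp (- (2 * pi * h))) / (1 - exp (- (2 * pi * h)))) * (4 * pi * h)\<^sup>2 * exp (4 * pi * h / \<delta>)"
    define Y where "Y = 7 * \<delta> * exp (960 * pi * L\<^sup>2 * real N / (\<delta> * g\<^sup>2))"
    let ?S = "1 / real d * (\<Sum>j<d. (cmod (poly p (cis (2 * pi * \<theta> d j))))\<^sup>2)"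
    have L7: "1 / 7 \<le> L" and N1: "1 \<le> real N" using False assms(6) by auto
    note ctx = g L7 N1 h_def
    have XY: "X \<le> Y" unfolding X_def Y_def by (rule constant_bound[OF ctx sepc(2,3)])
    have Y0: "Y > 0" using sepc(2) by (simp add: Y_def)
    have S0: "?S \<ge> 0" by (simp add: sum_nonneg)
    have sep: "\<delta> / real d \<le> infdist (\<theta> d i - \<theta> d j) \<int>" if "i < d" "j < d" "i \<noteq> j" for i j
      using sepc(1) d that inj[OF d] assms(2)[OF d] unfolding separated_by_def
      by (auto simp: inj_on_eq_iff)
    have \<rho>g: "4 * \<rho> = 1 - g" by (simp add: g_def)
    note phase = phase_bound[OF ctx \<rho> \<rho>g]
    have "s\<^sup>2 * circle_mean (\<lambda>z. (cmod (poly p z))\<^sup>2) \<le> X * ?S"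
      unfolding X_def
    proof (rule level_lower_bound)
      show "\<bar>\<theta> d j - real j / real d\<bar> \<le> L / real d" if "j < d" for j using dev'[OF d that] .
      show "\<bar>\<Sum>j = m * N..<(m + 1) * N. \<theta> d (j mod d) - real (j mod d) / real d\<bar> \<le> \<rho> * real N / real d"
        if "m < d" for m using block[OF d that] .
      show "\<delta> / real d \<le> infdist (\<theta> d i - \<theta> d j) \<int>" if "i < d" "j < d" "i \<noteq> j" for i j
        using sep[OF that] .
      show "s + 2 * exp (- (2 * pi * h)) / (1 - exp (- (2 * pi * h))) \<le>
          cos (pi / 2 - (pi / 4 + 1 / 4) * g)" unfolding s_def by (rule phase(3))
      show "0 \<le> s" using s0 by simp
    qed (fact d assms(4,6) h_pos[OF ctx] \<rho> sepc(2) phase(1,2) deg)+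
    also have "\<dots> \<le> Y * ?S" using XY S0 by (rule mult_right_mono)
    finally have "s\<^sup>2 * circle_mean (\<lambda>z. (cmod (poly p z))\<^sup>2) / Y \<le> ?S"
      using Y0 by (simp add: pos_divide_le_eq mult.commute)
    moreover have "T = s\<^sup>2 / Y"
    proof -
      have "1 / a * inverse e * x = x / (a * e)" for a e x :: real by (simp add: divide_inverse)
      thus ?thesis unfolding T_def Y_def exp_minus .
    qed
    ultimately show ?thesis by (simp only: times_divide_eq_left)
  qed
  \<comment> \<open>The upper bound at depth \<open>h = 1\<close>.\<close>
  define B where "B = exp L * ((1 + exp (- (2 * pi))) / (1 - exp (- (2 * pi)))) * exp (4 * pi)"
  have B0: "B > 0" by (simp add: B_def add_pos_pos)
  have MZ: "MZ_bounds \<Theta> T B"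
    unfolding MZ_bounds_def
  proof (intro allI impI)
    fix d :: nat and p :: "complex poly" assume d: "1 \<le> d" and deg: "degree p < d"
    have "(\<Sum>j<d. (cmod (poly p (cis (2 * pi * \<theta> d j))))\<^sup>2) \<le> real d * B * circle_mean (\<lambda>z. (cmod (poly p z))\<^sup>2)"
      using level_upper_bound[OF d zero_less_one dev'[OF d] deg] by (simp add: B_def)
    hence "1 / real d * (\<Sum>j<d. (cmod (poly p (cis (2 * pi * \<theta> d j))))\<^sup>2) \<le> B * circle_mean (\<lambda>z. (cmod (poly p z))\<^sup>2)"
      using d by (simp add: pos_divide_le_eq mult_ac)
    thus "T * (L2_norm_circle p)\<^sup>2 \<le> 1 / real d * (\<Sum>t\<in>\<Theta> d. (cmod (poly p (cis (2 * pi * t))))\<^sup>2) \<and>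
          1 / real d * (\<Sum>t\<in>\<Theta> d. (cmod (poly p (cis (2 * pi * t))))\<^sup>2) \<le> B * (L2_norm_circle p)\<^sup>2"
      unfolding L2_norm_circle_sq sum_nodes[OF d] using lower[OF d deg] by blast
  qed
  have "minimal_MZ_family \<Theta>" using minimal MZ T0 B0 by (auto simp: minimal_MZ_family_def)
  moreover have "T \<le> lower_MZ_bound \<Theta>" by (rule le_lower_MZ_bound[OF minimal T0 B0 MZ])
  ultimately show ?thesis unfolding T_def s_def g_def \<delta>_def by (rule conjI)
qed

end
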